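(* Let $(G,\omega^+)$ be a connected nilpotent symplectic Lie group endowed with its associated affine structure. Then any left invariant multivector field on $G$ is polynomial. In particular, any left invariant Poisson structure on $G$ is polynomial.
   Context: Lie groups are real and finite-dimensional. Let $G$ be a Lie group of dimension $n$ with Lie algebra $\mathcal{G}=T_eG$. For $u\in\mathcal{G}$, $u^+$ denotes the left invariant vector field on $G$ with value $u$ at $e$. A symplectic Lie group $(G,\omega^+)$ is a Lie group $G$ with a left invariant symplectic form $\omega^+$. Associated affine structure: the formula $$\omega^+(\nabla_{u^+}v^+,w^+)=-\omega^+(v^+,[u^+,w^+]),\qquad u,v,w\in\mathcal{G},$$ defines a left invariant flat and torsion free connection $\nabla$ on $G$, and hence an affine structure on $G$ (an atlas whose coordinate changes are locally restrictions of affine automorphisms of $\mathbb{R}^n$). Its affine charts are the local coordinates $(x_1,\ldots,x_n)$ (on connected open sets) with $\nabla dx_i=0$ for all $i$. A tensor field is polynomial if in affine coordinates its coefficients are polynomial functions of these coordinates. A Poisson structure is polynomial if its Poisson bivector is polynomial (equivalently, the space of local polynomial functions is closed under the Poisson bracket). *)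

theory Defs
  imports
    "HOL-Analysis.Analysis"
    "HOL-Algebra.Group"
    "HOL-Library.Function_Algebras"
begin

section \<open>Pointwise real vector space structure on function types\<close>

instantiation "fun" :: (type, real_vector) real_vector
begin

definition scaleR_fun :: "real \<Rightarrow> ('a \<Rightarrow> 'b) \<Rightarrow> 'a \<Rightarrow> 'b"
  where "scaleR_fun r f = (\<lambda>x. r *\<^sub>R f x)"

instance
  by standard (simp_all add: scaleR_fun_def fun_eq_iff scaleR_add_right scaleR_add_left)

end


section \<open>Smooth manifolds and smooth maps\<close>

text \<open>\<open>Ck_on k f S\<close> is only used for open \<open>S\<close>, where the derivatives
  do not depend on the values of \<open>f\<close> outside \<open>S\<close>.\<close>

fun Ck_on :: "nat \<Rightarrow> ('a::real_normed_vector \<Rightarrow> 'b::real_normed_vector) \<Rightarrow> 'a set \<Rightarrow> bool" where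
  "Ck_on 0 f S \<longleftrightarrow> continuous_on S f"
| "Ck_on (Suc k) f S \<longleftrightarrow>
     (\<forall>x\<in>S. f differentiable (at x)) \<and>
     (\<forall>v. Ck_on k (\<lambda>x. frechet_derivative f (at x) v) S)"

definition smooth_on :: "'a::real_normed_vector set \<Rightarrow> ('a \<Rightarrow> 'b::real_normed_vector) \<Rightarrow> bool" where
  "smooth_on S f \<longleftrightarrow> (\<forall>k. Ck_on k f S)"

type_synonym ('g, 'e) chart = "'g set \<times> ('g \<Rightarrow> 'e)"

definition is_chart :: "('g::topological_space, 'e::euclidean_space) chart \<Rightarrow> bool" where
  "is_chart c \<longleftrightarrow> (case c of (U, \<phi>) \<Rightarrow>
     open U \<and> open (\<phi> ` U) \<and> homeomorphism U (\<phi> ` U) \<phi> (inv_into U \<phi>))"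

definition compatible :: "('g, 'e::euclidean_space) chart \<Rightarrow> ('g, 'e) chart \<Rightarrow> bool" where
  "compatible c d \<longleftrightarrow> (case c of (U, \<phi>) \<Rightarrow> case d of (V, \<psi>) \<Rightarrow>
     smooth_on (\<phi> ` (U \<inter> V)) (\<psi> \<circ> inv_into U \<phi>) \<and>
     smooth_on (\<psi> ` (U \<inter> V)) (\<phi> \<circ> inv_into V \<psi>))"

definition smooth_atlas :: "('g::topological_space, 'e::euclidean_space) chart set \<Rightarrow> bool" where
  "smooth_atlas A \<longleftrightarrow>
     (\<Union>c\<in>A. fst c) = UNIV \<and> (\<forall>c\<in>A. is_chart c) \<and> (\<forall>c\<in>A. \<forall>d\<in>A. compatible c d)"

text \<open>Membership in the maximal atlas.\<close>

definition smooth_chart ::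
  "('g::topological_space, 'e::euclidean_space) chart set \<Rightarrow> ('g, 'e) chart \<Rightarrow> bool" where
  "smooth_chart A c \<longleftrightarrow> is_chart c \<and> (\<forall>d\<in>A. compatible c d)"

definition prod_atlas ::
  "('g, 'e) chart set \<Rightarrow> ('h, 'f) chart set \<Rightarrow> ('g \<times> 'h, 'e \<times> 'f) chart set" where
  "prod_atlas A B =
     {(U \<times> V, \<lambda>(p, q). (\<phi> p, \<psi> q)) | U \<phi> V \<psi>. (U, \<phi>) \<in> A \<and> (V, \<psi>) \<in> B}"

definition smooth_map ::
  "('g::topological_space, 'e::euclidean_space) chart set \<Rightarrow>
   ('h::topological_space, 'f::euclidean_space) chart set \<Rightarrow> ('g \<Rightarrow> 'h) \<Rightarrow> bool" where
  "smooth_map A B f \<longleftrightarrow> continuous_on UNIV f \<and>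
     (\<forall>(U, \<phi>)\<in>A. \<forall>(V, \<psi>)\<in>B.
        smooth_on (\<phi> ` (U \<inter> f -` V)) (\<psi> \<circ> f \<circ> inv_into U \<phi>))"

text \<open>Smooth real functions on an open subset \<open>U\<close> of the manifold.\<close>

definition smooth_fun ::
  "('g::topological_space, 'e::euclidean_space) chart set \<Rightarrow> 'g set \<Rightarrow> ('g \<Rightarrow> real) \<Rightarrow> bool" where
  "smooth_fun A U f \<longleftrightarrow> (\<forall>(V, \<phi>)\<in>A. smooth_on (\<phi> ` (U \<inter> V)) (f \<circ> inv_into V \<phi>))"

definition smooth_at ::
  "('g::topological_space, 'e::euclidean_space) chart set \<Rightarrow> 'g \<Rightarrow> ('g \<Rightarrow> real) \<Rightarrow> bool" where
  "smooth_at A p f \<longleftrightarrow> (\<exists>U. open U \<and> p \<in> U \<and> smooth_fun A U f)"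


section \<open>Tangent vectors and vector fields\<close>

text \<open>A tangent vector at \<open>p\<close> is identified with the directional derivative it defines on
  functions that are smooth near \<open>p\<close>.  So that equality of tangent vectors is equality of
  functionals, the value on all other functions is fixed to be \<open>0\<close>.\<close>

type_synonym 'g tvec = "('g \<Rightarrow> real) \<Rightarrow> real"
type_synonym 'g vfield = "'g \<Rightarrow> 'g tvec"

definition dir_deriv ::
  "('g::topological_space, 'e::euclidean_space) chart set \<Rightarrow> ('g, 'e) chart \<Rightarrow> 'g \<Rightarrow> 'e \<Rightarrow> 'g tvec" where
  "dir_deriv A c p v = (\<lambda>f. if smooth_at A p f
     then frechet_derivative (f \<circ> inv_into (fst c) (snd c)) (at (snd c p)) v else 0)"

definition tangent_space ::
  "('g::topological_space, 'e::euclidean_space) chart set \<Rightarrow> 'g \<Rightarrow> 'g tvec set" where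
  "tangent_space A p = {dir_deriv A c p v | c v. c \<in> A \<and> p \<in> fst c}"

definition vector_fields ::
  "('g::topological_space, 'e::euclidean_space) chart set \<Rightarrow> 'g vfield set" where
  "vector_fields A = {X. (\<forall>p. X p \<in> tangent_space A p) \<and>
     (\<forall>U f. open U \<longrightarrow> smooth_fun A U f \<longrightarrow> smooth_fun A U (\<lambda>q. X q f))}"

definition vf_bracket ::
  "('g::topological_space, 'e::euclidean_space) chart set \<Rightarrow> 'g vfield \<Rightarrow> 'g vfield \<Rightarrow> 'g vfield" where
  "vf_bracket A X Y = (\<lambda>p f. if smooth_at A p f
     then X p (\<lambda>q. Y q f) - Y p (\<lambda>q. X q f) else 0)"


section \<open>Differential forms\<close>

type_synonym 'g one_form = "'g \<Rightarrow> 'g tvec \<Rightarrow> real"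
type_synonym 'g two_form = "'g \<Rightarrow> 'g tvec \<Rightarrow> 'g tvec \<Rightarrow> real"

definition differential :: "('g \<Rightarrow> real) \<Rightarrow> 'g one_form" where
  "differential f = (\<lambda>p u. u f)"

definition is_two_form ::
  "('g::topological_space, 'e::euclidean_space) chart set \<Rightarrow> 'g two_form \<Rightarrow> bool" where
  "is_two_form A \<omega> \<longleftrightarrow>
     (\<forall>p. \<forall>u\<in>tangent_space A p. \<forall>v\<in>tangent_space A p. \<forall>w\<in>tangent_space A p. \<forall>a b.
        \<omega> p (a *\<^sub>R u + b *\<^sub>R v) w = a * \<omega> p u w + b * \<omega> p v w \<and>
        \<omega> p u v = - \<omega> p v u) \<and>
     (\<forall>X\<in>vector_fields A. \<forall>Y\<in>vector_fields A. smooth_fun A UNIV (\<lambda>p. \<omega> p (X p) (Y p)))"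

definition ext_deriv2 ::
  "('g::topological_space, 'e::euclidean_space) chart set \<Rightarrow> 'g two_form \<Rightarrow>
   'g vfield \<Rightarrow> 'g vfield \<Rightarrow> 'g vfield \<Rightarrow> 'g \<Rightarrow> real" where
  "ext_deriv2 A \<omega> X Y Z p =
     X p (\<lambda>q. \<omega> q (Y q) (Z q)) - Y p (\<lambda>q. \<omega> q (X q) (Z q)) + Z p (\<lambda>q. \<omega> q (X q) (Y q))
     - \<omega> p (vf_bracket A X Y p) (Z p) + \<omega> p (vf_bracket A X Z p) (Y p)
     - \<omega> p (vf_bracket A Y Z p) (X p)"

definition symplectic_form ::
  "('g::topological_space, 'e::euclidean_space) chart set \<Rightarrow> 'g two_form \<Rightarrow> bool" where
  "symplectic_form A \<omega> \<longleftrightarrow> is_two_form A \<omega> \<and>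
     (\<forall>X\<in>vector_fields A. \<forall>Y\<in>vector_fields A. \<forall>Z\<in>vector_fields A. \<forall>p.
        ext_deriv2 A \<omega> X Y Z p = 0) \<and>
     (\<forall>p. \<forall>u\<in>tangent_space A p. (\<forall>v\<in>tangent_space A p. \<omega> p u v = 0) \<longrightarrow> u = 0)"


section \<open>Multivector fields and Poisson structures\<close>

text \<open>An element of the \<open>k\<close>-th exterior power of the tangent space at \<open>p\<close> is regarded as the
  alternating map \<open>(f\<^sub>1, \<dots>, f\<^sub>k) \<mapsto> P (df\<^sub>1, \<dots>, df\<^sub>k)\<close> on functions, encoded as lists of
  length \<open>k\<close>: it is a tangent vector at \<open>p\<close> in each argument.  Values on lists of other lengths
  are irrelevant.\<close>

type_synonym 'g mvfield = "'g \<Rightarrow> ('g \<Rightarrow> real) list \<Rightarrow> real"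

definition multivector_at ::
  "('g::topological_space, 'e::euclidean_space) chart set \<Rightarrow> nat \<Rightarrow> 'g \<Rightarrow>
   (('g \<Rightarrow> real) list \<Rightarrow> real) \<Rightarrow> bool" where
  "multivector_at A k p P \<longleftrightarrow>
     (\<forall>fs. length fs = k \<longrightarrow>
        (\<forall>i<k. (\<lambda>f. P (fs[i := f])) \<in> tangent_space A p) \<and>
        (\<forall>i<k. \<forall>j<k. i \<noteq> j \<longrightarrow> fs ! i = fs ! j \<longrightarrow> P fs = 0))"

definition multivector_field ::
  "('g::topological_space, 'e::euclidean_space) chart set \<Rightarrow> nat \<Rightarrow> 'g mvfield \<Rightarrow> bool" where
  "multivector_field A k P \<longleftrightarrow> (\<forall>p. multivector_at A k p (P p)) \<and>
     (\<forall>U fs. open U \<longrightarrow> length fs = k \<longrightarrow> (\<forall>f\<in>set fs. smooth_fun A U f) \<longrightarrow>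
        smooth_fun A U (\<lambda>q. P q fs))"

definition poisson_bracket :: "'g mvfield \<Rightarrow> ('g \<Rightarrow> real) \<Rightarrow> ('g \<Rightarrow> real) \<Rightarrow> 'g \<Rightarrow> real" where
  "poisson_bracket \<pi> f g = (\<lambda>p. \<pi> p [f, g])"

definition poisson_structure ::
  "('g::topological_space, 'e::euclidean_space) chart set \<Rightarrow> 'g mvfield \<Rightarrow> bool" where
  "poisson_structure A \<pi> \<longleftrightarrow> multivector_field A 2 \<pi> \<and>
     (\<forall>f g h. smooth_fun A UNIV f \<longrightarrow> smooth_fun A UNIV g \<longrightarrow> smooth_fun A UNIV h \<longrightarrow>
        poisson_bracket \<pi> f (poisson_bracket \<pi> g h)
        + poisson_bracket \<pi> g (poisson_bracket \<pi> h f)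
        + poisson_bracket \<pi> h (poisson_bracket \<pi> f g) = 0)"


section \<open>Connections and their affine charts\<close>

definition connection ::
  "('g::topological_space, 'e::euclidean_space) chart set \<Rightarrow>
   ('g vfield \<Rightarrow> 'g vfield \<Rightarrow> 'g vfield) \<Rightarrow> bool" where
  "connection A nabla \<longleftrightarrow>
     (\<forall>X\<in>vector_fields A. \<forall>Y\<in>vector_fields A. \<forall>Z\<in>vector_fields A. \<forall>f. smooth_fun A UNIV f \<longrightarrow>
        nabla X Y \<in> vector_fields A \<and>
        nabla (X + Y) Z = nabla X Z + nabla Y Z \<and>
        nabla (\<lambda>p. f p *\<^sub>R X p) Y = (\<lambda>p. f p *\<^sub>R nabla X Y p) \<and>
        nabla X (Y + Z) = nabla X Y + nabla X Z \<and>
        nabla X (\<lambda>p. f p *\<^sub>R Y p) = (\<lambda>p. X p f *\<^sub>R Y p + f p *\<^sub>R nabla X Y p))"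

definition cov_deriv_form ::
  "('g vfield \<Rightarrow> 'g vfield \<Rightarrow> 'g vfield) \<Rightarrow> 'g vfield \<Rightarrow> 'g one_form \<Rightarrow> 'g vfield \<Rightarrow> 'g \<Rightarrow> real" where
  "cov_deriv_form nabla X \<alpha> Y p = X p (\<lambda>q. \<alpha> q (Y q)) - \<alpha> p (nabla X Y p)"

text \<open>The 1-forms \<open>dx\<^sub>i\<close> are only defined on \<open>U\<close>, but the value of their covariant derivative at a
  point of \<open>U\<close> is determined by evaluating it on global vector fields.\<close>

definition affine_chart ::
  "('g::topological_space, real ^ 'n) chart set \<Rightarrow> ('g vfield \<Rightarrow> 'g vfield \<Rightarrow> 'g vfield) \<Rightarrow>
   ('g, real ^ 'n) chart \<Rightarrow> bool" where
  "affine_chart A nabla c \<longleftrightarrow> (case c of (U, x) \<Rightarrow>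
     smooth_chart A (U, x) \<and> connected U \<and>
     (\<forall>i. \<forall>X\<in>vector_fields A. \<forall>Y\<in>vector_fields A. \<forall>p\<in>U.
        cov_deriv_form nabla X (differential (\<lambda>q. x q $ i)) Y p = 0))"

text \<open>The coefficients of a \<open>k\<close>-vector field \<open>P\<close> in the coordinates \<open>x\<close> are
  \<open>P (dx\<^bsub>i\<^sub>1\<^esub>, \<dots>, dx\<^bsub>i\<^sub>k\<^esub>)\<close>.\<close>

definition polynomial_multivector_field ::
  "('g::topological_space, real ^ 'n) chart set \<Rightarrow> ('g vfield \<Rightarrow> 'g vfield \<Rightarrow> 'g vfield) \<Rightarrow>
   nat \<Rightarrow> 'g mvfield \<Rightarrow> bool" where
  "polynomial_multivector_field A nabla k P \<longleftrightarrow>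
     (\<forall>U x. affine_chart A nabla (U, x) \<longrightarrow>
        (\<forall>is. length is = k \<longrightarrow>
           (\<exists>Q. real_polynomial_function Q \<and>
              (\<forall>p\<in>U. P p (map (\<lambda>i q. x q $ i) is) = Q (x p)))))"


section \<open>Lie groups\<close>

definition lie_group ::
  "'g monoid \<Rightarrow> ('g::{t2_space, second_countable_topology}, 'e::euclidean_space) chart set \<Rightarrow> bool" where
  "lie_group G A \<longleftrightarrow> group G \<and> carrier G = UNIV \<and> smooth_atlas A \<and>
     smooth_map (prod_atlas A A) A (\<lambda>(g, h). g \<otimes>\<^bsub>G\<^esub> h) \<and> smooth_map A A (m_inv G)"

text \<open>The differential of left translation by \<open>g\<close>, at any point.\<close>

definition left_push :: "'g monoid \<Rightarrow> 'g \<Rightarrow> 'g tvec \<Rightarrow> 'g tvec" where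
  "left_push G g u = (\<lambda>f. u (\<lambda>x. f (g \<otimes>\<^bsub>G\<^esub> x)))"

definition left_inv_field :: "'g monoid \<Rightarrow> 'g tvec \<Rightarrow> 'g vfield" where
  "left_inv_field G u = (\<lambda>g. left_push G g u)"

definition left_invariant_form ::
  "'g monoid \<Rightarrow> ('g::topological_space, 'e::euclidean_space) chart set \<Rightarrow> 'g two_form \<Rightarrow> bool" where
  "left_invariant_form G A \<omega> \<longleftrightarrow>
     (\<forall>g h. \<forall>u\<in>tangent_space A h. \<forall>v\<in>tangent_space A h.
        \<omega> (g \<otimes>\<^bsub>G\<^esub> h) (left_push G g u) (left_push G g v) = \<omega> h u v)"

definition left_invariant_multivector :: "'g monoid \<Rightarrow> nat \<Rightarrow> 'g mvfield \<Rightarrow> bool" where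
  "left_invariant_multivector G k P \<longleftrightarrow>
     (\<forall>g h fs. length fs = k \<longrightarrow>
        P (g \<otimes>\<^bsub>G\<^esub> h) fs = P h (map (\<lambda>f x. f (g \<otimes>\<^bsub>G\<^esub> x)) fs))"

abbreviation lie_algebra ::
  "'g monoid \<Rightarrow> ('g::topological_space, 'e::euclidean_space) chart set \<Rightarrow> 'g tvec set" where
  "lie_algebra G A \<equiv> tangent_space A \<one>\<^bsub>G\<^esub>"

definition lie_bracket ::
  "'g monoid \<Rightarrow> ('g::topological_space, 'e::euclidean_space) chart set \<Rightarrow>
   'g tvec \<Rightarrow> 'g tvec \<Rightarrow> 'g tvec" where
  "lie_bracket G A u v = vf_bracket A (left_inv_field G u) (left_inv_field G v) \<one>\<^bsub>G\<^esub>"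

fun lower_central ::
  "'g monoid \<Rightarrow> ('g::topological_space, 'e::euclidean_space) chart set \<Rightarrow> nat \<Rightarrow> 'g tvec set" where
  "lower_central G A 0 = lie_algebra G A"
| "lower_central G A (Suc k) =
     span {lie_bracket G A u v | u v. u \<in> lie_algebra G A \<and> v \<in> lower_central G A k}"

text \<open>Nilpotency of a (connected) Lie group is nilpotency of its Lie algebra.\<close>

definition nilpotent_lie_group ::
  "'g monoid \<Rightarrow> ('g::topological_space, 'e::euclidean_space) chart set \<Rightarrow> bool" where
  "nilpotent_lie_group G A \<longleftrightarrow> (\<exists>k. lower_central G A k = {0})"

definition symplectic_lie_group ::
  "'g monoid \<Rightarrow> ('g::{t2_space, second_countable_topology}, 'e::euclidean_space) chart set \<Rightarrow>
   'g two_form \<Rightarrow> bool" where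
  "symplectic_lie_group G A \<omega> \<longleftrightarrow>
     lie_group G A \<and> symplectic_form A \<omega> \<and> left_invariant_form G A \<omega>"

text \<open>The formula below determines a connection on \<open>G\<close> uniquely, as left invariant vector fields
  span the module of all vector fields.\<close>

definition associated_connection ::
  "'g monoid \<Rightarrow> ('g::topological_space, 'e::euclidean_space) chart set \<Rightarrow> 'g two_form \<Rightarrow>
   ('g vfield \<Rightarrow> 'g vfield \<Rightarrow> 'g vfield) \<Rightarrow> bool" where
  "associated_connection G A \<omega> nabla \<longleftrightarrow> connection A nabla \<and>
     (\<forall>u\<in>lie_algebra G A. \<forall>v\<in>lie_algebra G A. \<forall>w\<in>lie_algebra G A. \<forall>p.
        \<omega> p (nabla (left_inv_field G u) (left_inv_field G v) p) (left_inv_field G w p)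
        = - \<omega> p (left_inv_field G v p)
              (vf_bracket A (left_inv_field G u) (left_inv_field G w) p))"

end

(*
  In an affine chart x around a point p0, normalised so that x(p0) = 0 and that the left invariant
  frame E (the matrix of the components of the fields u^+) is the identity there, the affine structure
  says that the derivative of E v along E u is E (m u v), where m u v is the product on the Lie
  algebra corresponding to nabla_{u^+} v^+.  As the left multiplications L_u = m u are the negative
  adjoints of the ad_u with respect to the symplectic form, long products of them vanish.

  The affine fields r_u(y) = u + L_u y (right invariant fields, in group terms) commute with the
  columns of E: the commutators satisfy a homogeneous linear differential system and vanish at p0.
  Hence the derivative of E v along r_u is L_u (E v), and enough such derivatives kill every linear
  combination of the entries of E.  It remains to see that the matrix M with columns r_u has a
  polynomial inverse, since then functions with polynomial derivatives along all r_u are polynomial.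
  The polynomials p such that p M^-1 is polynomial form a nonzero ideal (it contains det M), which is
  stable under all r_u by the left symmetry of m.  The r_u act nilpotently on each polynomial because
  the L_u do, so this ideal contains a nonzero polynomial annihilated by all of them: a constant.

  Expanding a left invariant multivector field slot by slot in the frame E shows that its coefficients
  are polynomials in the entries of E.
*)
theory Submission
  imports Defs
begin

subsection \<open>Calculus of \<open>C\<^sup>k\<close> functions\<close>

text \<open>The structure equation differentiates \<open>E v\<close> along \<open>E u\<close>, that
  is, along the unknown itself, and the product forms inside: the result is
  \<open>E (m u v)\<close>. An induction over nilpotency needs the opposite, known directions and
  products that accumulate outside \<open>E\<close>. The fields \<open>r u\<close> provide both, and
  left symmetry is what makes them close under brackets. Their commutation with the frame comes from
  a uniqueness statement inside the chart, so no flow has to be constructed.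

  To integrate, derivatives along \<open>r u\<close> must become partial derivatives. Cramer's rule
  alone would leave the denominator det M and give rational functions only. At y the matrix M is the
  identity plus the right multiplication by y - y0, while nilpotency is known for left
  multiplications; constancy of det M is therefore not evident, and the ideal of denominators is the
  way around it. A further obstacle is that M could be singular far from the base point: being
  annihilated by all \<open>r u\<close> does not by itself mean constant. Membership in the ideal
  closes this gap, since for a denominator p every multiple of p(y) lies in the range of M at
  y.\<close>

lemma Ck_on_Suc_imp: "Ck_on (Suc k) f S \<Longrightarrow> Ck_on k f S"
proof (induction k arbitrary: f)
  case 0
  then show ?case
    by (auto intro!: differentiable_imp_continuous_within continuous_at_imp_continuous_on)
next
  case (Suc k)
  from Suc.prems[unfolded Ck_on.simps(2)[of "Suc k"]] have 1: "\<forall>x\<in>S. f differentiable (at x)"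
    and 2: "Ck_on (Suc k) (\<lambda>x. frechet_derivative f (at x) v) S" for v
    by blast+
  show ?case unfolding Ck_on.simps(2)[of k] using 1 Suc.IH[OF 2] by blast
qed

lemma Ck_on_subset: "Ck_on k f S \<Longrightarrow> T \<subseteq> S \<Longrightarrow> Ck_on k f T"
  by (induction k arbitrary: f) (auto intro: continuous_on_subset)

text \<open>Derivatives at a point of the open set \<open>S\<close> see only nearby values. Chart
  inverses built with \<open>inv_into\<close> are meaningful only on chart images, so many later
  smoothness claims pass through this rule.\<close>

lemma Ck_on_cong:
  assumes "open S" "\<And>x. x \<in> S \<Longrightarrow> f x = g x" "Ck_on k f S"
  shows "Ck_on k g S"
  using assms
proof (induction k arbitrary: f g)
  case 0
  then show ?case by (auto cong: continuous_on_cong)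
next
  case (Suc k)
  have fd: "f differentiable (at x)" if "x \<in> S" for x
    using Suc.prems(3) that by simp
  have der: "(g has_derivative frechet_derivative f (at x)) (at x)" if "x \<in> S" for x
    by (rule has_derivative_transform_within_open[OF _ \<open>open S\<close> that, of f])
       (use fd[OF that] Suc.prems(2) in \<open>auto simp flip: frechet_derivative_works\<close>)
  have eq: "frechet_derivative f (at x) = frechet_derivative g (at x)" if "x \<in> S" for x
    using frechet_derivative_at[OF der[OF that]] .
  have "Ck_on k (\<lambda>x. frechet_derivative g (at x) v) S" for v
    by (rule Suc.IH[OF Suc.prems(1), of "\<lambda>x. frechet_derivative f (at x) v"])
       (use eq Suc.prems(3) in auto)
  moreover have "g differentiable (at x)" if "x \<in> S" for x
    using der[OF that] unfolding differentiable_def by blast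
  ultimately show ?case by simp
qed

lemma Ck_on_local:
  assumes "\<And>x. x \<in> S \<Longrightarrow> \<exists>T. open T \<and> x \<in> T \<and> Ck_on k f T"
  shows "Ck_on k f S"
  using assms
proof (induction k arbitrary: f)
  case 0
  show ?case
    unfolding Ck_on.simps
  proof (intro continuous_at_imp_continuous_on ballI)
    fix x assume "x \<in> S"
    with 0 obtain T where "open T" "x \<in> T" "continuous_on T f" by force
    then show "isCont f x" by (simp add: continuous_on_eq_continuous_at)
  qed
next
  case (Suc k)
  have "f differentiable (at x)" if x: "x \<in> S" for x
  proof -
    from Suc.prems[OF x] obtain T where "x \<in> T" "Ck_on (Suc k) f T" by blast
    then show ?thesis by simp
  qed
  moreover have "Ck_on k (\<lambda>x. frechet_derivative f (at x) v) S" for v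
  proof (rule Suc.IH)
    fix x assume "x \<in> S"
    from Suc.prems[OF this] obtain T where "open T" "x \<in> T" "Ck_on (Suc k) f T" by blast
    then show "\<exists>T. open T \<and> x \<in> T \<and> Ck_on k (\<lambda>x. frechet_derivative f (at x) v) T"
      by (intro exI[of _ T]) simp
  qed
  ultimately show ?case by simp
qed

lemma Ck_on_const: "Ck_on k (\<lambda>x. c) S"
  by (induction k arbitrary: c) auto

lemma Ck_on_linear: "bounded_linear f \<Longrightarrow> Ck_on k f S"
proof (induction k)
  case 0
  then show ?case by (simp add: linear_continuous_on)
next
  case (Suc k)
  then have "frechet_derivative f (at x) = f" for x
    by (metis frechet_derivative_at bounded_linear_imp_has_derivative)
  then show ?case using Suc
    by (simp add: Ck_on_const bounded_linear_imp_differentiable)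
qed

lemma frechet_derivativeI: "(f has_derivative D) (at x) \<Longrightarrow> frechet_derivative f (at x) = D"
  using frechet_derivative_at by metis

lemma Ck_on_compose_linear:
  assumes "open S" "bounded_linear h" "Ck_on k f S"
  shows "Ck_on k (\<lambda>x. h (f x)) S"
  using assms(3)
proof (induction k arbitrary: f)
  case 0
  then show ?case using assms(2) by (simp add: bounded_linear.continuous_on)
next
  case (Suc k)
  have der: "((\<lambda>x. h (f x)) has_derivative (\<lambda>v. h (frechet_derivative f (at x) v))) (at x)"
    if "x \<in> S" for x
    using Suc.prems that by (intro bounded_linear.has_derivative[OF assms(2)])
      (auto simp: frechet_derivative_works)
  show ?case unfolding Ck_on.simps
  proof (intro conjI ballI allI)
    show "(\<lambda>x. h (f x)) differentiable at x" if "x \<in> S" for x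
      using der[OF that] by (auto simp: differentiable_def)
    show "Ck_on k (\<lambda>x. frechet_derivative (\<lambda>x. h (f x)) (at x) v) S" for v
      by (rule Ck_on_cong[OF assms(1) _ Suc.IH[of "\<lambda>x. frechet_derivative f (at x) v"]])
         (use Suc.prems in \<open>auto simp: frechet_derivativeI[OF der]\<close>)
  qed
qed

lemma Ck_on_add:
  assumes "open S" "Ck_on k f S" "Ck_on k g S"
  shows "Ck_on k (\<lambda>x. f x + g x) S"
  using assms(2,3)
proof (induction k arbitrary: f g)
  case 0
  then show ?case by (simp add: continuous_on_add)
next
  case (Suc k)
  have der: "((\<lambda>x. f x + g x) has_derivative
      (\<lambda>v. frechet_derivative f (at x) v + frechet_derivative g (at x) v)) (at x)"
    if "x \<in> S" for x
    using Suc.prems that by (intro has_derivative_add) (auto simp: frechet_derivative_works)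
  show ?case unfolding Ck_on.simps
  proof (intro conjI ballI allI)
    show "(\<lambda>x. f x + g x) differentiable at x" if "x \<in> S" for x
      using der[OF that] by (auto simp: differentiable_def)
    show "Ck_on k (\<lambda>x. frechet_derivative (\<lambda>x. f x + g x) (at x) v) S" for v
      by (rule Ck_on_cong[OF assms(1) _ Suc.IH[of "\<lambda>x. frechet_derivative f (at x) v"
           "\<lambda>x. frechet_derivative g (at x) v"]])
         (use Suc.prems in \<open>auto simp: frechet_derivativeI[OF der]\<close>)
  qed
qed

lemma Ck_on_sum:
  assumes "open S" "\<And>i. i \<in> I \<Longrightarrow> Ck_on k (f i) S"
  shows "Ck_on k (\<lambda>x. \<Sum>i\<in>I. f i x) S"
  using assms(2)
  by (induction I rule: infinite_finite_induct) (simp_all add: Ck_on_add assms(1) Ck_on_const)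

lemma Ck_on_scaleR:
  assumes "open S" "Ck_on k f S" "Ck_on k g S"
  shows "Ck_on k (\<lambda>x. f x *\<^sub>R g x) S"
  using assms(2,3)
proof (induction k arbitrary: f g)
  case 0
  then show ?case by (simp add: continuous_on_scaleR)
next
  case (Suc k)
  have der: "((\<lambda>x. f x *\<^sub>R g x) has_derivative
      (\<lambda>v. f x *\<^sub>R frechet_derivative g (at x) v + frechet_derivative f (at x) v *\<^sub>R g x)) (at x)"
    if "x \<in> S" for x
    using Suc.prems that by (intro has_derivative_scaleR) (auto simp: frechet_derivative_works)
  show ?case unfolding Ck_on.simps
  proof (intro conjI ballI allI)
    show "(\<lambda>x. f x *\<^sub>R g x) differentiable at x" if "x \<in> S" for x
      using der[OF that] by (auto simp: differentiable_def)
    show "Ck_on k (\<lambda>x. frechet_derivative (\<lambda>x. f x *\<^sub>R g x) (at x) v) S" for v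
    proof (rule Ck_on_cong[OF assms(1)])
      show "Ck_on k (\<lambda>x. f x *\<^sub>R frechet_derivative g (at x) v + frechet_derivative f (at x) v *\<^sub>R g x) S"
        using Suc.prems Ck_on_Suc_imp[OF Suc.prems(1)] Ck_on_Suc_imp[OF Suc.prems(2)]
        by (intro Ck_on_add assms(1) Suc.IH) auto
    qed (simp add: frechet_derivativeI[OF der])
  qed
qed

lemma Ck_on_Pair:
  assumes "open S" "Ck_on k f S" "Ck_on k g S"
  shows "Ck_on k (\<lambda>x. (f x, g x)) S"
proof -
  have "Ck_on k (\<lambda>x. (f x, 0) + (0, g x)) S"
    by (intro Ck_on_add assms Ck_on_compose_linear[OF assms(1) _ assms(2)]
         Ck_on_compose_linear[OF assms(1) _ assms(3)] bounded_linear_Pair bounded_linear_ident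
         bounded_linear_zero)
  then show ?thesis by simp
qed

text \<open>In the chain rule the outer derivative is taken in a moving direction, whereas the
  induction hypothesis treats fixed directions only. Expanding that direction in
  \<open>Basis\<close> leaves sums of products, which is why the intermediate space is
  Euclidean.\<close>

lemma Ck_on_compose:
  fixes f :: "'a::real_normed_vector \<Rightarrow> 'b::euclidean_space"
  assumes "open S" "open T" "f ` S \<subseteq> T" "Ck_on k f S" "Ck_on k g T"
  shows "Ck_on k (\<lambda>x. g (f x)) S"
  using assms(4,5)
proof (induction k arbitrary: g)
  case 0
  then show ?case
    using continuous_on_compose2[of T g S f] assms(3) by simp
next
  case (Suc k)
  have diff: "(f has_derivative frechet_derivative f (at x)) (at x)"
    "(g has_derivative frechet_derivative g (at (f x))) (at (f x))" if "x \<in> S" for x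
    using Suc.prems that assms(3) by (simp_all add: image_subset_iff flip: frechet_derivative_works)
  have der: "((\<lambda>x. g (f x)) has_derivative
      (\<lambda>v. frechet_derivative g (at (f x)) (frechet_derivative f (at x) v))) (at x)"
    if "x \<in> S" for x
    by (rule has_derivative_compose[OF diff[OF that]])
  have eq: "(\<Sum>b\<in>Basis. (frechet_derivative f (at x) v \<bullet> b) *\<^sub>R frechet_derivative g (at (f x)) b)
      = frechet_derivative (\<lambda>x. g (f x)) (at x) v" if "x \<in> S" for x v
  proof -
    have "linear (frechet_derivative g (at (f x)))"
      by (rule has_derivative_linear[OF diff(2)[OF that]])
    then have "frechet_derivative g (at (f x)) (\<Sum>b\<in>Basis. (w \<bullet> b) *\<^sub>R b) =
        (\<Sum>b\<in>Basis. (w \<bullet> b) *\<^sub>R frechet_derivative g (at (f x)) b)" for w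
      by (simp add: linear_sum linear_scale)
    from this[of "frechet_derivative f (at x) v"] show ?thesis
      by (simp only: frechet_derivativeI[OF der[OF that]] euclidean_representation)
  qed
  show ?case unfolding Ck_on.simps
  proof (intro conjI ballI allI)
    show "(\<lambda>x. g (f x)) differentiable at x" if "x \<in> S" for x
      using der[OF that] by (auto simp: differentiable_def)
    show "Ck_on k (\<lambda>x. frechet_derivative (\<lambda>x. g (f x)) (at x) v) S" for v
    proof (rule Ck_on_cong[OF assms(1) eq])
      show "Ck_on k (\<lambda>x. \<Sum>b\<in>Basis. (frechet_derivative f (at x) v \<bullet> b) *\<^sub>R
          frechet_derivative g (at (f x)) b) S"
      proof (rule Ck_on_sum[OF assms(1)], rule Ck_on_scaleR[OF assms(1)])
        fix b :: 'b
        show "Ck_on k (\<lambda>x. frechet_derivative f (at x) v \<bullet> b) S"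
          by (rule Ck_on_compose_linear[OF assms(1) bounded_linear_inner_left])
             (use Suc.prems in simp)
        show "Ck_on k (\<lambda>x. frechet_derivative g (at (f x)) b) S"
          by (rule Suc.IH[OF Ck_on_Suc_imp]) (use Suc.prems in simp_all)
      qed
    qed
  qed
qed

section \<open>Closure properties of smooth maps\<close>

lemma smooth_on_subset: "smooth_on S f \<Longrightarrow> T \<subseteq> S \<Longrightarrow> smooth_on T f"
  by (auto simp: smooth_on_def intro: Ck_on_subset)

lemma smooth_on_cong:
  "open S \<Longrightarrow> (\<And>x. x \<in> S \<Longrightarrow> f x = g x) \<Longrightarrow> smooth_on S f \<Longrightarrow> smooth_on S g"
  unfolding smooth_on_def using Ck_on_cong by metis

lemma smooth_on_local:
  "(\<And>x. x \<in> S \<Longrightarrow> \<exists>T. open T \<and> x \<in> T \<and> smooth_on T f) \<Longrightarrow> smooth_on S f"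
  unfolding smooth_on_def by (intro allI Ck_on_local) blast

lemma smooth_on_const: "smooth_on S (\<lambda>x. c)"
  by (simp add: smooth_on_def Ck_on_const)

lemma smooth_on_linear: "bounded_linear f \<Longrightarrow> smooth_on S f"
  by (simp add: smooth_on_def Ck_on_linear)

lemma smooth_on_add:
  "open S \<Longrightarrow> smooth_on S f \<Longrightarrow> smooth_on S g \<Longrightarrow> smooth_on S (\<lambda>x. f x + g x)"
  by (simp add: smooth_on_def Ck_on_add)

lemma smooth_on_scaleR:
  "open S \<Longrightarrow> smooth_on S f \<Longrightarrow> smooth_on S g \<Longrightarrow> smooth_on S (\<lambda>x. f x *\<^sub>R g x)"
  by (simp add: smooth_on_def Ck_on_scaleR)

lemma smooth_on_sum:
  "open S \<Longrightarrow> (\<And>i. i \<in> I \<Longrightarrow> smooth_on S (f i)) \<Longrightarrow> smooth_on S (\<lambda>x. \<Sum>i\<in>I. f i x)"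
  by (simp add: smooth_on_def Ck_on_sum)

lemma smooth_on_Pair:
  "open S \<Longrightarrow> smooth_on S f \<Longrightarrow> smooth_on S g \<Longrightarrow> smooth_on S (\<lambda>x. (f x, g x))"
  by (simp add: smooth_on_def Ck_on_Pair)

lemma smooth_on_compose:
  fixes f :: "'a::real_normed_vector \<Rightarrow> 'b::euclidean_space"
  shows "open S \<Longrightarrow> open T \<Longrightarrow> f ` S \<subseteq> T \<Longrightarrow> smooth_on S f \<Longrightarrow> smooth_on T g \<Longrightarrow>
    smooth_on S (\<lambda>x. g (f x))"
  by (simp add: smooth_on_def Ck_on_compose)

lemma smooth_on_compose_linear:
  "open S \<Longrightarrow> bounded_linear h \<Longrightarrow> smooth_on S f \<Longrightarrow> smooth_on S (\<lambda>x. h (f x))"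
  by (simp add: smooth_on_def Ck_on_compose_linear)

lemma smooth_on_frechet_derivative:
  "smooth_on S f \<Longrightarrow> smooth_on S (\<lambda>x. frechet_derivative f (at x) v)"
  unfolding smooth_on_def
proof
  fix k assume "\<forall>k. Ck_on k f S"
  then have "Ck_on (Suc k) f S" by blast
  then show "Ck_on k (\<lambda>x. frechet_derivative f (at x) v) S" by simp
qed

lemma smooth_on_imp_differentiable:
  "smooth_on S f \<Longrightarrow> x \<in> S \<Longrightarrow> f differentiable (at x)"
  unfolding smooth_on_def by (drule spec[of _ 1]) simp

lemma smooth_on_imp_has_derivative:
  "smooth_on S f \<Longrightarrow> x \<in> S \<Longrightarrow> (f has_derivative frechet_derivative f (at x)) (at x)"
  using smooth_on_imp_differentiable frechet_derivative_works by blast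

lemma smooth_on_imp_continuous_on: "smooth_on S f \<Longrightarrow> continuous_on S f"
  unfolding smooth_on_def by (drule spec[of _ 0]) simp

lemma smooth_on_vec:
  fixes f :: "'a::real_normed_vector \<Rightarrow> real ^ 'n"
  assumes "open S" "\<And>i. smooth_on S (\<lambda>x. f x $ i)"
  shows "smooth_on S f"
proof -
  have "smooth_on S (\<lambda>x. \<Sum>i\<in>UNIV. f x $ i *\<^sub>R axis i (1::real))"
    by (intro smooth_on_sum smooth_on_scaleR assms smooth_on_const)
  moreover have "(\<Sum>i\<in>UNIV. f x $ i *\<^sub>R axis i (1::real)) = f x" for x
    by (simp add: vec_eq_iff axis_def if_distrib cong: if_cong)
  ultimately show ?thesis by simp
qed

lemma linear_sum_axis:
  fixes L :: "real ^ 'n \<Rightarrow> 'b::real_vector"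
  assumes "linear L"
  shows "L w = (\<Sum>i\<in>UNIV. w $ i *\<^sub>R L (axis i 1))"
proof -
  have "w = (\<Sum>i\<in>UNIV. w $ i *\<^sub>R axis i (1::real))"
    by (simp add: vec_eq_iff axis_def if_distrib cong: if_cong)
  then show ?thesis
    by (metis (no_types, lifting) assms linear_scale linear_sum sum.cong)
qed

text \<open>Schwarz's theorem: the second difference of \<open>f\<close> over the parallelogram spanned by
  \<open>s *\<^sub>R v\<close> and \<open>s *\<^sub>R w\<close> is \<open>s\<^sup>2\<close> times either mixed derivative at a nearby point.\<close>

lemma second_difference:
  fixes f :: "'a::real_normed_vector \<Rightarrow> real"
  assumes S: "\<And>a b. a \<in> {0..s} \<Longrightarrow> b \<in> {0..s} \<Longrightarrow> x + a *\<^sub>R v + b *\<^sub>R w \<in> S"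
    and f: "Ck_on 2 f S" and s: "0 < s"
  shows "\<exists>a\<in>{0..s}. \<exists>b\<in>{0..s}.
     f (x + s *\<^sub>R v + s *\<^sub>R w) - f (x + s *\<^sub>R v) - f (x + s *\<^sub>R w) + f x =
     s\<^sup>2 * frechet_derivative (\<lambda>y. frechet_derivative f (at y) v) (at (x + a *\<^sub>R v + b *\<^sub>R w)) w"
proof -
  define f1 where "f1 y = frechet_derivative f (at y) v" for y
  define D2 where "D2 y = frechet_derivative f1 (at y) w" for y
  have d1: "(f has_derivative frechet_derivative f (at y)) (at y)" if "y \<in> S" for y
    using f that by (auto simp: numeral_2_eq_2 frechet_derivative_works)
  have d2: "(f1 has_derivative frechet_derivative f1 (at y)) (at y)" if "y \<in> S" for y
    using f that by (auto simp: numeral_2_eq_2 frechet_derivative_works f1_def[abs_def])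
  have p1: "((\<lambda>a. f (x + a *\<^sub>R v + b *\<^sub>R w)) has_real_derivative f1 (x + a *\<^sub>R v + b *\<^sub>R w)) (at a)"
    if "a \<in> {0..s}" "b \<in> {0..s}" for a b
  proof -
    have "((\<lambda>a. x + a *\<^sub>R v + b *\<^sub>R w) has_derivative (\<lambda>h. h *\<^sub>R v)) (at a)"
      by (auto intro!: derivative_eq_intros)
    from has_derivative_compose[OF this d1[OF S[OF that]]]
    moreover have "frechet_derivative f (at (x + a *\<^sub>R v + b *\<^sub>R w)) (h *\<^sub>R v) = f1 (x + a *\<^sub>R v + b *\<^sub>R w) * h" for h
      using linear_scale[OF has_derivative_linear[OF d1[OF S[OF that]]]] by (simp add: f1_def)
    ultimately show ?thesis by (simp add: has_field_derivative_def)
  qed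
  have p2: "((\<lambda>b. f1 (x + a *\<^sub>R v + b *\<^sub>R w)) has_real_derivative D2 (x + a *\<^sub>R v + b *\<^sub>R w)) (at b)"
    if "a \<in> {0..s}" "b \<in> {0..s}" for a b
  proof -
    have "((\<lambda>b. x + a *\<^sub>R v + b *\<^sub>R w) has_derivative (\<lambda>h. h *\<^sub>R w)) (at b)"
      by (auto intro!: derivative_eq_intros)
    from has_derivative_compose[OF this d2[OF S[OF that]]]
    moreover have "frechet_derivative f1 (at (x + a *\<^sub>R v + b *\<^sub>R w)) (h *\<^sub>R w) = D2 (x + a *\<^sub>R v + b *\<^sub>R w) * h" for h
      using linear_scale[OF has_derivative_linear[OF d2[OF S[OF that]]]] by (simp add: D2_def)
    ultimately show ?thesis by (simp add: has_field_derivative_def)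
  qed
  have "\<exists>a. a > 0 \<and> a < s \<and>
     (f (x + s *\<^sub>R v + s *\<^sub>R w) - f (x + s *\<^sub>R v + 0 *\<^sub>R w)) - (f (x + 0 *\<^sub>R v + s *\<^sub>R w) - f (x + 0 *\<^sub>R v + 0 *\<^sub>R w))
      = (s - 0) * (f1 (x + a *\<^sub>R v + s *\<^sub>R w) - f1 (x + a *\<^sub>R v + 0 *\<^sub>R w))"
    using s by (intro MVT2 DERIV_diff p1) auto
  then obtain a where a: "0 < a" "a < s" and
    e1: "f (x + s *\<^sub>R v + s *\<^sub>R w) - f (x + s *\<^sub>R v) - f (x + s *\<^sub>R w) + f x
      = s * (f1 (x + a *\<^sub>R v + s *\<^sub>R w) - f1 (x + a *\<^sub>R v + 0 *\<^sub>R w))"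
    by auto
  have "\<exists>b. b > 0 \<and> b < s \<and> f1 (x + a *\<^sub>R v + s *\<^sub>R w) - f1 (x + a *\<^sub>R v + 0 *\<^sub>R w)
      = (s - 0) * D2 (x + a *\<^sub>R v + b *\<^sub>R w)"
    using s a by (intro MVT2 p2) auto
  then obtain b where "0 < b" "b < s" 
    "f1 (x + a *\<^sub>R v + s *\<^sub>R w) - f1 (x + a *\<^sub>R v + 0 *\<^sub>R w) = s * D2 (x + a *\<^sub>R v + b *\<^sub>R w)"
    by auto
  with e1 a show ?thesis
    by - (rule bexI[of _ a], rule bexI[of _ b], auto simp: D2_def f1_def[abs_def] power2_eq_square)
qed

text \<open>The second difference does not change when \<open>v\<close> and \<open>w\<close> are
  exchanged. So the two mixed derivatives agree at suitable points of shrinking parallelograms, and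
  continuity at \<open>x\<close> finishes.\<close>

lemma Ck_on_2_derivative_symmetric:
  fixes f :: "'a::real_normed_vector \<Rightarrow> real"
  assumes "open S" "x \<in> S" and f: "Ck_on 2 f S"
  shows "frechet_derivative (\<lambda>y. frechet_derivative f (at y) v) (at x) w =
         frechet_derivative (\<lambda>y. frechet_derivative f (at y) w) (at x) v"
    (is "?A v w x = ?A w v x")
proof -
  let ?A = "\<lambda>v w x. frechet_derivative (\<lambda>y. frechet_derivative f (at y) v) (at x) w"
  obtain e where e: "e > 0" "ball x e \<subseteq> S" using assms openE by blast
  \<comment> \<open>The summand 1 keeps \<open>c\<close> positive when \<open>v\<close> and
    \<open>w\<close> vanish. With \<open>s n\<close> as below, the parallelogram stays within
    distance \<open>e / (n + 1)\<close> of \<open>x\<close>, hence inside the ball once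
    \<open>n \<ge> 1\<close>.\<close>
  define c where "c = norm v + norm w + 1"
  have c: "c > 0" by (simp add: c_def add_nonneg_pos)
  define s where "s n = e / (c * (n + 1))" for n :: nat
  have s0: "s n > 0" for n using e c by (simp add: s_def)
  have near: "norm (a *\<^sub>R v + b *\<^sub>R w) \<le> c * s n" if "a \<in> {0..s n}" "b \<in> {0..s n}" for a b n
  proof -
    have "norm (a *\<^sub>R v + b *\<^sub>R w) \<le> a * norm v + b * norm w"
      using that norm_triangle_ineq[of "a *\<^sub>R v" "b *\<^sub>R w"] by simp
    also have "\<dots> \<le> s n * norm v + s n * norm w"
      using that by (intro add_mono mult_right_mono) auto
    also have "\<dots> \<le> c * s n" using s0[of n] by (simp add: c_def algebra_simps)
    finally show ?thesis .
  qed
  have cs: "c * s n = e / (n + 1)" for n using c by (simp add: s_def)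
  have cs_less: "c * s n \<le> e * (1/2)" if "n \<ge> 1" for n
  proof -
    have "e / (n + 1) \<le> e / 2" using that e by (intro divide_left_mono) auto
    then show ?thesis by (simp add: cs)
  qed
  have inS: "x + a *\<^sub>R v + b *\<^sub>R w \<in> S" if "n \<ge> 1" "a \<in> {0..s n}" "b \<in> {0..s n}" for a b n
  proof -
    have "norm (a *\<^sub>R v + b *\<^sub>R w) < e" using near[OF that(2,3)] cs_less[OF that(1)] e by simp
    then have "x + (a *\<^sub>R v + b *\<^sub>R w) \<in> ball x e"
      by (metis add_diff_cancel_left' dist_commute dist_norm mem_ball)
    then show ?thesis using e by (auto simp: add.assoc)
  qed
  have inS': "x + a *\<^sub>R w + b *\<^sub>R v \<in> S" if "n \<ge> 1" "a \<in> {0..s n}" "b \<in> {0..s n}" for a b n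
    using inS[OF that(1,3,2)] by (simp add: add_ac)
  have cs0: "(\<lambda>n. c * s n) \<longlonglongrightarrow> 0"
    unfolding cs using LIMSEQ_Suc[OF lim_const_over_n[of e]] by simp
  have lim: "(\<lambda>n. ?A v w (q n)) \<longlonglongrightarrow> ?A v w x"
    if "\<And>n. n \<ge> 1 \<Longrightarrow> norm (q n - x) \<le> c * s n" for q v w
  proof (rule isCont_tendsto_compose[of x "?A v w" q])
    have "continuous_on S (?A v w)" using f by (simp add: numeral_2_eq_2)
    then show "isCont (?A v w) x" using assms by (simp add: continuous_on_eq_continuous_at)
    have "(\<lambda>n. q n - x) \<longlonglongrightarrow> 0"
      by (rule Lim_null_comparison[OF _ cs0]) (use that eventually_sequentially in blast)
    then show "q \<longlonglongrightarrow> x" by (simp add: LIM_zero_iff)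
  qed
  have "\<forall>n\<ge>1. \<exists>a\<in>{0..s n}. \<exists>b\<in>{0..s n}. \<exists>a'\<in>{0..s n}. \<exists>b'\<in>{0..s n}.
      ?A v w (x + a *\<^sub>R v + b *\<^sub>R w) = ?A w v (x + a' *\<^sub>R w + b' *\<^sub>R v)"
  proof (intro allI impI)
    fix n :: nat assume n: "n \<ge> 1"
    obtain a b where ab: "a\<in>{0..s n}" "b\<in>{0..s n}"
      "f (x + s n *\<^sub>R v + s n *\<^sub>R w) - f (x + s n *\<^sub>R v) - f (x + s n *\<^sub>R w) + f x = (s n)\<^sup>2 * ?A v w (x + a *\<^sub>R v + b *\<^sub>R w)"
      using second_difference[OF inS[OF n] f s0] by blast
    obtain a' b' where ab': "a'\<in>{0..s n}" "b'\<in>{0..s n}"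
      "f (x + s n *\<^sub>R w + s n *\<^sub>R v) - f (x + s n *\<^sub>R w) - f (x + s n *\<^sub>R v) + f x = (s n)\<^sup>2 * ?A w v (x + a' *\<^sub>R w + b' *\<^sub>R v)"
      using second_difference[OF inS'[OF n] f s0] by blast
    have comm: "x + s n *\<^sub>R w + s n *\<^sub>R v = x + s n *\<^sub>R v + s n *\<^sub>R w" by (simp add: add_ac)
    have "(s n)\<^sup>2 * ?A v w (x + a *\<^sub>R v + b *\<^sub>R w) = (s n)\<^sup>2 * ?A w v (x + a' *\<^sub>R w + b' *\<^sub>R v)"
      using ab(3) ab'(3)[unfolded comm] by linarith
    then show "\<exists>a\<in>{0..s n}. \<exists>b\<in>{0..s n}. \<exists>a'\<in>{0..s n}. \<exists>b'\<in>{0..s n}.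
      ?A v w (x + a *\<^sub>R v + b *\<^sub>R w) = ?A w v (x + a' *\<^sub>R w + b' *\<^sub>R v)"
      using s0[of n] ab ab' by (metis mult_left_cancel power_not_zero less_irrefl)
  qed
  then obtain a b a' b' where q: "\<And>n. n \<ge> 1 \<Longrightarrow> a n \<in> {0..s n} \<and> b n \<in> {0..s n} \<and>
      a' n \<in> {0..s n} \<and> b' n \<in> {0..s n} \<and>
      ?A v w (x + a n *\<^sub>R v + b n *\<^sub>R w) = ?A w v (x + a' n *\<^sub>R w + b' n *\<^sub>R v)"
    by metis
  have l1: "(\<lambda>n. ?A v w (x + a n *\<^sub>R v + b n *\<^sub>R w)) \<longlonglongrightarrow> ?A v w x"
  proof (rule lim)
    fix n :: nat assume "n \<ge> 1"
    then show "norm (x + a n *\<^sub>R v + b n *\<^sub>R w - x) \<le> c * s n"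
      using near[of "a n" n "b n"] q[of n] by (simp add: algebra_simps)
  qed
  have l2: "(\<lambda>n. ?A w v (x + a' n *\<^sub>R w + b' n *\<^sub>R v)) \<longlonglongrightarrow> ?A w v x"
  proof (rule lim)
    fix n :: nat assume "n \<ge> 1"
    then show "norm (x + a' n *\<^sub>R w + b' n *\<^sub>R v - x) \<le> c * s n"
      using near[of "b' n" n "a' n"] q[of n] by (simp add: algebra_simps)
  qed
  have "(\<lambda>n. ?A w v (x + a' n *\<^sub>R w + b' n *\<^sub>R v)) \<longlonglongrightarrow> ?A v w x"
    using q by (intro Lim_transform_eventually[OF l1]) (auto simp: eventually_sequentially intro!: exI[of _ 1])
  with l2 show ?thesis using LIMSEQ_unique by blast
qed

text \<open>The direction \<open>\<eta>\<close> moves, so it is expanded in coordinates; symmetry of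
  the second derivative then reassembles the sum into a single derivative in the direction
  \<open>\<eta> x\<close>.\<close>

lemma has_derivative_frechet_field:
  fixes f :: "real ^ 'n \<Rightarrow> real"
  assumes S: "open S" "x \<in> S" and f: "Ck_on 2 f S"
    and \<eta>: "(\<eta> has_derivative \<eta>') (at x)"
  shows "((\<lambda>y. frechet_derivative f (at y) (\<eta> y)) has_derivative
     (\<lambda>w. frechet_derivative f (at x) (\<eta>' w) +
        frechet_derivative (\<lambda>y. frechet_derivative f (at y) w) (at x) (\<eta> x))) (at x)"
proof -
  define g where "g i y = frechet_derivative f (at y) (axis i 1)" for i y
  have lin: "linear (frechet_derivative f (at y))" if "y \<in> S" for y
    using f that by (auto simp: numeral_2_eq_2 linear_frechet_derivative)
  have g: "(g i has_derivative frechet_derivative (g i) (at x)) (at x)" for i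
    using f S by (auto simp: numeral_2_eq_2 frechet_derivative_works g_def[abs_def])
  have d: "((\<lambda>y. \<Sum>i\<in>UNIV. \<eta> y $ i * g i y) has_derivative
      (\<lambda>w. \<Sum>i\<in>UNIV. \<eta> x $ i * frechet_derivative (g i) (at x) w + \<eta>' w $ i * g i x)) (at x)"
    by (intro has_derivative_sum has_derivative_mult g bounded_linear.has_derivative[OF bounded_linear_vec_nth \<eta>])
  have lin2: "linear (frechet_derivative (\<lambda>y. frechet_derivative f (at y) w) (at x))" for w
    using f S by (auto simp: numeral_2_eq_2 linear_frechet_derivative)
  have e1: "(\<Sum>i\<in>UNIV. \<eta> x $ i * frechet_derivative (g i) (at x) w) =
     frechet_derivative (\<lambda>y. frechet_derivative f (at y) w) (at x) (\<eta> x)" for w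
    unfolding linear_sum_axis[OF lin2, of _ "\<eta> x"]
    by (simp add: g_def[abs_def] Ck_on_2_derivative_symmetric[OF S f, of _ w])
  have e2: "(\<Sum>i\<in>UNIV. w $ i * g i y) = frechet_derivative f (at y) w" if "y \<in> S" for y w
    unfolding linear_sum_axis[OF lin[OF that], of w] by (simp add: g_def)
  show ?thesis
    by (rule has_derivative_transform_within_open[OF has_derivative_eq_rhs[OF d] S])
       (auto simp: sum.distrib e1 e2 S fun_eq_iff)
qed

text \<open>The second order terms cancel by Schwarz's theorem, which leaves the derivative along
  the coordinate expression of the Lie bracket. It serves both for brackets on the manifold and for
  the fields \<open>r a\<close> and \<open>E _ u\<close> in a chart.\<close>

lemma commutator_derivative:
  fixes f :: "real ^ 'n \<Rightarrow> real"
  assumes S: "open S" "x \<in> S" and f: "Ck_on 2 f S"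
    and \<xi>: "(\<xi> has_derivative \<xi>') (at x)" and \<eta>: "(\<eta> has_derivative \<eta>') (at x)"
  shows "frechet_derivative (\<lambda>y. frechet_derivative f (at y) (\<eta> y)) (at x) (\<xi> x)
       - frechet_derivative (\<lambda>y. frechet_derivative f (at y) (\<xi> y)) (at x) (\<eta> x)
       = frechet_derivative f (at x) (\<eta>' (\<xi> x) - \<xi>' (\<eta> x))"
proof -
  have "linear (frechet_derivative f (at x))"
    using f S by (auto simp: numeral_2_eq_2 linear_frechet_derivative)
  then show ?thesis
    by (simp add: frechet_derivativeI[OF has_derivative_frechet_field[OF S f \<xi>]]
        frechet_derivativeI[OF has_derivative_frechet_field[OF S f \<eta>]] linear_diff
        Ck_on_2_derivative_symmetric[OF S f, of "\<xi> x"])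
qed


subsection \<open>Polynomial functions\<close>

lemmas real_polynomial_linear = real_polynomial_function.intros(1)
  and real_polynomial_const = real_polynomial_function.intros(2)
  and real_polynomial_add = real_polynomial_function.intros(3)
  and real_polynomial_mult = real_polynomial_function.intros(4)

lemma real_polynomial_vec_nth: "real_polynomial_function (\<lambda>z::real^'n. z $ i)"
  by (intro real_polynomial_linear bounded_linear_vec_nth)

lemma polynomial_affine: "polynomial_function (\<lambda>t::real. a + t *\<^sub>R z)"
  by (intro polynomial_function_add polynomial_function_const polynomial_function_mult
      polynomial_function_id)

text \<open>On the line through \<open>x\<close> and \<open>y\<close> the function is a polynomial
  in one variable with infinitely many zeros. This extends polynomial identities from a
  neighbourhood to the whole space.\<close>

lemma real_polynomial_zero_on_open:
  assumes p: "real_polynomial_function p" and T: "open T" "x \<in> T" "\<And>y. y \<in> T \<Longrightarrow> p y = 0"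
  shows "p y = 0"
proof -
  have "real_polynomial_function (\<lambda>t::real. p (x + t *\<^sub>R (y - x)))"
    using real_polynomial_function_compose[OF polynomial_affine p] by (simp add: o_def)
  from real_polynomial_function_imp_sum[OF this] obtain a n
    where "(\<lambda>t::real. p (x + t *\<^sub>R (y - x))) = (\<lambda>t. \<Sum>i\<le>n. a i * t^i)" by blast
  then have eq: "p (x + t *\<^sub>R (y - x)) = (\<Sum>i\<le>n. a i * t^i)" for t by (rule fun_cong)
  have "open ((\<lambda>t::real. x + t *\<^sub>R (y - x)) -` T)"
    by (intro open_vimage T continuous_intros)
  moreover have "0 \<in> (\<lambda>t::real. x + t *\<^sub>R (y - x)) -` T" using T by simp
  ultimately have "infinite ((\<lambda>t::real. x + t *\<^sub>R (y - x)) -` T)"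
    using finite_imp_not_open by blast
  moreover have "(\<lambda>t::real. x + t *\<^sub>R (y - x)) -` T \<subseteq> {t. (\<Sum>i\<le>n. a i * t^i) = 0}"
    using T(3) by (auto simp flip: eq)
  ultimately have "infinite {t. (\<Sum>i\<le>n. a i * t^i) = 0}"
    using finite_subset by blast
  then have "\<forall>i\<le>n. a i = 0" using polyfun_finite_roots by blast
  then show ?thesis using eq[of 1] by simp
qed

lemma real_polynomial_has_derivative:
  assumes "real_polynomial_function p"
  shows "(p has_derivative frechet_derivative p (at y)) (at y)"
  using differentiable_at_real_polynomial_function[OF assms] frechet_derivative_works by blast

lemma real_polynomial_frechet_derivative:
  assumes "real_polynomial_function p"
  shows "real_polynomial_function (\<lambda>y. frechet_derivative p (at y) v)"
  using assms
proof induction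
  case (linear f)
  then have "frechet_derivative f (at y) = f" for y
    by (intro frechet_derivativeI bounded_linear_imp_has_derivative)
  then show ?case by (simp add: real_polynomial_const)
next
  case (const c)
  then show ?case by (simp add: real_polynomial_const)
next
  case (add f g)
  have "frechet_derivative (\<lambda>x. f x + g x) (at y) =
      (\<lambda>v. frechet_derivative f (at y) v + frechet_derivative g (at y) v)" for y
    by (intro frechet_derivativeI has_derivative_add real_polynomial_has_derivative add)
  then show ?case using add by (simp add: real_polynomial_add)
next
  case (mult f g)
  have "frechet_derivative (\<lambda>x. f x * g x) (at y) =
      (\<lambda>v. f y * frechet_derivative g (at y) v + frechet_derivative f (at y) v * g y)" for y
    by (intro frechet_derivativeI has_derivative_mult real_polynomial_has_derivative mult)
  then show ?case using mult by auto
qed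

lemma real_polynomial_directional_derivative:
  fixes p :: "real ^ 'n \<Rightarrow> real"
  assumes p: "real_polynomial_function p" and q: "\<And>i. real_polynomial_function (\<lambda>y. q y $ i)"
  shows "real_polynomial_function (\<lambda>y. frechet_derivative p (at y) (q y))"
proof -
  have "frechet_derivative p (at y) (q y) = (\<Sum>i\<in>UNIV. q y $ i * frechet_derivative p (at y) (axis i 1))" for y
    using linear_sum_axis[OF has_derivative_linear[OF real_polynomial_has_derivative[OF p]], of y "q y"]
    by simp
  then show ?thesis
    by (simp add: q real_polynomial_frechet_derivative[OF p] real_polynomial_function_sum
        real_polynomial_mult)
qed

text \<open>Since the coefficients are polynomial in the direction \<open>z\<close>, integrating
  term by term in \<open>t\<close> gives a polynomial in \<open>z\<close> again. Their vanishing
  beyond \<open>N\<close> lets sums of different lengths be added and multiplied.\<close>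

lemma real_polynomial_on_rays:
  assumes "real_polynomial_function p"
  shows "\<exists>N c. (\<forall>k. real_polynomial_function (c k)) \<and> (\<forall>k>N. c k = (\<lambda>z. 0)) \<and>
     (\<forall>t z. p (a + t *\<^sub>R z) = (\<Sum>k\<le>N. c k z * t ^ k))"
  using assms
proof induction
  case (linear f)
  let ?c = "\<lambda>k::nat. if k = 0 then (\<lambda>z. f a) else if k = 1 then f else (\<lambda>z. 0)"
  have "f (a + t *\<^sub>R z) = (\<Sum>k\<le>1. ?c k z * t ^ k)" for t z
    using linear by (simp add: bounded_linear_def linear_add linear_scale)
  then show ?case using linear
    by (intro exI[of _ 1] exI[of _ ?c]) auto
next
  case (const c)
  then show ?case
    by (intro exI[of _ 0] exI[of _ "\<lambda>k z. if k = 0 then c else 0"])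
       (auto simp: real_polynomial_const)
next
  case (add f g)
  from add.IH(1) obtain N c where c: "\<And>k. real_polynomial_function (c k)"
    "\<And>k. k > N \<Longrightarrow> c k = (\<lambda>z. 0)" "\<And>t z. f (a + t *\<^sub>R z) = (\<Sum>k\<le>N. c k z * t ^ k)" by blast
  from add.IH(2) obtain M d where d: "\<And>k. real_polynomial_function (d k)"
    "\<And>k. k > M \<Longrightarrow> d k = (\<lambda>z. 0)" "\<And>t z. g (a + t *\<^sub>R z) = (\<Sum>k\<le>M. d k z * t ^ k)" by blast
  have "(\<Sum>k\<le>N. c k z * t ^ k) = (\<Sum>k\<le>max N M. c k z * t ^ k)" for t z
    by (rule sum.mono_neutral_left) (auto simp: c(2))
  moreover have "(\<Sum>k\<le>M. d k z * t ^ k) = (\<Sum>k\<le>max N M. d k z * t ^ k)" for t z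
    by (rule sum.mono_neutral_left) (auto simp: d(2))
  ultimately show ?case
    by (intro exI[of _ "max N M"] exI[of _ "\<lambda>k z. c k z + d k z"])
       (auto simp: c d sum.distrib algebra_simps)
next
  case (mult f g)
  from mult.IH(1) obtain N c where c: "\<And>k. real_polynomial_function (c k)"
    "\<And>k. k > N \<Longrightarrow> c k = (\<lambda>z. 0)" "\<And>t z. f (a + t *\<^sub>R z) = (\<Sum>k\<le>N. c k z * t ^ k)" by blast
  from mult.IH(2) obtain M d where d: "\<And>k. real_polynomial_function (d k)"
    "\<And>k. k > M \<Longrightarrow> d k = (\<lambda>z. 0)" "\<And>t z. g (a + t *\<^sub>R z) = (\<Sum>k\<le>M. d k z * t ^ k)" by blast
  have zero: "c i z * d (r - i) z = 0" if "r > N + M" for i r z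
    using that c(2)[of i] d(2)[of "r - i"] by (cases "i > N") auto
  have "f (a + t *\<^sub>R z) * g (a + t *\<^sub>R z) = (\<Sum>r\<le>N + M. (\<Sum>i\<le>r. c i z * d (r - i) z) * t ^ r)" for t z
    unfolding c d by (rule polynomial_product) (auto simp: c(2) d(2))
  then show ?case
    by (intro exI[of _ "N + M"] exI[of _ "\<lambda>r z. \<Sum>i\<le>r. c i z * d (r - i) z"])
       (auto simp: zero intro!: c d)
qed

text \<open>Integrating the partial derivatives along rays from \<open>a\<close> gives the candidate
  \<open>Q\<close>. As \<open>S\<close> need not be star-shaped, this yields \<open>f = Q\<close> on
  a ball only. The partial derivatives of \<open>Q\<close> and the given polynomials agree there,
  hence everywhere, and connectedness of \<open>S\<close> spreads the equality.\<close>

lemma polynomial_if_polynomial_derivative: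
  fixes f :: "real ^ 'n \<Rightarrow> real"
  assumes S: "open S" "connected S"
    and f: "\<And>y. y \<in> S \<Longrightarrow> (f has_derivative f' y) (at y)"
    and f': "\<And>i. \<exists>q. real_polynomial_function q \<and> (\<forall>y\<in>S. f' y (axis i 1) = q y)"
  shows "\<exists>Q. real_polynomial_function Q \<and> (\<forall>y\<in>S. f y = Q y)"
proof (cases "S = {}")
  case False
  then obtain a where a: "a \<in> S" by blast
  obtain q where q: "\<And>i. real_polynomial_function (q i)" "\<And>i y. y \<in> S \<Longrightarrow> f' y (axis i 1) = q i y"
    using f' by metis
  have "\<forall>i. \<exists>N c. (\<forall>k. real_polynomial_function (c k)) \<and> (\<forall>t z. q i (a + t *\<^sub>R z) = (\<Sum>k\<le>N. c k z * t ^ k))"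
    using real_polynomial_on_rays[OF q(1)] by blast
  then obtain N c where c: "\<And>i k. real_polynomial_function (c i k)"
     "\<And>i t z. q i (a + t *\<^sub>R z) = (\<Sum>k\<le>N i. c i k z * t ^ k)" by metis
  \<comment> \<open>The primitive, zero at \<open>t = 0\<close>, of the derivative of
    \<open>f\<close> along the ray in the direction \<open>z\<close>.\<close>
  define G where "G t z = (\<Sum>i\<in>UNIV. z $ i * (\<Sum>k\<le>N i. c i k z * t ^ Suc k / Suc k))" for t z
  define Q where "Q y = f a + G 1 (y - a)" for y
  have Gpoly: "real_polynomial_function (G 1)"
    unfolding G_def
    by (intro real_polynomial_function_sum finite finite_atMost real_polynomial_mult
        real_polynomial_vec_nth real_polynomial_function_divide c(1) real_polynomial_const)
  have Qpoly: "real_polynomial_function Q"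
  proof -
    have "polynomial_function (\<lambda>y::real^'n. y - a)"
      by (intro polynomial_function_diff polynomial_function_id polynomial_function_const)
    from real_polynomial_function_compose[OF this Gpoly] show ?thesis
      by (auto simp: Q_def[abs_def] o_def intro!: real_polynomial_add real_polynomial_const)
  qed
  obtain e where e: "e > 0" "ball a e \<subseteq> S" using a S openE by blast
  have fQ: "f y = Q y" if y: "y \<in> ball a e" for y
  proof -
    define z where "z = y - a"
    have seg: "a + t *\<^sub>R z \<in> S" if "t \<in> {0..1}" for t
    proof -
      have "norm (t *\<^sub>R z) \<le> norm z" using that by (simp add: mult_left_le_one_le)
      also have "\<dots> < e" using y by (simp add: z_def dist_norm norm_minus_commute)
      finally show ?thesis using e by (auto simp: dist_norm subset_iff)
    qed
    have dG: "((\<lambda>t. G t z) has_real_derivative (\<Sum>i\<in>UNIV. z $ i * (\<Sum>k\<le>N i. c i k z * t ^ k))) (at t)" for t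
      unfolding G_def
    proof (intro DERIV_sum DERIV_cmult)
      fix i k
      show "((\<lambda>t. c i k z * t ^ Suc k / Suc k) has_real_derivative c i k z * t ^ k) (at t)"
        using DERIV_cdivide[OF DERIV_cmult[OF DERIV_pow[of "Suc k" t UNIV]], of "c i k z" "Suc k"]
        by (simp del: of_nat_Suc power_Suc)
    qed
    have df: "((\<lambda>t. f (a + t *\<^sub>R z)) has_real_derivative (\<Sum>i\<in>UNIV. z $ i * (\<Sum>k\<le>N i. c i k z * t ^ k))) (at t)"
      if "t \<in> {0..1}" for t
    proof -
      have "((\<lambda>t. a + t *\<^sub>R z) has_derivative (\<lambda>h. h *\<^sub>R z)) (at t)"
        by (auto intro!: derivative_eq_intros)
      note d = has_derivative_compose[OF this f[OF seg[OF that]]]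
      have lin: "linear (f' (a + t *\<^sub>R z))" using f[OF seg[OF that]] has_derivative_linear by blast
      have "f' (a + t *\<^sub>R z) z = (\<Sum>i\<in>UNIV. z $ i * (\<Sum>k\<le>N i. c i k z * t ^ k))"
        using linear_sum_axis[OF lin, of z] q(2)[OF seg[OF that]] by (simp add: c(2))
      then have "f' (a + t *\<^sub>R z) (h *\<^sub>R z) = (\<Sum>i\<in>UNIV. z $ i * (\<Sum>k\<le>N i. c i k z * t ^ k)) * h" for h
        using linear_scale[OF lin, of h z] by simp
      then show ?thesis using d by (simp add: has_field_derivative_def)
    qed
    have "(f (a + 1 *\<^sub>R z) - G 1 z) = (f (a + 0 *\<^sub>R z) - G 0 z)"
    proof (rule DERIV_isconst2[of 0 1 "\<lambda>t. f (a + t *\<^sub>R z) - G t z" 1])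
      have d0: "((\<lambda>t. f (a + t *\<^sub>R z) - G t z) has_real_derivative 0) (at t)" if "t \<in> {0..1}" for t
        using DERIV_diff[OF df[OF that] dG] by simp
      show "continuous_on {0..1} (\<lambda>t. f (a + t *\<^sub>R z) - G t z)"
        using d0 by (intro continuous_at_imp_continuous_on ballI) (rule DERIV_isCont)
      show "((\<lambda>t. f (a + t *\<^sub>R z) - G t z) has_real_derivative 0) (at t)" if "0 < t" "t < 1" for t
        using d0 that by auto
    qed auto
    then show ?thesis by (simp add: Q_def z_def G_def)
  qed
  have dQ: "frechet_derivative Q (at y) (axis i 1) = f' y (axis i 1)" if "y \<in> S" for y i
  proof -
    let ?r = "\<lambda>y. q i y - frechet_derivative Q (at y) (axis i 1)"
    have "?r y = 0"
    proof (rule real_polynomial_zero_on_open[of ?r "ball a e" a])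
      show "real_polynomial_function ?r"
        by (intro real_polynomial_function_diff q real_polynomial_frechet_derivative Qpoly)
      show "open (ball a e)" "a \<in> ball a e" using e by auto
      fix y assume y: "y \<in> ball a e"
      have "(Q has_derivative f' y) (at y)"
        by (rule has_derivative_transform_within_open[of f _ _ _ "ball a e"])
           (use e f y in \<open>auto simp: fQ\<close>)
      then have "frechet_derivative Q (at y) = f' y" by (rule frechet_derivativeI)
      then show "?r y = 0" using q(2) y e by auto
    qed
    then show ?thesis using q(2)[OF that] by simp
  qed
  have "f y - Q y = f a - Q a" if "y \<in> S" for y
  proof (rule has_derivative_zero_unique_connected[OF S _ that a])
    fix y assume y: "y \<in> S"
    have "f' y w = frechet_derivative Q (at y) w" for w
      using linear_sum_axis[OF has_derivative_linear[OF f[OF y]], of w]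
        linear_sum_axis[OF has_derivative_linear[OF real_polynomial_has_derivative[OF Qpoly]], of y w]
      by (simp add: dQ[OF y])
    then show "((\<lambda>y. f y - Q y) has_derivative (\<lambda>x. 0)) (at y)"
      using has_derivative_diff[OF f[OF y] real_polynomial_has_derivative[OF Qpoly, of y]] by simp
  qed
  moreover have "f a = Q a" using fQ e by simp
  ultimately show ?thesis using Qpoly by auto
qed (auto intro: real_polynomial_const)

lemma real_polynomial_det:
  fixes F :: "'a::real_normed_vector \<Rightarrow> real ^ 'n ^ 'n"
  assumes "\<And>i j. real_polynomial_function (\<lambda>y. F y $ i $ j)"
  shows "real_polynomial_function (\<lambda>y. det (F y))"
  unfolding det_def
  by (intro real_polynomial_function_sum real_polynomial_mult real_polynomial_const
      real_polynomial_function_prod assms finite_permutations) auto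


subsection \<open>Uniqueness for linear total differential equations\<close>

text \<open>The common zero set is closed in \<open>S\<close>. It is open because near each of its
  points the mean value inequality bounds the maximum of the total norm by half of itself. The
  constant \<open>C\<close> is local and may depend on the point.\<close>

lemma linear_differential_system_zero:
  fixes \<zeta> :: "'i::finite \<Rightarrow> 'a::euclidean_space \<Rightarrow> 'b::euclidean_space"
  assumes S: "open S" "connected S" "y0 \<in> S"
    and der: "\<And>i y. y \<in> S \<Longrightarrow> (\<zeta> i has_derivative \<zeta>' i y) (at y)"
    and bound: "\<And>y. y \<in> S \<Longrightarrow> \<exists>e>0. \<exists>C. \<forall>x\<in>ball y e \<inter> S. \<forall>i w.
        norm (\<zeta>' i x w) \<le> C * norm w * (\<Sum>j\<in>UNIV. norm (\<zeta> j x))"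
    and init: "\<And>i. \<zeta> i y0 = 0" and y: "y \<in> S"
  shows "\<zeta> i y = 0"
proof -
  define A where "A = {y \<in> S. (\<Sum>j\<in>UNIV. norm (\<zeta> j y)) = 0}"
  have A_iff: "y \<in> A \<longleftrightarrow> y \<in> S \<and> (\<forall>j. \<zeta> j y = 0)" for y
    by (auto simp: A_def sum_nonneg_eq_0_iff)
  have cont: "continuous_on S (\<zeta> j)" for j
    using der by (meson continuous_at_imp_continuous_on has_derivative_continuous)
  have closed: "closedin (top_of_set S) A"
    unfolding A_def by (intro continuous_closedin_preimage_constant continuous_intros cont)
  have "open A"
  proof (subst open_contains_cball, intro ballI)
    fix y assume "y \<in> A"
    then have y: "y \<in> S" "\<And>j. \<zeta> j y = 0" by (auto simp: A_iff)
    obtain e C where e: "e > 0" and C: "\<And>x i w. x \<in> ball y e \<inter> S \<Longrightarrow>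
        norm (\<zeta>' i x w) \<le> C * norm w * (\<Sum>j\<in>UNIV. norm (\<zeta> j x))" using bound[OF y(1)] by metis
    obtain e' where e': "e' > 0" "ball y e' \<subseteq> S" using S y openE by blast
    define n where "n = real CARD('i)"
    have n: "n > 0" by (simp add: n_def)
    \<comment> \<open>The last bound makes \<open>n * \<bar>C\<bar> * d\<close> at most 1/2, where
      \<open>n\<close> is the number of unknown functions; the added 1 excludes a zero denominator.
      The halves keep the closed ball inside the open ones.\<close>
    define d where "d = min (min (e/2) (e'/2)) (1 / (2 * n * (\<bar>C\<bar> + 1)))"
    have d: "d > 0" using e e' n by (simp add: d_def)
    have dS: "cball y d \<subseteq> ball y e \<inter> S"
    proof
      fix x assume "x \<in> cball y d"
      then have "dist y x \<le> e/2" "dist y x \<le> e'/2" by (auto simp: d_def)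
      then show "x \<in> ball y e \<inter> S" using e e' by (auto simp: subset_iff)
    qed
    define N where "N x = (\<Sum>j\<in>UNIV. norm (\<zeta> j x))" for x
    have contN: "continuous_on (cball y d) N"
      unfolding N_def using dS by (intro continuous_intros continuous_on_subset[OF cont]) auto
    obtain z where z: "z \<in> cball y d" "\<And>x. x \<in> cball y d \<Longrightarrow> N x \<le> N z"
      using continuous_attains_sup[OF compact_cball _ contN] d by fastforce
    have Nz: "N x \<ge> 0" for x by (simp add: N_def sum_nonneg)
    have each: "norm (\<zeta> j z) \<le> (\<bar>C\<bar> * N z) * d" for j
    proof -
      have "norm (\<zeta> j z - \<zeta> j y) \<le> (\<bar>C\<bar> * N z) * norm (z - y)"
      proof (rule differentiable_bound[OF convex_cball[of y d]])
        fix x assume x: "x \<in> cball y d"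
        show "(\<zeta> j has_derivative \<zeta>' j x) (at x within cball y d)"
          using der dS x by (meson has_derivative_at_withinI IntD2 subsetD)
        show "onorm (\<zeta>' j x) \<le> \<bar>C\<bar> * N z"
        proof (rule onorm_le)
          fix w
          have "x \<in> ball y e \<inter> S" using dS x by blast
          from C[OF this] have "norm (\<zeta>' j x w) \<le> C * norm w * N x" by (simp add: N_def)
          also have "\<dots> \<le> \<bar>C\<bar> * norm w * N z"
            by (intro mult_mono z x Nz mult_right_mono mult_nonneg_nonneg) auto
          finally show "norm (\<zeta>' j x w) \<le> \<bar>C\<bar> * N z * norm w" by (simp add: mult_ac)
        qed
      qed (use z d in auto)
      also have "\<dots> \<le> (\<bar>C\<bar> * N z) * d"
        using z Nz by (intro mult_left_mono) (auto simp: dist_norm norm_minus_commute)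
      finally show ?thesis using y by simp
    qed
    have "N z \<le> (\<Sum>j\<in>(UNIV::'i set). (\<bar>C\<bar> * N z) * d)"
      unfolding N_def[of z] by (intro sum_mono) (use each in \<open>simp add: N_def\<close>)
    also have "\<dots> = n * \<bar>C\<bar> * d * N z" by (simp add: n_def)
    also have "\<dots> \<le> 1/2 * N z"
    proof (intro mult_right_mono Nz)
      have "n * \<bar>C\<bar> * d \<le> n * (\<bar>C\<bar> + 1) * (1 / (2 * n * (\<bar>C\<bar> + 1)))"
        using n d by (intro mult_mono) (auto simp: d_def)
      also have "\<dots> = 1/2"
      proof -
        have "a * b * (1 / (2 * a * b)) = 1/2" if "a > 0" "b > 0" for a b :: real
          using that by simp
        then show ?thesis using n by simp
      qed
      finally show "n * \<bar>C\<bar> * d \<le> 1/2" .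
    qed
    finally have "N z = 0" using Nz[of z] by simp
    then have "N x = 0" if "x \<in> cball y d" for x using z(2)[OF that] Nz[of x] by simp
    then have "cball y d \<subseteq> A" using dS by (auto simp: A_def N_def)
    then show "\<exists>e>0. cball y e \<subseteq> A" using d by blast
  qed
  then have "openin (top_of_set S) A" by (intro open_subset) (auto simp: A_def)
  moreover have "y0 \<in> A" using S init by (simp add: A_iff)
  ultimately have "A = S" using closed S(2) connected_clopen by blast
  then show ?thesis using y A_iff by blast
qed


lemma has_derivative_frechetI:
  "(f has_derivative D) (at x) \<Longrightarrow> (f has_derivative frechet_derivative f (at x)) (at x)"
  by (simp add: frechet_derivativeI)

subsection \<open>Frames of left symmetric type in an affine chart\<close>

text \<open>The columns \<open>E y v\<close> are the values at \<open>y\<close> of the left invariant vector fields, written in an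
  affine chart, and \<open>m u v\<close> is the left symmetric product \<open>\<nabla>\<^sub>u v\<close>.\<close>

locale affine_frame =
  fixes m :: "real ^ 'n \<Rightarrow> real ^ 'n \<Rightarrow> real ^ 'n"
    and E :: "real ^ 'n \<Rightarrow> real ^ 'n \<Rightarrow> real ^ 'n"
    and S :: "(real ^ 'n) set" and y0 :: "real ^ 'n" and K :: nat
  assumes bilinear_m: "bilinear m"
    and open_S: "open S" and connected_S: "connected S" and y0: "y0 \<in> S"
    and linear_E: "y \<in> S \<Longrightarrow> linear (E y)"
    and inj_E: "y \<in> S \<Longrightarrow> inj (E y)"
    and E_y0: "E y0 v = v"
    and smooth_E: "smooth_on S (\<lambda>y. E y v)"
    and derivative_E: "y \<in> S \<Longrightarrow> frechet_derivative (\<lambda>y. E y v) (at y) (E y u) = E y (m u v)"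
    and flat: "m u (m w v) - m w (m u v) = m (m u w - m w u) v"
    and nilpotent: "length us = K \<Longrightarrow> foldr m us v = 0"
begin

lemma linear_m1: "linear (\<lambda>u. m u v)" and linear_m2: "linear (m u)"
  using bilinear_m by (simp_all add: bilinear_def)

lemmas m_simps = linear_add[OF linear_m1] linear_add[OF linear_m2] linear_diff[OF linear_m1]
  linear_diff[OF linear_m2] linear_scale[OF linear_m1] linear_scale[OF linear_m2]

text \<open>In a chart centred at the identity these are the right invariant vector fields.\<close>

definition r :: "real ^ 'n \<Rightarrow> real ^ 'n \<Rightarrow> real ^ 'n" where
  "r u y = u + m u (y - y0)"

section \<open>Derivatives of the frame and of the affine fields\<close>

definition dE :: "real ^ 'n \<Rightarrow> real ^ 'n \<Rightarrow> real ^ 'n \<Rightarrow> real ^ 'n" where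
  "dE v y = frechet_derivative (\<lambda>y. E y v) (at y)"

lemma E_has_derivative: "y \<in> S \<Longrightarrow> ((\<lambda>y. E y v) has_derivative dE v y) (at y)"
  unfolding dE_def by (rule smooth_on_imp_has_derivative[OF smooth_E])

lemma linear_dE: "y \<in> S \<Longrightarrow> linear (dE v y)"
  using E_has_derivative has_derivative_linear by blast

lemma dE_E: "y \<in> S \<Longrightarrow> dE v y (E y u) = E y (m u v)"
  unfolding dE_def by (rule derivative_E)

lemma r_eq: "r u = (\<lambda>y. (u - m u y0) + m u y)"
  by (simp add: r_def m_simps fun_eq_iff)

lemma r_has_derivative: "(r u has_derivative m u) (at y)"
  unfolding r_eq
  using has_derivative_add[OF has_derivative_const[of "u - m u y0"]
      linear_imp_has_derivative[OF linear_m2, of u "at y"]] by simp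

lemma smooth_r: "smooth_on S (r u)"
  unfolding r_eq using linear_m2 linear_conv_bounded_linear
  by (intro smooth_on_add open_S smooth_on_const smooth_on_linear) blast

lemma linear_r: "linear (\<lambda>u. r u y)"
  by (rule linearI) (simp_all add: r_def m_simps algebra_simps)

lemma E_component_has_derivative:
  assumes "y \<in> S"
  shows "((\<lambda>y. E y v $ i) has_derivative (\<lambda>w. dE v y w $ i)) (at y)"
  by (rule bounded_linear.has_derivative[OF bounded_linear_vec_nth E_has_derivative[OF assms]])

lemma linear_dE_left: "y \<in> S \<Longrightarrow> linear (\<lambda>v. dE v y w)"
proof (rule linearI)
  assume y: "y \<in> S"
  fix v v'
  have "((\<lambda>y. E y (v + v')) has_derivative (\<lambda>w. dE v y w + dE v' y w)) (at y)"
    by (rule has_derivative_transform_within_open[OF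
          has_derivative_add[OF E_has_derivative[OF y] E_has_derivative[OF y]] open_S y])
       (simp add: linear_add[OF linear_E])
  from frechet_derivativeI[OF this] show "dE (v + v') y w = dE v y w + dE v' y w"
    by (simp add: dE_def)
next
  assume y: "y \<in> S"
  fix c v
  have "((\<lambda>y. E y (c *\<^sub>R v)) has_derivative (\<lambda>w. c *\<^sub>R dE v y w)) (at y)"
    by (rule has_derivative_transform_within_open[OF
          has_derivative_scaleR_right[OF E_has_derivative[OF y]] open_S y])
       (simp add: linear_scale[OF linear_E])
  from frechet_derivativeI[OF this] show "dE (c *\<^sub>R v) y w = c *\<^sub>R dE v y w"
    by (simp add: dE_def)
qed

text \<open>\<open>Z a v\<close> is the Lie bracket of \<open>r a\<close> with the field \<open>E _ v\<close>.  It solves a homogeneous linear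
  differential system and vanishes at \<open>y0\<close>, hence everywhere.\<close>

definition Z :: "real ^ 'n \<Rightarrow> real ^ 'n \<Rightarrow> real ^ 'n \<Rightarrow> real ^ 'n" where
  "Z a v y = m a (E y v) - dE v y (r a y)"

lemma linear_Z: "y \<in> S \<Longrightarrow> linear (\<lambda>v. Z a v y)"
  unfolding Z_def
  by (intro linear_compose_sub linear_dE_left)
     (use linear_compose[OF linear_E linear_m2] in \<open>auto simp: o_def\<close>)

lemma smooth_Z: "smooth_on S (Z a v)"
proof -
  have "smooth_on S (\<lambda>y. m a (E y v) + (-1) *\<^sub>R (\<Sum>i\<in>UNIV. r a y $ i *\<^sub>R dE v y (axis i 1)))"
    unfolding dE_def
    using linear_m2[of a] smooth_r
    by (intro smooth_on_add smooth_on_compose_linear[OF open_S _ smooth_E] smooth_on_scaleR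
        smooth_on_const smooth_on_sum smooth_on_frechet_derivative[OF smooth_E] open_S
        smooth_on_compose_linear[OF open_S bounded_linear_vec_nth smooth_r])
       (simp add: linear_conv_bounded_linear)
  moreover have "m a (E y v) + (-1) *\<^sub>R (\<Sum>i\<in>UNIV. r a y $ i *\<^sub>R dE v y (axis i 1)) = Z a v y"
    if "y \<in> S" for y
    using linear_sum_axis[OF linear_dE[OF that], of v "r a y"] by (simp add: Z_def)
  ultimately show ?thesis
    using smooth_on_cong[OF open_S] by (metis (no_types, lifting))
qed

lemma Z_has_derivative: "y \<in> S \<Longrightarrow> (Z a v has_derivative frechet_derivative (Z a v) (at y)) (at y)"
  by (rule smooth_on_imp_has_derivative[OF smooth_Z])

text \<open>Exchanging the derivative along \<open>E _ u\<close> with the one along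
  \<open>r a\<close> costs the commutator of these two fields, which is \<open>Z a u\<close> itself.
  Hence the system closes up and is homogeneous in \<open>Z\<close>.\<close>

lemma Z_derivative:
  assumes y: "y \<in> S"
  shows "frechet_derivative (Z a v) (at y) (E y u) = Z a (m u v) y - dE v y (Z a u y)"
  unfolding vec_eq_iff
proof
  fix i
  let ?f = "\<lambda>y. E y v $ i"
  have ff: "frechet_derivative ?f (at x) = (\<lambda>w. dE v x w $ i)" if "x \<in> S" for x
    by (rule frechet_derivativeI[OF E_component_has_derivative[OF that]])
  have Ck: "Ck_on 2 ?f S"
    using smooth_on_compose_linear[OF open_S bounded_linear_vec_nth smooth_E]
    by (simp add: smooth_on_def)
  let ?h = "\<lambda>y. frechet_derivative ?f (at y) (r a y)"
  have h: "(?h has_derivative frechet_derivative ?h (at y)) (at y)"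
    by (rule has_derivative_frechetI[OF has_derivative_frechet_field[OF open_S y Ck r_has_derivative]])
  have "((\<lambda>y. E y (m u v) $ i) has_derivative (\<lambda>w. dE (m u v) y w $ i)) (at y)"
    by (rule E_component_has_derivative[OF y])
  then have "((\<lambda>y. frechet_derivative ?f (at y) (E y u)) has_derivative (\<lambda>w. dE (m u v) y w $ i)) (at y)"
    by (rule has_derivative_transform_within_open[OF _ open_S y]) (simp add: ff dE_E)
  note g = frechet_derivativeI[OF this]
  have c: "frechet_derivative ?h (at y) (E y u) - dE (m u v) y (r a y) $ i = dE v y (Z a u y) $ i"
    using commutator_derivative[OF open_S y Ck E_has_derivative[OF y, of u] r_has_derivative[of a]]
    by (simp add: g ff[OF y] Z_def)
  have "((\<lambda>y. m a (E y v) $ i) has_derivative (\<lambda>w. m a (dE v y w) $ i)) (at y)"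
    using linear_m2[of a] E_has_derivative[OF y]
    by (intro bounded_linear.has_derivative[OF bounded_linear_vec_nth] 
        bounded_linear.has_derivative[where f="m a"]) (simp_all add: linear_conv_bounded_linear)
  from has_derivative_diff[OF this h]
  have "((\<lambda>y. Z a v y $ i) has_derivative
      (\<lambda>w. m a (dE v y w) $ i - frechet_derivative ?h (at y) w)) (at y)"
    by (rule has_derivative_transform_within_open[OF _ open_S y]) (simp add: ff Z_def)
  moreover have "((\<lambda>y. Z a v y $ i) has_derivative (\<lambda>w. frechet_derivative (Z a v) (at y) w $ i)) (at y)"
    by (rule bounded_linear.has_derivative[OF bounded_linear_vec_nth Z_has_derivative[OF y]])
  ultimately have "(\<lambda>w. frechet_derivative (Z a v) (at y) w $ i) =
      (\<lambda>w. m a (dE v y w) $ i - frechet_derivative ?h (at y) w)"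
    by (rule has_derivative_unique[rotated])
  from fun_cong[OF this, of "E y u"] c
  show "frechet_derivative (Z a v) (at y) (E y u) $ i = (Z a (m u v) y - dE v y (Z a u y)) $ i"
    by (simp add: dE_E[OF y] Z_def)
qed

text \<open>\<open>Z_derivative\<close> gives derivatives in the directions \<open>E x u\<close>. To
  estimate them in an arbitrary direction \<open>w = E x u\<close>, the norm of \<open>u\<close>
  must be controlled by that of \<open>w\<close>, uniformly near \<open>y\<close>.\<close>

lemma E_bounded_below:
  assumes y: "y \<in> S"
  shows "\<exists>c>0. \<exists>d>0. \<forall>x\<in>ball y d \<inter> S. \<forall>w. c * norm w \<le> norm (E x w)"
proof -
  obtain B where B: "B > 0" "\<And>w. B * norm w \<le> norm (E y w)"
    using linear_inj_bounded_below_pos[OF linear_E[OF y] inj_E[OF y]] by blast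
  define g where "g x = (\<Sum>j\<in>UNIV. norm (E x (axis j 1) - E y (axis j 1)))" for x
  have "isCont g y"
    unfolding g_def using has_derivative_continuous[OF E_has_derivative[OF y]]
    by (intro continuous_intros) auto
  then obtain d where d: "d > 0" "\<And>x. dist x y < d \<Longrightarrow> dist (g x) (g y) < B/2"
    using B(1) unfolding continuous_at_eps_delta by (metis half_gt_zero)
  have "B/2 * norm w \<le> norm (E x w)" if "x \<in> ball y d \<inter> S" for x w
  proof -
    have "E x w - E y w = (\<Sum>j\<in>UNIV. w $ j *\<^sub>R (E x (axis j 1) - E y (axis j 1)))"
      using that linear_sum_axis[OF linear_E[of x], of w] linear_sum_axis[OF linear_E[OF y], of w]
      by (simp add: sum_subtractf scaleR_diff_right)
    also have "norm \<dots> \<le> (\<Sum>j\<in>UNIV. norm w * norm (E x (axis j 1) - E y (axis j 1)))"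
      by (rule order_trans[OF norm_sum])
         (auto intro!: sum_mono mult_right_mono simp: component_le_norm_cart)
    also have "\<dots> = norm w * g x" by (simp add: g_def sum_distrib_left)
    also have "\<dots> \<le> norm w * (B/2)"
      using d(2)[of x] that by (intro mult_left_mono) (auto simp: g_def dist_commute dist_real_def)
    finally have "norm (E x w - E y w) \<le> norm w * (B/2)" .
    moreover have "norm (E y w) \<le> norm (E x w) + norm (E x w - E y w)"
      using norm_triangle_ineq2[of "E y w" "E x w"] by (simp add: norm_minus_commute)
    ultimately show ?thesis using B(2)[of w] by (simp add: field_simps)
  qed
  then show ?thesis using B d by (metis half_gt_zero)
qed

lemma dE_bounded:
  assumes y: "y \<in> S"
  shows "\<exists>B\<ge>0. \<exists>d>0. \<forall>x\<in>ball y d \<inter> S. \<forall>j w. norm (dE (axis j 1) x w) \<le> B * norm w"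
proof -
  obtain d where d: "d > 0" "cball y d \<subseteq> S" using open_S y open_contains_cball by blast
  have "\<exists>B. \<forall>x\<in>cball y d. norm (dE (axis j 1) x (axis i 1)) \<le> B" for i j
  proof -
    have "continuous_on (cball y d) (\<lambda>x. dE (axis j 1) x (axis i 1))"
      unfolding dE_def
      by (rule continuous_on_subset[OF smooth_on_imp_continuous_on[OF
            smooth_on_frechet_derivative[OF smooth_E]] d(2)])
    from compact_imp_bounded[OF compact_continuous_image[OF this compact_cball]]
    show ?thesis by (simp add: bounded_iff)
  qed
  then have "\<forall>p. \<exists>B. \<forall>x\<in>cball y d. norm (dE (axis (snd p) 1) x (axis (fst p) 1)) \<le> B" by blast
  from choice[OF this] obtain B' where
    B': "\<forall>p. \<forall>x\<in>cball y d. norm (dE (axis (snd p) 1) x (axis (fst p) 1)) \<le> B' p" by blast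
  define B where "B i j = B' (i, j)" for i j
  have B: "norm (dE (axis j 1) x (axis i 1)) \<le> B i j" if "x \<in> cball y d" for i j x
    using B'[rule_format, OF that, of "(i, j)"] by (simp add: B_def)
  define C where "C = (\<Sum>i\<in>UNIV. \<Sum>j\<in>UNIV. \<bar>B i j\<bar>)"
  have "norm (dE (axis j 1) x w) \<le> C * norm w" if "x \<in> ball y d \<inter> S" for x j w
  proof -
    have "norm (dE (axis j 1) x w) \<le> (\<Sum>i\<in>UNIV. norm (w $ i *\<^sub>R dE (axis j 1) x (axis i 1)))"
      using that by (subst linear_sum_axis[OF linear_dE, of x _ w]) (simp, rule norm_sum)
    also have "\<dots> \<le> (\<Sum>i\<in>UNIV. norm w * (\<Sum>j\<in>UNIV. \<bar>B i j\<bar>))"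
    proof (rule sum_mono)
      fix i
      have "norm (dE (axis j 1) x (axis i 1)) \<le> \<bar>B i j\<bar>" using B[of x j i] that by auto
      also have "\<dots> \<le> (\<Sum>j\<in>UNIV. \<bar>B i j\<bar>)" by (intro member_le_sum) auto
      finally show "norm (w $ i *\<^sub>R dE (axis j 1) x (axis i 1)) \<le> norm w * (\<Sum>j\<in>UNIV. \<bar>B i j\<bar>)"
        by (simp add: mult_mono component_le_norm_cart)
    qed
    also have "\<dots> = C * norm w" by (simp add: C_def mult.commute flip: sum_distrib_left)
    finally show ?thesis .
  qed
  moreover have "C \<ge> 0" by (simp add: C_def sum_nonneg)
  ultimately show ?thesis using d(1) by blast
qed

lemma Z_zero:
  assumes y: "y \<in> S"
  shows "Z a v y = 0"
proof -
  have "Z a (axis j 1) y = 0" for j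
  proof (rule linear_differential_system_zero[where \<zeta>="\<lambda>j. Z a (axis j 1)",
        OF open_S connected_S y0 Z_has_derivative _ _ y])
    fix j
    \<comment> \<open>At \<open>y0\<close> the field \<open>r a\<close> and the frame field of
      \<open>a\<close> both have the value \<open>a\<close>, so the two terms of \<open>Z\<close>
      agree by the structure equation \<open>dE_E\<close>.\<close>
    show "Z a (axis j 1) y0 = 0"
      using dE_E[OF y0, of "axis j 1" a] by (simp add: Z_def r_def E_y0 linear_0[OF linear_m2])
  next
    fix y assume y: "y \<in> S"
    obtain c d1 where c: "c > 0" "d1 > 0" "\<And>x w. x \<in> ball y d1 \<inter> S \<Longrightarrow> c * norm w \<le> norm (E x w)"
      using E_bounded_below[OF y] by blast
    obtain B d2 where B: "B \<ge> 0" "d2 > 0"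
      "\<And>x j w. x \<in> ball y d2 \<inter> S \<Longrightarrow> norm (dE (axis j 1) x w) \<le> B * norm w"
      using dE_bounded[OF y] by blast
    obtain M where M: "M > 0" "\<And>u v. norm (m u v) \<le> M * norm u * norm v"
      using bilinear_bounded_pos[OF bilinear_m] by blast
    let ?N = "\<lambda>x. \<Sum>j\<in>UNIV. norm (Z a (axis j 1) x)"
    have "norm (frechet_derivative (Z a (axis j 1)) (at x) w) \<le> ((M + B) / c) * norm w * ?N x"
      if x: "x \<in> ball y (min d1 d2) \<inter> S" for x j w
    proof -
      have xS: "x \<in> S" using x by simp
      have Zn: "norm (Z a v x) \<le> norm v * ?N x" for v
      proof -
        have "norm (Z a v x) \<le> (\<Sum>j\<in>UNIV. norm (v $ j *\<^sub>R Z a (axis j 1) x))"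
          by (subst linear_sum_axis[OF linear_Z[OF xS]]) (rule norm_sum)
        also have "\<dots> \<le> (\<Sum>j\<in>UNIV. norm v * norm (Z a (axis j 1) x))"
          by (auto intro!: sum_mono mult_right_mono simp: component_le_norm_cart)
        finally show ?thesis by (simp add: sum_distrib_left)
      qed
      have N0: "?N x \<ge> 0" by (simp add: sum_nonneg)
      have "surj (E x)" using linear_injective_imp_surjective[OF linear_E[OF xS] inj_E[OF xS]] by simp
      then obtain u where u: "w = E x u" by (metis surjD)
      have nu: "norm u \<le> norm w / c" using c x by (simp add: u pos_le_divide_eq mult.commute)
      have "norm (frechet_derivative (Z a (axis j 1)) (at x) w)
          \<le> norm (Z a (m u (axis j 1)) x) + norm (dE (axis j 1) x (Z a u x))"
        unfolding u Z_derivative[OF xS] by (rule norm_triangle_ineq4)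
      also have "\<dots> \<le> (M * norm u) * ?N x + B * (norm u * ?N x)"
      proof (rule add_mono)
        have "norm (Z a (m u (axis j 1)) x) \<le> norm (m u (axis j 1)) * ?N x" by (rule Zn)
        also have "\<dots> \<le> (M * norm u) * ?N x"
          using M(2)[of u "axis j 1"] by (intro mult_right_mono N0) simp
        finally show "norm (Z a (m u (axis j 1)) x) \<le> (M * norm u) * ?N x" .
        have "norm (dE (axis j 1) x (Z a u x)) \<le> B * norm (Z a u x)" using B x by auto
        also have "\<dots> \<le> B * (norm u * ?N x)" by (intro mult_left_mono Zn B)
        finally show "norm (dE (axis j 1) x (Z a u x)) \<le> B * (norm u * ?N x)" .
      qed
      also have "\<dots> = (M + B) * norm u * ?N x" by (simp add: algebra_simps)
      also have "\<dots> \<le> (M + B) * (norm w / c) * ?N x"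
        using M B by (intro mult_right_mono mult_left_mono nu N0) auto
      finally show ?thesis by simp
    qed
    then show "\<exists>e>0. \<exists>C. \<forall>x\<in>ball y e \<inter> S. \<forall>i w.
        norm (frechet_derivative (Z a (axis i 1)) (at x) w) \<le> C * norm w * ?N x"
      using c(2) B(2) by (intro exI[of _ "min d1 d2"] conjI exI[of _ "(M + B) / c"]) auto
  qed
  then show ?thesis using linear_sum_axis[OF linear_Z[OF y], of a v] by simp
qed

text \<open>In contrast to \<open>dE_E\<close> the product acts outside \<open>E\<close>. Repeated
  derivatives of a functional of \<open>E y v\<close> along the fields \<open>r\<close> thus produce
  compositions of left multiplications, which eventually vanish.\<close>

lemma dE_r: "y \<in> S \<Longrightarrow> dE v y (r a y) = m a (E y v)"
  using Z_zero[of y a v] by (simp add: Z_def)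


subsubsection \<open>The inverse of the right invariant frame is polynomial\<close>

definition rderiv :: "real ^ 'n \<Rightarrow> (real ^ 'n \<Rightarrow> real) \<Rightarrow> real ^ 'n \<Rightarrow> real" where
  "rderiv u p y = frechet_derivative p (at y) (r u y)"

lemma real_polynomial_linear_functional: "linear l \<Longrightarrow> real_polynomial_function (l :: real ^ 'n \<Rightarrow> real)"
  by (intro real_polynomial_linear) (simp add: linear_conv_bounded_linear)

lemma real_polynomial_r: "real_polynomial_function (\<lambda>y. r u y $ i)"
proof -
  have "linear (\<lambda>y. m u y $ i)" using linear_m2[of u] by (auto simp: linear_iff)
  from real_polynomial_add[OF real_polynomial_const real_polynomial_linear_functional[OF this]]
  show ?thesis by (simp add: r_eq)
qed

lemma real_polynomial_rderiv: "real_polynomial_function p \<Longrightarrow> real_polynomial_function (rderiv u p)"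
  unfolding rderiv_def
  by (intro real_polynomial_directional_derivative real_polynomial_r)

lemma rderiv_add:
  assumes "real_polynomial_function p" "real_polynomial_function q"
  shows "rderiv u (\<lambda>y. p y + q y) = (\<lambda>y. rderiv u p y + rderiv u q y)"
proof
  fix y
  show "rderiv u (\<lambda>y. p y + q y) y = rderiv u p y + rderiv u q y"
    using frechet_derivativeI[OF has_derivative_add[OF assms[THEN real_polynomial_has_derivative, of y]]]
    by (simp add: rderiv_def)
qed

lemma rderiv_mult:
  assumes "real_polynomial_function p" "real_polynomial_function q"
  shows "rderiv u (\<lambda>y. p y * q y) = (\<lambda>y. p y * rderiv u q y + rderiv u p y * q y)"
proof
  fix y
  show "rderiv u (\<lambda>y. p y * q y) y = p y * rderiv u q y + rderiv u p y * q y"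
    using frechet_derivativeI[OF has_derivative_mult[OF assms[THEN real_polynomial_has_derivative, of y]]]
    by (simp add: rderiv_def)
qed

lemma rderiv_const: "rderiv u (\<lambda>y. c) = (\<lambda>y. 0)"
  by (simp add: rderiv_def fun_eq_iff)

text \<open>The direction may change from one derivative to the next, matching the words
  \<open>us\<close> in the nilpotency assumption of the locale.\<close>

fun rnil :: "nat \<Rightarrow> (real ^ 'n \<Rightarrow> real) \<Rightarrow> bool" where
  "rnil 0 p \<longleftrightarrow> p = (\<lambda>y. 0)"
| "rnil (Suc k) p \<longleftrightarrow> (\<forall>u. rnil k (rderiv u p))"

lemma rnil_zero: "rnil k (\<lambda>y. 0)"
  by (induction k) (auto simp: rderiv_const)

lemma rnil_Suc: "rnil k p \<Longrightarrow> rnil (Suc k) p"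
  by (induction k arbitrary: p) (auto simp: rderiv_const)

lemma rnil_mono: "rnil k p \<Longrightarrow> k \<le> l \<Longrightarrow> rnil l p"
  by (rule dec_induct[of k l "\<lambda>l. rnil l p"]) (auto simp del: rnil.simps intro: rnil_Suc)

lemma rnil_add:
  "real_polynomial_function p \<Longrightarrow> real_polynomial_function q \<Longrightarrow> rnil k p \<Longrightarrow> rnil k q \<Longrightarrow>
    rnil k (\<lambda>y. p y + q y)"
  by (induction k arbitrary: p q) (auto simp: rderiv_add real_polynomial_rderiv)

text \<open>By the Leibniz rule, among \<open>k + l\<close> derivatives either at least
  \<open>k\<close> fall on \<open>p\<close> or at least \<open>l\<close> on
  \<open>q\<close>.\<close>

lemma rnil_mult:
  assumes "real_polynomial_function p" "real_polynomial_function q" "rnil k p" "rnil l q"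
  shows "rnil (k + l) (\<lambda>y. p y * q y)"
  using assms
proof (induction "k + l" arbitrary: k l p q)
  case 0
  then show ?case by (simp add: rnil_zero)
next
  case (Suc n)
  show ?case
  proof (cases "k = 0 \<or> l = 0")
    case True
    then have "(\<lambda>y. p y * q y) = (\<lambda>y. 0)" using Suc.prems by auto
    then show ?thesis by (simp add: rnil_zero)
  next
    case False
    then obtain k' l' where kl: "k = Suc k'" "l = Suc l'" by (metis not0_implies_Suc)
    have "rnil (k + l') (\<lambda>y. p y * rderiv u q y)" for u
      using Suc.prems Suc.hyps(2) by (intro Suc.hyps(1)) (auto simp: kl real_polynomial_rderiv)
    moreover have "rnil (k' + l) (\<lambda>y. rderiv u p y * q y)" for u
      using Suc.prems Suc.hyps(2) by (intro Suc.hyps(1)) (auto simp: kl real_polynomial_rderiv)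
    ultimately have "rnil (Suc (k' + l')) (\<lambda>y. p y * rderiv u q y + rderiv u p y * q y)" for u
      using Suc.prems(1,2) 
      by (intro rnil_add) (auto simp: kl real_polynomial_mult real_polynomial_rderiv simp del: rnil.simps)
    then show ?thesis using Suc.prems(1,2) by (simp add: kl rderiv_mult)
  qed
qed

text \<open>A derivative along \<open>r u\<close> replaces \<open>l\<close> by its composition with
  \<open>m u\<close> and produces a new constant. After \<open>k\<close> steps only a constant is
  left, which the additional derivative in \<open>Suc k\<close> removes.\<close>

lemma rnil_linear:
  assumes "linear l" "\<And>us v. length us = k \<Longrightarrow> l (foldr m us v) = 0"
  shows "rnil (Suc k) (\<lambda>y. c + l y)"
  using assms
proof (induction k arbitrary: l c)
  case 0
  then have "l = (\<lambda>y. 0)" by (auto simp: fun_eq_iff)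
  then show ?case by (simp add: rderiv_const)
next
  case (Suc k)
  have "rnil (Suc k) (rderiv u (\<lambda>y. c + l y))" for u
  proof -
    have lin: "linear (\<lambda>y. l (m u y))" using linear_compose[OF linear_m2 Suc.prems(1)] by (simp add: o_def)
    have "rnil (Suc k) (\<lambda>y. (l u - l (m u y0)) + l (m u y))"
    proof (rule Suc.IH[OF lin])
      fix us :: "(real^'n) list" and v assume "length us = k"
      then show "l (m u (foldr m us v)) = 0" using Suc.prems(2)[of "u # us" v] by simp
    qed
    moreover have "rderiv u (\<lambda>y. c + l y) = (\<lambda>y. (l u - l (m u y0)) + l (m u y))"
    proof
      fix y
      have "((\<lambda>y. c + l y) has_derivative l) (at y)"
        using has_derivative_add[OF has_derivative_const[of c] linear_imp_has_derivative[OF Suc.prems(1)]]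
        by simp
      then show "rderiv u (\<lambda>y. c + l y) y = (l u - l (m u y0)) + l (m u y)"
        by (simp add: rderiv_def frechet_derivativeI r_eq linear_add[OF Suc.prems(1)] linear_diff[OF Suc.prems(1)])
    qed
    ultimately show ?thesis by (simp only:)
  qed
  then show ?case unfolding rnil.simps(2)[of "Suc k"] by blast
qed

lemma polynomial_rnil: "real_polynomial_function p \<Longrightarrow> \<exists>k. rnil k p"
proof (induction rule: real_polynomial_function.induct)
  case (linear f)
  then have "rnil (Suc K) (\<lambda>y. 0 + f y)"
    by (intro rnil_linear) (auto simp: nilpotent bounded_linear.linear linear_0)
  then show ?case by (intro exI[of _ "Suc K"]) (simp del: rnil.simps)
next
  case (const c)
  have "rnil (Suc 0) (\<lambda>y. c)" by (simp add: rderiv_const)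
  then show ?case by blast
next
  case (add f g)
  then obtain k l where "rnil k f" "rnil l g" by blast
  then have "rnil (max k l) f" "rnil (max k l) g" by (auto intro: rnil_mono simp del: rnil.simps)
  then show ?case using rnil_add add by blast
next
  case (mult f g)
  then show ?case using rnil_mult by blast
qed

text \<open>Polynomials \<open>p\<close> for which \<open>p\<close> times the inverse of \<open>u \<mapsto> r u y\<close> is polynomial in \<open>y\<close>.\<close>

definition denominator :: "(real ^ 'n \<Rightarrow> real) \<Rightarrow> bool" where
  "denominator p \<longleftrightarrow> real_polynomial_function p \<and>
     (\<forall>w. \<exists>n. (\<forall>i. real_polynomial_function (\<lambda>y. n y $ i)) \<and> (\<forall>y. r (n y) y = p y *\<^sub>R w))"

text \<open>Differentiate \<open>r (n y) y = p y *\<^sub>R w\<close> along \<open>r u\<close>.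
  Besides \<open>r (dn y) y\<close> this leaves \<open>m (n y) (r u y)\<close>, which left symmetry
  rewrites as \<open>m u (p y *\<^sub>R w)\<close> minus a value of \<open>r\<close>. The former is
  a value of \<open>r\<close> as well, because \<open>p\<close> is also a denominator for the vector
  \<open>m u w\<close>. The witness \<open>q\<close> collects the three contributions.\<close>

lemma denominator_rderiv:
  assumes "denominator p"
  shows "denominator (rderiv u p)"
  unfolding denominator_def
proof (intro conjI allI)
  have p: "real_polynomial_function p" using assms by (simp add: denominator_def)
  show "real_polynomial_function (rderiv u p)" by (rule real_polynomial_rderiv[OF p])
  fix w
  obtain n where n: "\<And>i. real_polynomial_function (\<lambda>y. n y $ i)" "\<And>y. r (n y) y = p y *\<^sub>R w"
    using assms unfolding denominator_def by blast
  obtain n' where n': "\<And>i. real_polynomial_function (\<lambda>y. n' y $ i)" "\<And>y. r (n' y) y = p y *\<^sub>R m u w"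
    using assms unfolding denominator_def by blast
  define dn where "dn y = (\<chi> i. rderiv u (\<lambda>y. n y $ i) y)" for y
  define q where "q y = n' y - (m u (n y) - m (n y) u) + dn y" for y
  have m_poly: "real_polynomial_function (\<lambda>y. m u (n y) $ i)" "real_polynomial_function (\<lambda>y. m (n y) u $ i)" for i
  proof -
    have "m u (n y) $ i = (\<Sum>j\<in>UNIV. n y $ j * m u (axis j 1) $ i)"
      "m (n y) u $ i = (\<Sum>j\<in>UNIV. n y $ j * m (axis j 1) u $ i)" for y
      using linear_sum_axis[OF linear_m2, of u "n y"] linear_sum_axis[OF linear_m1, of "n y" u] by simp_all
    then show "real_polynomial_function (\<lambda>y. m u (n y) $ i)" "real_polynomial_function (\<lambda>y. m (n y) u $ i)"
      by (simp_all add: n real_polynomial_function_sum real_polynomial_mult real_polynomial_const)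
  qed
  have "real_polynomial_function (\<lambda>y. q y $ i)" for i
    by (simp add: q_def dn_def)
       (intro real_polynomial_add real_polynomial_function_diff n' m_poly real_polynomial_rderiv n)
  moreover have "r (q y) y = rderiv u p y *\<^sub>R w" for y
  proof -
    have dn: "(n has_derivative (\<lambda>h. \<chi> i. frechet_derivative (\<lambda>y. n y $ i) (at y) h)) (at y)"
      unfolding has_derivative_componentwise_within[where f=n]
      using real_polynomial_has_derivative[OF n(1)] by (auto simp: Basis_vec_def inner_axis)
    have dr: "((\<lambda>y. r (n y) y) has_derivative (\<lambda>h. n'' h + (m (n y) h + m (n'' h) (y - y0)))) (at y)"
      if "(n has_derivative n'') (at y)" for n''
    proof -
      have "((\<lambda>y. y - y0) has_derivative (\<lambda>h. h)) (at y)" by (auto intro!: derivative_eq_intros)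
      then show ?thesis
        unfolding r_def
        by (intro has_derivative_add that
            bounded_bilinear.FDERIV[OF bilinear_conv_bounded_bilinear[THEN iffD1, OF bilinear_m]])
    qed
    have dn_eq: "(\<chi> i. frechet_derivative (\<lambda>y. n y $ i) (at y) (r u y)) = dn y"
      by (simp add: dn_def rderiv_def)
    have "((\<lambda>y. p y *\<^sub>R w) has_derivative (\<lambda>h. frechet_derivative p (at y) h *\<^sub>R w)) (at y)"
      by (intro has_derivative_scaleR_left real_polynomial_has_derivative p)
    from has_derivative_unique[OF dr[OF dn, unfolded n(2)] this]
    have "rderiv u p y *\<^sub>R w = dn y + (m (n y) (r u y) + m (dn y) (y - y0))"
      by (auto simp: rderiv_def dn_eq dest!: fun_cong[of _ _ "r u y"])
    \<comment> \<open>For constant \<open>n\<close> this says that the fields \<open>r\<close> are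
      closed under the Lie bracket.\<close>
    moreover have "m (n y) (r u y) + r (m u (n y) - m (n y) u) y = m u (r (n y) y)"
      using flat[of u "n y" "y - y0"] by (simp add: r_def m_simps algebra_simps)
    moreover have "m u (r (n y) y) = r (n' y) y" by (simp add: n n' m_simps)
    ultimately show ?thesis
      by (simp add: q_def linear_add[OF linear_r] linear_diff[OF linear_r]) (simp add: r_def algebra_simps)
  qed
  ultimately show "\<exists>n. (\<forall>i. real_polynomial_function (\<lambda>y. n y $ i)) \<and> (\<forall>y. r (n y) y = rderiv u p y *\<^sub>R w)"
    by blast
qed

text \<open>While some derivative of the denominator is nonzero, it is a denominator that
  \<open>rnil\<close> kills one step earlier, so the process stops at a nonzero \<open>p\<close>
  annihilated by all fields \<open>r\<close>.\<close>

lemma denominator_const: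
  assumes "rnil k p" "denominator p" "p y \<noteq> 0"
  shows "\<exists>c\<noteq>0. denominator (\<lambda>y. c)"
  using assms
proof (induction k arbitrary: p y)
  case 0
  then show ?case by auto
next
  case (Suc k)
  have p: "real_polynomial_function p" using Suc.prems by (simp add: denominator_def)
  show ?case
  proof (cases "\<exists>u y. rderiv u p y \<noteq> 0")
    case True
    then obtain u y where "rderiv u p y \<noteq> 0" by blast
    then show ?thesis using Suc.IH[of "rderiv u p" y] Suc.prems denominator_rderiv by simp
  next
    case False
    \<comment> \<open>The vector \<open>p y *\<^sub>R w\<close> is a value of \<open>r\<close> at
      \<open>y\<close>, so \<open>p\<close> has derivative zero along it even where the fields
      \<open>r\<close> might fail to span. This makes \<open>p * p\<close> constant, and
      \<open>p * p\<close> is a denominator because \<open>p\<close> is one.\<close>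
    have zero: "p y * frechet_derivative p (at y) w = 0" for y w
    proof -
      obtain n where "r (n y) y = p y *\<^sub>R w"
        using Suc.prems unfolding denominator_def by blast
      then have "frechet_derivative p (at y) (p y *\<^sub>R w) = rderiv (n y) p y" by (simp add: rderiv_def)
      then show ?thesis
        using False linear_scale[OF has_derivative_linear[OF real_polynomial_has_derivative[OF p]], of y "p y" w]
        by simp
    qed
    have const: "p x * p x = p y * p y" for x
    proof (rule has_derivative_zero_unique_connected[of UNIV "\<lambda>y. p y * p y"])
      fix x
      show "((\<lambda>y. p y * p y) has_derivative (\<lambda>h. 0)) (at x)"
        using has_derivative_mult[OF real_polynomial_has_derivative[OF p] real_polynomial_has_derivative[OF p], of x]
          zero[of x] by (simp add: mult.commute)
    qed (auto simp: connected_UNIV)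
    have "denominator (\<lambda>x. p y * p y)"
      unfolding denominator_def
    proof (intro conjI allI real_polynomial_const)
      fix w
      obtain n where n: "\<And>i. real_polynomial_function (\<lambda>y. n y $ i)" "\<And>y. r (n y) y = p y *\<^sub>R w"
        using Suc.prems unfolding denominator_def by blast
      have "r (p x *\<^sub>R n x) x = (p y * p y) *\<^sub>R w" for x
        using linear_scale[OF linear_r, of "p x" "n x" x] n(2)[of x] const[of x] by simp
      then show "\<exists>n. (\<forall>i. real_polynomial_function (\<lambda>y. n y $ i)) \<and> (\<forall>x. r (n x) x = (p y * p y) *\<^sub>R w)"
        using n(1) p by (intro exI[of _ "\<lambda>x. p x *\<^sub>R n x"]) (auto intro: real_polynomial_mult)
    qed
    then show ?thesis using Suc.prems by (intro exI[of _ "p y * p y"]) auto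
  qed
qed

text \<open>Cramer's rule with determinants as numerators. It applies where the determinant is
  nonzero, an open set containing \<open>y0\<close> because \<open>r u y0 = u\<close>; the resulting
  identity is polynomial and so extends to every \<open>y\<close>.\<close>

lemma denominator_det: "\<exists>p. denominator p \<and> p y0 \<noteq> 0"
proof -
  define F where "F y = matrix (\<lambda>u. r u y)" for y
  have F: "F y *v u = r u y" for y u unfolding F_def
    by (rule fun_cong[OF matrix_vector_mul(2)[OF linear_r]])
  have Fpoly: "real_polynomial_function (\<lambda>y. F y $ i $ j)" for i j
    by (simp add: F_def matrix_def real_polynomial_r)
  define T where "T = {y. det (F y) \<noteq> 0}"
  have detpoly: "real_polynomial_function (\<lambda>y. det (F y))" by (rule real_polynomial_det[OF Fpoly])
  have "F y0 = mat 1" by (simp add: matrix_eq F) (simp add: r_def linear_0[OF linear_m2])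
  then have y0T: "y0 \<in> T" by (simp add: T_def)
  have contdet: "continuous_on UNIV (\<lambda>y. det (F y))"
    using differentiable_on_real_polynomial_function[OF detpoly] differentiable_imp_continuous_on by blast
  have "T = (\<lambda>y. det (F y)) -` (- {0})" by (auto simp: T_def)
  then have openT: "open T" using contdet by (simp add: open_vimage open_Compl)
  have "denominator (\<lambda>y. det (F y))"
    unfolding denominator_def
  proof (intro conjI detpoly allI)
    fix w :: "real^'n"
    define n where "n y = (\<chi> k. det (\<chi> i j. if j = k then w $ i else F y $ i $ j))" for y
    have npoly: "real_polynomial_function (\<lambda>y. n y $ k)" for k
      unfolding n_def vec_lambda_beta
    proof (rule real_polynomial_det)
      fix i j
      show "real_polynomial_function (\<lambda>y. (\<chi> i j. if j = k then w $ i else F y $ i $ j) $ i $ j)"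
        by (cases "j = k") (auto simp: Fpoly real_polynomial_const)
    qed
    have onT: "r (n y) y = det (F y) *\<^sub>R w" if "y \<in> T" for y
    proof -
      have d: "det (F y) \<noteq> 0" using that by (simp add: T_def)
      have "F y *v (\<chi> k. det (\<chi> i j. if j = k then w $ i else F y $ i $ j) / det (F y)) = w"
        using cramer[OF d] by blast
      moreover have "(\<chi> k. det (\<chi> i j. if j = k then w $ i else F y $ i $ j) / det (F y)) = inverse (det (F y)) *\<^sub>R n y"
        by (simp add: n_def vec_eq_iff divide_inverse)
      ultimately have "inverse (det (F y)) *\<^sub>R r (n y) y = w"
        by (simp add: F linear_scale[OF linear_r])
      then have "det (F y) *\<^sub>R (inverse (det (F y)) *\<^sub>R r (n y) y) = det (F y) *\<^sub>R w" by simp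
      then show ?thesis using d by simp
    qed
    have "r (n y) y $ i = (det (F y) *\<^sub>R w) $ i" for y i
    proof -
      have eq: "r (n y) y $ i = (\<Sum>j\<in>UNIV. n y $ j * r (axis j 1) y $ i)" for y
        using linear_sum_axis[OF linear_r, of "n y" y] by simp
      have "r (n y) y $ i - det (F y) * w $ i = 0"
      proof (rule real_polynomial_zero_on_open[of "\<lambda>y. r (n y) y $ i - det (F y) * w $ i" T y0])
        show "real_polynomial_function (\<lambda>y. r (n y) y $ i - det (F y) * w $ i)"
          unfolding eq
          by (intro real_polynomial_function_diff real_polynomial_function_sum finite real_polynomial_mult
              npoly real_polynomial_r detpoly real_polynomial_const)
      qed (simp_all add: openT y0T onT)
      then show ?thesis by simp
    qed
    then show "\<exists>n. (\<forall>i. real_polynomial_function (\<lambda>y. n y $ i)) \<and> (\<forall>y. r (n y) y = det (F y) *\<^sub>R w)"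
      using npoly by (intro exI[of _ n]) (auto simp: vec_eq_iff)
  qed
  then show ?thesis using y0T by (auto simp: T_def)
qed

lemma r_inverse_polynomial:
  "\<exists>n. (\<forall>i. real_polynomial_function (\<lambda>y. n y $ i)) \<and> (\<forall>y. r (n y) y = w)"
proof -
  obtain p where p: "denominator p" "p y0 \<noteq> 0" using denominator_det by blast
  then have "real_polynomial_function p" by (simp add: denominator_def)
  then obtain k where "rnil k p" using polynomial_rnil by blast
  from denominator_const[OF this p] obtain c where c: "c \<noteq> 0" "denominator (\<lambda>y. c)" by blast
  then obtain n where n: "\<And>i. real_polynomial_function (\<lambda>y. n y $ i)" "\<And>y. r (n y) y = c *\<^sub>R w"
    unfolding denominator_def by blast
  then show ?thesis using c(1)
    by (intro exI[of _ "\<lambda>y. inverse c *\<^sub>R n y"])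
       (auto simp: linear_scale[OF linear_r] intro!: real_polynomial_mult real_polynomial_const)
qed

text \<open>Induction on the number of left multiplications after which \<open>l\<close> vanishes.
  The derivative along \<open>r u\<close> is \<open>l (m u (E y v))\<close>, polynomial by the
  hypothesis for \<open>l\<close> composed with \<open>m u\<close>; the polynomial inverse of
  \<open>r\<close> converts this into partial derivatives.\<close>

lemma functional_E_polynomial:
  fixes l :: "real ^ 'n \<Rightarrow> real"
  assumes "linear l" "\<And>us v. length us = k \<Longrightarrow> l (foldr m us v) = 0"
  shows "\<exists>Q. real_polynomial_function Q \<and> (\<forall>y\<in>S. l (E y v) = Q y)"
  using assms
proof (induction k arbitrary: l)
  case 0
  then have "l = (\<lambda>y. 0)" by (auto simp: fun_eq_iff)
  then show ?case by (auto intro: real_polynomial_const)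
next
  case (Suc k)
  have "\<exists>Q. real_polynomial_function Q \<and> (\<forall>y\<in>S. l (m u (E y v)) = Q y)" for u
  proof (rule Suc.IH)
    show "linear (\<lambda>y. l (m u y))" using linear_compose[OF linear_m2 Suc.prems(1)] by (simp add: o_def)
    show "l (m u (foldr m us v)) = 0" if "length us = k" for us v
      using Suc.prems(2)[of "u # us" v] that by simp
  qed
  then obtain Q where Q: "\<And>u. real_polynomial_function (Q u)" "\<And>u y. y \<in> S \<Longrightarrow> l (m u (E y v)) = Q u y"
    by metis
  show ?case
  proof (rule polynomial_if_polynomial_derivative[OF open_S connected_S])
    show "((\<lambda>y. l (E y v)) has_derivative (\<lambda>h. l (dE v y h))) (at y)" if "y \<in> S" for y
      using Suc.prems(1) E_has_derivative[OF that]
      by (intro bounded_linear.has_derivative[where f=l]) (simp_all add: linear_conv_bounded_linear)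
    fix i
    obtain n where n: "\<And>i. real_polynomial_function (\<lambda>y. n y $ i)" "\<And>y. r (n y) y = axis i 1"
      using r_inverse_polynomial by blast
    have "l (dE v y (axis i 1)) = (\<Sum>j\<in>UNIV. n y $ j * Q (axis j 1) y)" if y: "y \<in> S" for y
    proof -
      have lin: "linear (\<lambda>u. l (dE v y (r u y)))"
        using linear_compose[OF linear_compose[OF linear_r linear_dE[OF y]] Suc.prems(1)] by (simp add: o_def)
      show ?thesis
        using linear_sum_axis[OF lin, of "n y"] by (simp add: n(2) dE_r[OF y] Q(2)[OF y])
    qed
    then show "\<exists>q. real_polynomial_function q \<and> (\<forall>y\<in>S. l (dE v y (axis i 1)) = q y)"
      by (intro exI[of _ "\<lambda>y. \<Sum>j\<in>UNIV. n y $ j * Q (axis j 1) y"])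
         (auto intro!: real_polynomial_function_sum real_polynomial_mult n Q)
  qed
qed

lemma E_polynomial: "\<exists>Q. real_polynomial_function Q \<and> (\<forall>y\<in>S. E y v $ i = Q y)"
  by (rule functional_E_polynomial[of "\<lambda>y. y $ i" K])
     (simp_all add: nilpotent linear_iff)

end


subsection \<open>Charts, smooth functions and tangent vectors\<close>

lemma is_chartD:
  assumes "is_chart (U, x)"
  shows "open U" "open (x ` U)" "inj_on x U" "continuous_on U x" "continuous_on (x ` U) (inv_into U x)"
    "homeomorphism U (x ` U) x (inv_into U x)"
proof -
  show *: "open U" "open (x ` U)" "homeomorphism U (x ` U) x (inv_into U x)"
    using assms by (auto simp: is_chart_def)
  show "inj_on x U" by (rule inj_on_inverseI[of _ "inv_into U x"]) (use * in \<open>auto simp: homeomorphism_def\<close>)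
  show "continuous_on U x" "continuous_on (x ` U) (inv_into U x)" using * by (auto simp: homeomorphism_def)
qed

lemma open_chart_image:
  assumes "is_chart (U, x)" "open V"
  shows "open (x ` (U \<inter> V))"
proof -
  have "openin (top_of_set U) (U \<inter> V)" using assms(2) by (simp add: openin_open_Int)
  from homeomorphism_imp_open_map[OF is_chartD(6)[OF assms(1)] this]
  show ?thesis using is_chartD(2)[OF assms(1)] openin_open_trans by blast
qed

lemma open_chart_image_subset:
  assumes "is_chart (U, x)" "open V" "V \<subseteq> U"
  shows "open (x ` V)"
  using open_chart_image[OF assms(1,2)] assms(3) by (simp add: Int_absorb1)

locale manifold =
  fixes A :: "('g::topological_space, real ^ 'n) chart set"
  assumes atlas: "smooth_atlas A"
begin

lemma smooth_chart_atlas: "c \<in> A \<Longrightarrow> smooth_chart A c"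
  using atlas by (auto simp: smooth_atlas_def smooth_chart_def)

lemma chart_at: obtains U x where "(U, x) \<in> A" "p \<in> U"
  using atlas unfolding smooth_atlas_def by (metis UNIV_I UN_E fst_conv surj_pair)

lemma smooth_chartD: "smooth_chart A (U, x) \<Longrightarrow> is_chart (U, x)"
  by (simp add: smooth_chart_def)

lemma smooth_transition:
  assumes "smooth_chart A (U, x)" "(V, \<phi>) \<in> A"
  shows "smooth_on (x ` (U \<inter> V)) (\<lambda>y. \<phi> (inv_into U x y))"
    and "smooth_on (\<phi> ` (U \<inter> V)) (\<lambda>y. x (inv_into V \<phi> y))"
proof -
  have "compatible (U, x) (V, \<phi>)" using assms unfolding smooth_chart_def by blast
  then show "smooth_on (x ` (U \<inter> V)) (\<lambda>y. \<phi> (inv_into U x y))"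
    "smooth_on (\<phi> ` (U \<inter> V)) (\<lambda>y. x (inv_into V \<phi> y))"
    by (simp_all add: compatible_def o_def)
qed

text \<open>\<open>smooth_fun\<close> tests charts of the atlas only, whereas affine charts are
  merely compatible with it. The transition map to an atlas chart bridges the difference.\<close>

lemma smooth_fun_chart:
  assumes c: "smooth_chart A (U, x)" and W: "open W" "smooth_fun A W f"
  shows "smooth_on (x ` (U \<inter> W)) (\<lambda>y. f (inv_into U x y))"
proof (rule smooth_on_local)
  fix y assume "y \<in> x ` (U \<inter> W)"
  then obtain p where p: "y = x p" "p \<in> U" "p \<in> W" by blast
  obtain V \<phi> where V: "(V, \<phi>) \<in> A" "p \<in> V" by (rule chart_at)
  have cV: "is_chart (V, \<phi>)" using smooth_chartD[OF smooth_chart_atlas[OF V(1)]] .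
  note cU = smooth_chartD[OF c]
  let ?T = "x ` (U \<inter> (V \<inter> W))"
  have T: "open ?T" by (intro open_chart_image[OF cU] open_Int W(1) is_chartD(1)[OF cV])
  have "smooth_on (\<phi> ` (W \<inter> V)) (\<lambda>y. f (inv_into V \<phi> y))"
    using W(2) V(1) unfolding smooth_fun_def by (auto simp: o_def)
  moreover have "open (\<phi> ` (W \<inter> V))" using open_chart_image[OF cV W(1)] by (simp add: Int_commute)
  moreover have "smooth_on ?T (\<lambda>y. \<phi> (inv_into U x y))"
    by (rule smooth_on_subset[OF smooth_transition(1)[OF c V(1)]]) auto
  moreover have "(\<lambda>y. \<phi> (inv_into U x y)) ` ?T \<subseteq> \<phi> ` (W \<inter> V)"
    using is_chartD(3)[OF cU] by auto
  ultimately have "smooth_on ?T (\<lambda>y. f (inv_into V \<phi> (\<phi> (inv_into U x y))))"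
    using smooth_on_compose[OF T, of "\<phi> ` (W \<inter> V)"] by blast
  then have "smooth_on ?T (\<lambda>y. f (inv_into U x y))"
    by (rule smooth_on_cong[OF T, rotated])
       (use is_chartD(3)[OF cU] is_chartD(3)[OF cV] in auto)
  then show "\<exists>T. open T \<and> y \<in> T \<and> smooth_on T (\<lambda>y. f (inv_into U x y))"
    using T p V by (intro exI[of _ ?T]) auto
qed

text \<open>Transition maps from atlas charts are smooth, so a single compatible chart around each
  point decides, on a domain \<open>D\<close> that may be taken small.\<close>

lemma smooth_funI:
  assumes "\<And>p. p \<in> W \<Longrightarrow> \<exists>V x D. smooth_chart A (V, x) \<and> open D \<and> p \<in> D \<and> D \<subseteq> V \<and>
      smooth_on (x ` D) (\<lambda>y. f (inv_into V x y))"
  shows "smooth_fun A W f"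
  unfolding smooth_fun_def
proof (clarsimp simp: o_def, rule smooth_on_local)
  fix U \<phi> y assume U: "(U, \<phi>) \<in> A" and "y \<in> \<phi> ` (W \<inter> U)"
  then obtain p where p: "y = \<phi> p" "p \<in> W" "p \<in> U" by blast
  obtain V x D where V: "smooth_chart A (V, x)" and D: "open D" "p \<in> D" "D \<subseteq> V"
    and f: "smooth_on (x ` D) (\<lambda>y. f (inv_into V x y))" using assms[OF p(2)] by blast
  have cU: "is_chart (U, \<phi>)" using smooth_chartD[OF smooth_chart_atlas[OF U]] .
  note cV = smooth_chartD[OF V]
  let ?T = "\<phi> ` (U \<inter> D)"
  have T: "open ?T" by (intro open_chart_image[OF cU] D)
  have "smooth_on ?T (\<lambda>y. x (inv_into U \<phi> y))"
    by (rule smooth_on_subset[OF smooth_transition(2)[OF V U]]) (use D in auto)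
  moreover have "(\<lambda>y. x (inv_into U \<phi> y)) ` ?T \<subseteq> x ` D"
    using is_chartD(3)[OF cU] by auto
  moreover have "open (x ` D)" by (rule open_chart_image_subset[OF cV D(1,3)])
  ultimately have "smooth_on ?T (\<lambda>y. f (inv_into V x (x (inv_into U \<phi> y))))"
    using smooth_on_compose[OF T, of "x ` D"] f by blast
  then have "smooth_on ?T (\<lambda>y. f (inv_into U \<phi> y))"
    by (rule smooth_on_cong[OF T, rotated])
       (use is_chartD(3)[OF cU] is_chartD(3)[OF cV] D in auto)
  then show "\<exists>T. open T \<and> y \<in> T \<and> smooth_on T (\<lambda>y. f (inv_into U \<phi> y))"
    using T p D by (intro exI[of _ ?T]) auto
qed

lemma smooth_fun_subset: "smooth_fun A W f \<Longrightarrow> V \<subseteq> W \<Longrightarrow> smooth_fun A V f"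
  unfolding smooth_fun_def by (fastforce intro: smooth_on_subset)

lemma smooth_fun_cong:
  assumes W: "open W" and fg: "\<And>p. p \<in> W \<Longrightarrow> f p = g p" and f: "smooth_fun A W f"
  shows "smooth_fun A W g"
  unfolding smooth_fun_def
proof clarify
  fix U x assume U: "(U, x) \<in> A"
  have c: "is_chart (U, x)" using smooth_chartD[OF smooth_chart_atlas[OF U]] .
  have o: "open (x ` (W \<inter> U))" using open_chart_image[OF c W] by (simp add: Int_commute)
  have "smooth_on (x ` (W \<inter> U)) (f \<circ> inv_into U x)" using f U unfolding smooth_fun_def by blast
  then show "smooth_on (x ` (W \<inter> U)) (g \<circ> inv_into U x)"
    by (rule smooth_on_cong[OF o, rotated]) (use fg is_chartD(3)[OF c] in auto)
qed

lemma smooth_fun_const: "smooth_fun A W (\<lambda>p. c)"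
  by (auto simp: smooth_fun_def o_def smooth_on_const)

lemma smooth_fun_coordinate:
  assumes c: "smooth_chart A (U, x)"
  shows "smooth_fun A U (\<lambda>q. x q $ i)"
proof (rule smooth_funI)
  fix p assume "p \<in> U"
  note cU = smooth_chartD[OF c]
  have "smooth_on (x ` U) (\<lambda>y. x (inv_into U x y) $ i)"
    by (rule smooth_on_cong[OF is_chartD(2)[OF cU] _ smooth_on_linear[OF bounded_linear_vec_nth, of _ i]])
       (simp add: f_inv_into_f)
  then show "\<exists>V x' D. smooth_chart A (V, x') \<and> open D \<and> p \<in> D \<and> D \<subseteq> V \<and>
      smooth_on (x' ` D) (\<lambda>y. x (inv_into V x' y) $ i)"
    using c is_chartD(1)[OF cU] \<open>p \<in> U\<close> by blast
qed

section \<open>Local smoothness and tangent vectors\<close>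

lemma smooth_atI: "open U \<Longrightarrow> p \<in> U \<Longrightarrow> smooth_fun A U f \<Longrightarrow> smooth_at A p f"
  by (auto simp: smooth_at_def)

lemma smooth_at_coordinate: "smooth_chart A (U, x) \<Longrightarrow> p \<in> U \<Longrightarrow> smooth_at A p (\<lambda>q. x q $ i)"
  using smooth_atI[OF is_chartD(1)[OF smooth_chartD] _ smooth_fun_coordinate] by blast

lemma smooth_at_cong:
  assumes "open W" "p \<in> W" "\<And>q. q \<in> W \<Longrightarrow> f q = g q" "smooth_at A p f"
  shows "smooth_at A p g"
proof -
  obtain V where V: "open V" "p \<in> V" "smooth_fun A V f" using assms(4) by (auto simp: smooth_at_def)
  have "smooth_fun A (V \<inter> W) g"
    by (rule smooth_fun_cong[of _ f]) (use V assms smooth_fun_subset[OF V(3)] in auto)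
  then show ?thesis using V assms by (intro smooth_atI[of "V \<inter> W"]) auto
qed

lemma smooth_at_has_derivative:
  assumes c: "smooth_chart A (U, x)" and p: "p \<in> U" and f: "smooth_at A p f"
  shows "((f \<circ> inv_into U x) has_derivative frechet_derivative (f \<circ> inv_into U x) (at (x p))) (at (x p))"
proof -
  obtain W where W: "open W" "p \<in> W" "smooth_fun A W f" using f by (auto simp: smooth_at_def)
  show ?thesis
    using smooth_on_imp_has_derivative[OF smooth_fun_chart[OF c W(1,3)], of "x p"] W(2) p
    by (simp add: o_def)
qed

text \<open>The chain rule for a map \<open>\<gamma>\<close> into the manifold. It covers changes of
  charts, where \<open>\<gamma>\<close> is a chart inverse, and left translations.\<close>

lemma has_derivative_along:
  assumes c: "smooth_chart A (U, x)" and f: "smooth_at A (\<gamma> z) f"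
    and T: "open T" "z \<in> T" "\<gamma> ` T \<subseteq> U" and \<gamma>: "((\<lambda>s. x (\<gamma> s)) has_derivative D) (at z)"
  shows "((\<lambda>s. f (\<gamma> s)) has_derivative
      (\<lambda>h. frechet_derivative (f \<circ> inv_into U x) (at (x (\<gamma> z))) (D h))) (at z)"
proof -
  have "\<gamma> z \<in> U" using T by auto
  from has_derivative_compose[OF \<gamma> smooth_at_has_derivative[OF c this f]]
  show ?thesis
    by (rule has_derivative_transform_within_open[OF _ T(1,2)])
       (use T(3) is_chartD(3)[OF smooth_chartD[OF c]] in auto)
qed

lemma dir_deriv_change:
  assumes c: "smooth_chart A (U, x)" "p \<in> U" and d: "smooth_chart A (V, \<phi>)" "p \<in> V"
    and s: "smooth_on (x ` (U \<inter> V)) (\<lambda>y. \<phi> (inv_into U x y))"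
  shows "\<exists>D. \<forall>v. dir_deriv A (U, x) p v = dir_deriv A (V, \<phi>) p (D v)"
proof -
  let ?D = "frechet_derivative (\<lambda>y. \<phi> (inv_into U x y)) (at (x p))"
  have inv: "inv_into U x (x p) = p" using is_chartD(3)[OF smooth_chartD[OF c(1)]] c(2) by simp
  have "dir_deriv A (U, x) p v f = dir_deriv A (V, \<phi>) p (?D v) f" for v f
  proof (cases "smooth_at A p f")
    case True
    have "((\<lambda>s. f (inv_into U x s)) has_derivative
      (\<lambda>h. frechet_derivative (f \<circ> inv_into V \<phi>) (at (\<phi> (inv_into U x (x p)))) (?D h))) (at (x p))"
    proof (rule has_derivative_along[OF d(1)])
      show "smooth_at A (inv_into U x (x p)) f" using True by (simp add: inv)
      show "open (x ` (U \<inter> V))"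
        by (rule open_chart_image[OF smooth_chartD[OF c(1)] is_chartD(1)[OF smooth_chartD[OF d(1)]]])
      show "x p \<in> x ` (U \<inter> V)" using c d by auto
      then show "((\<lambda>s. \<phi> (inv_into U x s)) has_derivative ?D) (at (x p))"
        by (rule smooth_on_imp_has_derivative[OF s])
      show "inv_into U x ` x ` (U \<inter> V) \<subseteq> V"
        using is_chartD(3)[OF smooth_chartD[OF c(1)]] by auto
    qed
    from frechet_derivativeI[OF this] show ?thesis
      using True by (simp add: dir_deriv_def inv o_def)
  qed (simp add: dir_deriv_def)
  then show ?thesis by blast
qed

text \<open>Transition maps transport direction vectors both ways, so compatible charts outside the
  atlas describe the same tangent space.\<close>

lemma tangent_space_chart:
  assumes c: "smooth_chart A (U, x)" "p \<in> U"
  shows "tangent_space A p = range (dir_deriv A (U, x) p)"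
proof (intro equalityI subsetI)
  fix \<tau> assume "\<tau> \<in> tangent_space A p"
  then obtain V \<phi> v where V: "(V, \<phi>) \<in> A" "p \<in> V" "\<tau> = dir_deriv A (V, \<phi>) p v"
    by (auto simp: tangent_space_def)
  have "smooth_on (\<phi> ` (V \<inter> U)) (\<lambda>y. x (inv_into V \<phi> y))"
    using smooth_transition(2)[OF c(1) V(1)] by (simp add: Int_commute)
  from dir_deriv_change[OF smooth_chart_atlas[OF V(1)] V(2) c this] V(3)
  show "\<tau> \<in> range (dir_deriv A (U, x) p)" by auto
next
  fix \<tau> assume "\<tau> \<in> range (dir_deriv A (U, x) p)"
  then obtain v where v: "\<tau> = dir_deriv A (U, x) p v" by blast
  obtain V \<phi> where V: "(V, \<phi>) \<in> A" "p \<in> V" by (rule chart_at)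
  from dir_deriv_change[OF c smooth_chart_atlas[OF V(1)] V(2) smooth_transition(1)[OF c(1) V(1)]]
  obtain D where "\<tau> = dir_deriv A (V, \<phi>) p (D v)" using v by blast
  then show "\<tau> \<in> tangent_space A p" using V by (auto simp: tangent_space_def)
qed

lemma linear_dir_deriv:
  assumes c: "smooth_chart A (U, x)" "p \<in> U"
  shows "linear (dir_deriv A (U, x) p)"
proof (rule linearI)
  note lin = has_derivative_linear[OF smooth_at_has_derivative[OF c]]
  show "dir_deriv A (U, x) p (v + w) = dir_deriv A (U, x) p v + dir_deriv A (U, x) p w" for v w
    by (auto simp: dir_deriv_def fun_eq_iff linear_add[OF lin])
  show "dir_deriv A (U, x) p (r *\<^sub>R v) = r *\<^sub>R dir_deriv A (U, x) p v" for r v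
    by (auto simp: dir_deriv_def fun_eq_iff scaleR_fun_def linear_scale[OF lin])
qed

lemma subspace_tangent_space: "subspace (tangent_space A p)"
proof -
  obtain V \<phi> where V: "(V, \<phi>) \<in> A" "p \<in> V" by (rule chart_at)
  show ?thesis
    unfolding tangent_space_chart[OF smooth_chart_atlas[OF V(1)] V(2)]
    by (rule linear_subspace_image[OF linear_dir_deriv[OF smooth_chart_atlas[OF V(1)] V(2)] subspace_UNIV])
qed

lemma dir_deriv_coordinate:
  assumes c: "smooth_chart A (U, x)" "p \<in> U"
  shows "dir_deriv A (U, x) p v (\<lambda>q. x q $ i) = v $ i"
proof -
  have "(((\<lambda>q. x q $ i) \<circ> inv_into U x) has_derivative (\<lambda>v. v $ i)) (at (x p))"
    by (rule has_derivative_transform_within_open[OF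
          bounded_linear_imp_has_derivative[OF bounded_linear_vec_nth] is_chartD(2)[OF smooth_chartD[OF c(1)]]])
       (use c in \<open>auto simp: f_inv_into_f\<close>)
  from frechet_derivativeI[OF this] show ?thesis
    by (simp add: dir_deriv_def smooth_at_coordinate[OF c])
qed

lemma tangent_eq_dir_deriv:
  assumes c: "smooth_chart A (U, x)" "p \<in> U" and "\<tau> \<in> tangent_space A p"
  shows "\<tau> = dir_deriv A (U, x) p (\<chi> i. \<tau> (\<lambda>q. x q $ i))"
proof -
  obtain v where v: "\<tau> = dir_deriv A (U, x) p v" using assms tangent_space_chart[OF c] by blast
  have "(\<chi> i. \<tau> (\<lambda>q. x q $ i)) = v" by (simp add: v dir_deriv_coordinate[OF c])
  then show ?thesis using v by simp
qed

lemma tangent_vector_apply: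
  assumes c: "smooth_chart A (U, x)" "p \<in> U" and "\<tau> \<in> tangent_space A p" "smooth_at A p f"
  shows "\<tau> f = frechet_derivative (f \<circ> inv_into U x) (at (x p)) (\<chi> i. \<tau> (\<lambda>q. x q $ i))"
  using arg_cong[OF tangent_eq_dir_deriv[OF c assms(3)], of "\<lambda>\<tau>. \<tau> f"] assms(4)
  by (simp add: dir_deriv_def)

lemma tangent_not_smooth: "\<tau> \<in> tangent_space A p \<Longrightarrow> \<not> smooth_at A p f \<Longrightarrow> \<tau> f = 0"
  by (auto simp: tangent_space_def dir_deriv_def)

lemma tangent_eqI:
  assumes c: "smooth_chart A (U, x)" "p \<in> U" and "\<tau> \<in> tangent_space A p" "\<sigma> \<in> tangent_space A p"
    and "\<And>i. \<tau> (\<lambda>q. x q $ i) = \<sigma> (\<lambda>q. x q $ i)"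
  shows "\<tau> = \<sigma>"
  using tangent_eq_dir_deriv[OF c assms(3)] tangent_eq_dir_deriv[OF c assms(4)] assms(5) by simp

text \<open>Equations between coordinate functions hold on a chart domain only and must still be
  usable under a tangent vector. If \<open>f\<close> is not smooth at \<open>p\<close>, neither is
  \<open>g\<close>, and both values are 0 by convention.\<close>

lemma tangent_local:
  assumes \<tau>: "\<tau> \<in> tangent_space A p" and W: "open W" "p \<in> W" "\<And>q. q \<in> W \<Longrightarrow> f q = g q"
  shows "\<tau> f = \<tau> g"
proof (cases "smooth_at A p f")
  case True
  then have g: "smooth_at A p g" using smooth_at_cong W by blast
  obtain U x where U: "(U, x) \<in> A" "p \<in> U" by (rule chart_at)
  note c = smooth_chart_atlas[OF U(1)]
  note i = is_chartD(3)[OF smooth_chartD[OF c]]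
  have "((g \<circ> inv_into U x) has_derivative frechet_derivative (f \<circ> inv_into U x) (at (x p))) (at (x p))"
    by (rule has_derivative_transform_within_open[OF smooth_at_has_derivative[OF c U(2) True]
          open_chart_image[OF smooth_chartD[OF c] W(1)]])
       (use U W i in auto)
  from frechet_derivativeI[OF this] show ?thesis
    by (simp add: tangent_vector_apply[OF c U(2) \<tau>] True g)
next
  case False
  then have "\<not> smooth_at A p g" using smooth_at_cong[OF W(1,2), of g f] W(3) by auto
  then show ?thesis using False tangent_not_smooth[OF \<tau>] by simp
qed

lemma tangent_const: "\<tau> \<in> tangent_space A p \<Longrightarrow> \<tau> (\<lambda>q. c) = 0"
  by (auto simp: tangent_space_def dir_deriv_def o_def)

section \<open>Vector fields in charts and their brackets\<close>

lemma vector_field_tangent: "X \<in> vector_fields A \<Longrightarrow> X p \<in> tangent_space A p"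
  by (simp add: vector_fields_def)

lemma vector_field_smooth:
  "X \<in> vector_fields A \<Longrightarrow> open U \<Longrightarrow> smooth_fun A U f \<Longrightarrow> smooth_fun A U (\<lambda>q. X q f)"
  by (simp add: vector_fields_def)

lemma smooth_vector_field_components:
  assumes c: "smooth_chart A (U, x)" and X: "X \<in> vector_fields A"
  shows "smooth_on (x ` U) (\<lambda>y. \<chi> i. X (inv_into U x y) (\<lambda>q. x q $ i))"
proof (rule smooth_on_vec)
  note cU = smooth_chartD[OF c]
  show "open (x ` U)" by (rule is_chartD(2)[OF cU])
  show "smooth_on (x ` U) (\<lambda>y. (\<chi> i. X (inv_into U x y) (\<lambda>q. x q $ i)) $ i)" for i
    using smooth_fun_chart[OF c is_chartD(1)[OF cU]
        vector_field_smooth[OF X is_chartD(1)[OF cU] smooth_fun_coordinate[OF c]]]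
    by simp
qed

lemma vf_bracket_tangent:
  assumes X: "X \<in> vector_fields A" and Y: "Y \<in> vector_fields A"
  shows "vf_bracket A X Y p \<in> tangent_space A p"
proof -
  obtain U x where U: "(U, x) \<in> A" "p \<in> U" by (rule chart_at)
  note c = smooth_chart_atlas[OF U(1)]
  note cU = smooth_chartD[OF c]
  note inj = is_chartD(3)[OF cU]
  define comp where "comp X y = (\<chi> i. X (inv_into U x y) (\<lambda>q. x q $ i))" for X :: "'g vfield" and y
  \<comment> \<open>The coordinate bracket of the component vectors of \<open>X\<close> and
    \<open>Y\<close>, as in \<open>commutator_derivative\<close>.\<close>
  define w where "w = frechet_derivative (comp Y) (at (x p)) (comp X (x p))
     - frechet_derivative (comp X) (at (x p)) (comp Y (x p))"
  have comp: "(comp X has_derivative frechet_derivative (comp X) (at (x p))) (at (x p))"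
    if "X \<in> vector_fields A" for X
    using smooth_on_imp_has_derivative[OF smooth_vector_field_components[OF c that], of "x p"] U(2)
    by (simp add: comp_def[abs_def])
  have "vf_bracket A X Y p f = dir_deriv A (U, x) p w f" for f
  proof (cases "smooth_at A p f")
    case True
    then obtain W where W: "open W" "p \<in> W" "smooth_fun A W f" by (auto simp: smooth_at_def)
    let ?S = "x ` (U \<inter> W)"
    let ?f = "f \<circ> inv_into U x"
    have S: "open ?S" "x p \<in> ?S" using open_chart_image[OF cU W(1)] U W by auto
    have Ck: "Ck_on 2 ?f ?S"
      using smooth_fun_chart[OF c W(1,3)] by (simp add: smooth_on_def o_def)
    have app: "X q f = frechet_derivative ?f (at (x q)) (comp X (x q))"
      if "X \<in> vector_fields A" "q \<in> U \<inter> W" for X q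
      using tangent_vector_apply[OF c _ vector_field_tangent[OF that(1)], of q f] that W inj
      by (auto simp: comp_def intro!: smooth_atI)
    have app2: "X p (\<lambda>q. Y q f) =
        frechet_derivative (\<lambda>y. frechet_derivative ?f (at y) (comp Y y)) (at (x p)) (comp X (x p))"
      if X: "X \<in> vector_fields A" and Y: "Y \<in> vector_fields A" for X Y
    proof -
      have sm: "smooth_at A p (\<lambda>q. Y q f)"
        using smooth_atI[OF W(1,2) vector_field_smooth[OF Y W(1,3)]] .
      have "X p (\<lambda>q. Y q f) = frechet_derivative ((\<lambda>q. Y q f) \<circ> inv_into U x) (at (x p)) (comp X (x p))"
        using tangent_vector_apply[OF c U(2) vector_field_tangent[OF X] sm] inj U(2) by (simp add: comp_def)
      moreover have "((\<lambda>y. frechet_derivative ?f (at y) (comp Y y)) has_derivative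
          frechet_derivative ((\<lambda>q. Y q f) \<circ> inv_into U x) (at (x p))) (at (x p))"
      proof (rule has_derivative_transform_within_open[OF smooth_at_has_derivative[OF c U(2) sm] S])
        fix y assume "y \<in> ?S"
        then obtain q where "y = x q" "q \<in> U \<inter> W" by blast
        then show "((\<lambda>q. Y q f) \<circ> inv_into U x) y = frechet_derivative ?f (at y) (comp Y y)"
          using app[OF Y, of q] inj by simp
      qed
      ultimately show ?thesis by (simp only: frechet_derivativeI)
    qed
    show ?thesis
      using commutator_derivative[OF S Ck comp[OF X] comp[OF Y]] True
      by (simp add: vf_bracket_def dir_deriv_def app2 X Y w_def)
  qed (simp add: vf_bracket_def dir_deriv_def)
  then have "vf_bracket A X Y p = dir_deriv A (U, x) p w" by blast
  then show ?thesis using tangent_space_chart[OF c U(2)] by blast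
qed

end


subsection \<open>Left invariant vector fields on a Lie group\<close>

locale lie =
  fixes G :: "'g::{t2_space, second_countable_topology} monoid"
    and A :: "('g, real ^ 'n) chart set"
  assumes lie_group: "lie_group G A"
begin

sublocale manifold A
  using lie_group by unfold_locales (simp add: lie_group_def)

sublocale group G
  using lie_group by (simp add: lie_group_def)

lemma in_carrier [simp]: "g \<in> carrier G"
  using lie_group by (simp add: lie_group_def)

lemma mult_inv_cancel [simp]: "g \<otimes>\<^bsub>G\<^esub> (inv\<^bsub>G\<^esub> g \<otimes>\<^bsub>G\<^esub> h) = h" "inv\<^bsub>G\<^esub> g \<otimes>\<^bsub>G\<^esub> (g \<otimes>\<^bsub>G\<^esub> h) = h"
  by (simp_all flip: m_assoc)

lemma continuous_mult: "continuous_on UNIV (\<lambda>(g, h). g \<otimes>\<^bsub>G\<^esub> h)"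
  using lie_group by (simp add: lie_group_def smooth_map_def)

lemma continuous_left_mult: "continuous_on UNIV (\<lambda>h. g \<otimes>\<^bsub>G\<^esub> h)"
proof -
  have "continuous_on UNIV (\<lambda>h. (\<lambda>(g, h). g \<otimes>\<^bsub>G\<^esub> h) (g, h))"
    by (rule continuous_on_compose2[OF continuous_mult]) (auto intro: continuous_intros)
  then show ?thesis by simp
qed

lemma open_left_preimage: "open U \<Longrightarrow> open {h. g \<otimes>\<^bsub>G\<^esub> h \<in> U}"
  using open_vimage[OF _ continuous_left_mult] by (simp add: vimage_def)

text \<open>Smoothness of multiplication is given between atlas charts, so near each point the
  product passes through a chart \<open>\<theta>\<close> at \<open>p \<otimes> q\<close>. Joint
  smoothness in both factors is what makes left invariant fields smooth.\<close>

lemma smooth_mult: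
  assumes V: "(V, \<psi>) \<in> A" and W: "(W, \<phi>) \<in> A" and U: "open U" "smooth_fun A U f"
  defines "\<Omega> \<equiv> (\<lambda>(p, q). (\<psi> p, \<phi> q)) ` (V \<times> W \<inter> {(p, q). p \<otimes>\<^bsub>G\<^esub> q \<in> U})"
  shows "open \<Omega>" "smooth_on \<Omega> (\<lambda>(y, z). f (inv_into V \<psi> y \<otimes>\<^bsub>G\<^esub> inv_into W \<phi> z))"
proof -
  let ?\<Phi> = "\<lambda>(p, q). (\<psi> p, \<phi> q)" and ?m = "\<lambda>(g, h). g \<otimes>\<^bsub>G\<^esub> h"
  have cV: "is_chart (V, \<psi>)" and cW: "is_chart (W, \<phi>)"
    using smooth_chartD[OF smooth_chart_atlas] V W by auto
  note inj = is_chartD(3)[OF cV] is_chartD(3)[OF cW]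
  have inj\<Phi>: "inj_on ?\<Phi> (V \<times> W)" using inj by (auto simp: inj_on_def)
  have inv\<Phi>: "inv_into (V \<times> W) ?\<Phi> (\<psi> p, \<phi> q) = (p, q)" if "p \<in> V" "q \<in> W" for p q
    by (rule inv_into_f_eq[OF inj\<Phi>]) (use that in auto)
  have open_im: "open (?\<Phi> ` (V \<times> W \<inter> ?m -` N))" if N: "open N" for N
  proof -
    let ?h = "\<lambda>(y, z). inv_into V \<psi> y \<otimes>\<^bsub>G\<^esub> inv_into W \<phi> z"
    have c1: "continuous_on (\<psi> ` V \<times> \<phi> ` W) (\<lambda>a. (inv_into V \<psi> (fst a), inv_into W \<phi> (snd a)))"
      by (intro continuous_on_Pair continuous_on_compose2[OF is_chartD(5)[OF cV]]
          continuous_on_compose2[OF is_chartD(5)[OF cW]] continuous_intros) auto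
    have "continuous_on (\<psi> ` V \<times> \<phi> ` W) (\<lambda>a. ?m (inv_into V \<psi> (fst a), inv_into W \<phi> (snd a)))"
      by (rule continuous_on_compose2[OF continuous_mult c1]) auto
    then have "continuous_on (\<psi> ` V \<times> \<phi> ` W) ?h" by (simp add: case_prod_unfold)
    then have "open (\<psi> ` V \<times> \<phi> ` W \<inter> ?h -` N)"
      by (rule continuous_open_preimage[OF _ open_Times[OF is_chartD(2)[OF cV] is_chartD(2)[OF cW]] N])
    moreover have "\<psi> ` V \<times> \<phi> ` W \<inter> ?h -` N = ?\<Phi> ` (V \<times> W \<inter> ?m -` N)"
      using inj by (force simp: image_iff)
    ultimately show ?thesis by simp
  qed
  have \<Omega>: "\<Omega> = ?\<Phi> ` (V \<times> W \<inter> ?m -` U)" by (auto simp: \<Omega>_def)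
  show "open \<Omega>" unfolding \<Omega> by (rule open_im[OF U(1)])
  show "smooth_on \<Omega> (\<lambda>(y, z). f (inv_into V \<psi> y \<otimes>\<^bsub>G\<^esub> inv_into W \<phi> z))"
  proof (rule smooth_on_local)
    fix a assume "a \<in> \<Omega>"
    then obtain p q where pq: "a = (\<psi> p, \<phi> q)" "p \<in> V" "q \<in> W" "p \<otimes>\<^bsub>G\<^esub> q \<in> U" by (auto simp: \<Omega>_def)
    obtain N \<theta> where N: "(N, \<theta>) \<in> A" "p \<otimes>\<^bsub>G\<^esub> q \<in> N" by (rule chart_at)
    have cN: "is_chart (N, \<theta>)" using smooth_chartD[OF smooth_chart_atlas[OF N(1)]] .
    let ?T = "?\<Phi> ` (V \<times> W \<inter> ?m -` (N \<inter> U))"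
    have T: "open ?T" by (intro open_im open_Int is_chartD(1)[OF cN] U)
    have sm: "smooth_map (prod_atlas A A) A ?m" using lie_group by (simp add: lie_group_def)
    have "(V \<times> W, ?\<Phi>) \<in> prod_atlas A A" using V W by (auto simp: prod_atlas_def)
    with sm N(1) have "smooth_on (?\<Phi> ` (V \<times> W \<inter> ?m -` N)) (\<theta> \<circ> ?m \<circ> inv_into (V \<times> W) ?\<Phi>)"
      unfolding smooth_map_def by fast
    then have "smooth_on ?T (\<theta> \<circ> ?m \<circ> inv_into (V \<times> W) ?\<Phi>)"
      by (rule smooth_on_subset) auto
    then have "smooth_on ?T (\<lambda>a. \<theta> (?m (inv_into (V \<times> W) ?\<Phi> a)))" unfolding o_def .
    moreover have "(\<lambda>a. \<theta> (?m (inv_into (V \<times> W) ?\<Phi> a))) ` ?T \<subseteq> \<theta> ` (N \<inter> U)"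
      using inv\<Phi> by auto
    moreover have "open (\<theta> ` (N \<inter> U))" by (rule open_chart_image[OF cN U(1)])
    moreover have "smooth_on (\<theta> ` (N \<inter> U)) (\<lambda>y. f (inv_into N \<theta> y))"
      by (rule smooth_fun_chart[OF smooth_chart_atlas[OF N(1)] U])
    ultimately have "smooth_on ?T (\<lambda>a. f (inv_into N \<theta> (\<theta> (?m (inv_into (V \<times> W) ?\<Phi> a)))))"
      using smooth_on_compose[OF T] by blast
    then have "smooth_on ?T (\<lambda>(y, z). f (inv_into V \<psi> y \<otimes>\<^bsub>G\<^esub> inv_into W \<phi> z))"
      by (rule smooth_on_cong[OF T, rotated])
         (use inv\<Phi> inj is_chartD(3)[OF cN] in auto)
    then show "\<exists>T. open T \<and> a \<in> T \<and> smooth_on T (\<lambda>(y, z). f (inv_into V \<psi> y \<otimes>\<^bsub>G\<^esub> inv_into W \<phi> z))"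
      using T pq N by (intro exI[of _ ?T]) auto
  qed
qed

lemma smooth_fun_left_translate:
  assumes U: "open U" "smooth_fun A U f"
  shows "smooth_fun A {h. g \<otimes>\<^bsub>G\<^esub> h \<in> U} (\<lambda>h. f (g \<otimes>\<^bsub>G\<^esub> h))"
proof (rule smooth_funI)
  fix h assume h: "h \<in> {h. g \<otimes>\<^bsub>G\<^esub> h \<in> U}"
  obtain W \<phi> where W: "(W, \<phi>) \<in> A" "h \<in> W" by (rule chart_at)
  obtain V \<psi> where V: "(V, \<psi>) \<in> A" "g \<in> V" by (rule chart_at)
  have cV: "is_chart (V, \<psi>)" and cW: "is_chart (W, \<phi>)"
    using smooth_chartD[OF smooth_chart_atlas] V W by auto
  note inj = is_chartD(3)[OF cV] is_chartD(3)[OF cW]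
  let ?D = "W \<inter> {h. g \<otimes>\<^bsub>G\<^esub> h \<in> U}"
  have D: "open ?D" by (intro open_Int open_left_preimage U is_chartD(1)[OF cW])
  have oD: "open (\<phi> ` ?D)" by (intro open_chart_image[OF cW] open_left_preimage U)
  \<comment> \<open>The first factor is frozen at the coordinates \<open>\<psi> g\<close> of
    \<open>g\<close>.\<close>
  have "smooth_on (\<phi> ` ?D) (\<lambda>z. (\<lambda>(y, z). f (inv_into V \<psi> y \<otimes>\<^bsub>G\<^esub> inv_into W \<phi> z)) (\<psi> g, z))"
    by (rule smooth_on_compose[OF oD smooth_mult(1)[OF V(1) W(1) U] _ _ smooth_mult(2)[OF V(1) W(1) U]])
       (use V in \<open>auto intro!: smooth_on_Pair oD smooth_on_const smooth_on_linear[OF bounded_linear_ident]\<close>)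
  then have "smooth_on (\<phi> ` ?D) (\<lambda>z. f (g \<otimes>\<^bsub>G\<^esub> inv_into W \<phi> z))"
    using inj V by simp
  then show "\<exists>V x D. smooth_chart A (V, x) \<and> open D \<and> h \<in> D \<and> D \<subseteq> V \<and>
      smooth_on (x ` D) (\<lambda>y. f (g \<otimes>\<^bsub>G\<^esub> inv_into V x y))"
    using smooth_chart_atlas[OF W(1)] D h W(2) by blast
qed

lemma smooth_at_left_translate: "smooth_at A h (\<lambda>x. f (g \<otimes>\<^bsub>G\<^esub> x)) \<longleftrightarrow> smooth_at A (g \<otimes>\<^bsub>G\<^esub> h) f"
proof -
  have *: "smooth_at A h (\<lambda>x. f (g \<otimes>\<^bsub>G\<^esub> x))" if sm: "smooth_at A (g \<otimes>\<^bsub>G\<^esub> h) f" for f g h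
  proof -
    obtain U where U: "open U" "g \<otimes>\<^bsub>G\<^esub> h \<in> U" "smooth_fun A U f"
      using sm unfolding smooth_at_def by blast
    show ?thesis
      by (rule smooth_atI[OF open_left_preimage[OF U(1)] _ smooth_fun_left_translate[OF U(1,3)]])
         (use U(2) in simp)
  qed
  show ?thesis
  proof
    assume "smooth_at A h (\<lambda>x. f (g \<otimes>\<^bsub>G\<^esub> x))"
    then have "smooth_at A (inv\<^bsub>G\<^esub> g \<otimes>\<^bsub>G\<^esub> (g \<otimes>\<^bsub>G\<^esub> h)) (\<lambda>x. f (g \<otimes>\<^bsub>G\<^esub> x))" by simp
    from *[OF this] show "smooth_at A (g \<otimes>\<^bsub>G\<^esub> h) f" by simp
  qed (rule *)
qed

section \<open>Left translation of tangent vectors\<close>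

lemma left_push_left_push: "left_push G g (left_push G h \<tau>) = left_push G (g \<otimes>\<^bsub>G\<^esub> h) \<tau>"
  by (simp add: left_push_def m_assoc)

lemma left_push_one: "left_push G \<one>\<^bsub>G\<^esub> \<tau> = \<tau>"
  by (simp add: left_push_def)

lemma linear_left_push: "linear (left_push G g)"
  by (rule linearI) (simp_all add: left_push_def fun_eq_iff scaleR_fun_def)

lemma left_push_tangent:
  assumes "\<tau> \<in> tangent_space A h"
  shows "left_push G g \<tau> \<in> tangent_space A (g \<otimes>\<^bsub>G\<^esub> h)"
proof -
  obtain W \<phi> where W: "(W, \<phi>) \<in> A" "h \<in> W" by (rule chart_at)
  obtain V \<psi> where V: "(V, \<psi>) \<in> A" "g \<otimes>\<^bsub>G\<^esub> h \<in> V" by (rule chart_at)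
  note sV = smooth_chart_atlas[OF V(1)] and sW = smooth_chart_atlas[OF W(1)]
  note cV = smooth_chartD[OF sV] and cW = smooth_chartD[OF sW]
  obtain v where v: "\<tau> = dir_deriv A (W, \<phi>) h v" using assms tangent_space_chart[OF sW W(2)] by blast
  let ?\<gamma> = "\<lambda>z. g \<otimes>\<^bsub>G\<^esub> inv_into W \<phi> z"
  let ?T = "\<phi> ` (W \<inter> {h. g \<otimes>\<^bsub>G\<^esub> h \<in> V})"
  have T: "open ?T" "\<phi> h \<in> ?T"
    using open_chart_image[OF cW open_left_preimage[OF is_chartD(1)[OF cV]]] V W by auto
  have inv: "inv_into W \<phi> (\<phi> h) = h" using is_chartD(3)[OF cW] W by simp
  have "smooth_on ?T (\<lambda>z. \<psi> (?\<gamma> z))"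
    by (rule smooth_on_vec[OF T(1)])
       (rule smooth_fun_chart[OF sW open_left_preimage[OF is_chartD(1)[OF cV]]
          smooth_fun_left_translate[OF is_chartD(1)[OF cV] smooth_fun_coordinate[OF sV]]])
  from smooth_on_imp_has_derivative[OF this T(2)] obtain D
    where D: "((\<lambda>z. \<psi> (?\<gamma> z)) has_derivative D) (at (\<phi> h))" by blast
  have "left_push G g \<tau> f = dir_deriv A (V, \<psi>) (g \<otimes>\<^bsub>G\<^esub> h) (D v) f" for f
  proof (cases "smooth_at A (g \<otimes>\<^bsub>G\<^esub> h) f")
    case True
    have "((\<lambda>s. f (?\<gamma> s)) has_derivative
      (\<lambda>h'. frechet_derivative (f \<circ> inv_into V \<psi>) (at (\<psi> (?\<gamma> (\<phi> h)))) (D h'))) (at (\<phi> h))"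
      by (rule has_derivative_along[OF sV _ T _ D]) (use True inv is_chartD(3)[OF cW] in auto)
    from frechet_derivativeI[OF this] show ?thesis
      using True by (simp add: left_push_def v dir_deriv_def smooth_at_left_translate inv o_def)
  qed (simp add: left_push_def v dir_deriv_def smooth_at_left_translate)
  then have "left_push G g \<tau> = dir_deriv A (V, \<psi>) (g \<otimes>\<^bsub>G\<^esub> h) (D v)" by blast
  then show ?thesis using tangent_space_chart[OF sV V(2)] by blast
qed

text \<open>Applied to \<open>f\<close>, the field at \<open>q\<close> is the derivative of
  \<open>f (q \<otimes> z)\<close> in \<open>z\<close> at the identity. This is a partial derivative
  of a function jointly smooth in \<open>q\<close> and \<open>z\<close>, hence smooth in
  \<open>q\<close>.\<close>

lemma left_inv_field_vector_field:
  assumes u: "u \<in> lie_algebra G A"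
  shows "left_inv_field G u \<in> vector_fields A"
  unfolding vector_fields_def
proof (intro CollectI conjI allI impI)
  show "left_inv_field G u p \<in> tangent_space A p" for p
    using left_push_tangent[OF u, of p] by (simp add: left_inv_field_def)
  fix U f assume U: "open U" "smooth_fun A U f"
  obtain W \<phi> where W: "(W, \<phi>) \<in> A" "\<one>\<^bsub>G\<^esub> \<in> W" by (rule chart_at)
  note sW = smooth_chart_atlas[OF W(1)]
  note cW = smooth_chartD[OF sW]
  obtain v where v: "u = dir_deriv A (W, \<phi>) \<one>\<^bsub>G\<^esub> v" using u tangent_space_chart[OF sW W(2)] by blast
  show "smooth_fun A U (\<lambda>q. left_inv_field G u q f)"
  proof (rule smooth_funI)
    fix q0 assume q0: "q0 \<in> U"
    obtain V \<psi> where V: "(V, \<psi>) \<in> A" "q0 \<in> V" by (rule chart_at)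
    note sV = smooth_chart_atlas[OF V(1)]
    note cV = smooth_chartD[OF sV]
    note inj = is_chartD(3)[OF cV] is_chartD(3)[OF cW]
    let ?F = "\<lambda>(y, z). f (inv_into V \<psi> y \<otimes>\<^bsub>G\<^esub> inv_into W \<phi> z)"
    let ?\<Omega> = "(\<lambda>(p, q). (\<psi> p, \<phi> q)) ` (V \<times> W \<inter> {(p, q). p \<otimes>\<^bsub>G\<^esub> q \<in> U})"
    note F = smooth_mult[OF V(1) W(1) U]
    let ?D = "V \<inter> U"
    have oD: "open (\<psi> ` ?D)" by (rule open_chart_image[OF cV U(1)])
    have in\<Omega>: "(\<psi> q, \<phi> \<one>\<^bsub>G\<^esub>) \<in> ?\<Omega>" if "q \<in> ?D" for q using that W by auto
    have "smooth_on (\<psi> ` ?D) (\<lambda>y. (\<lambda>a. frechet_derivative ?F (at a) (0, v)) (y, \<phi> \<one>\<^bsub>G\<^esub>))"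
      by (rule smooth_on_compose[OF oD F(1) _ _ smooth_on_frechet_derivative[OF F(2)]])
         (use in\<Omega> in \<open>auto intro!: smooth_on_Pair oD smooth_on_const smooth_on_linear[OF bounded_linear_ident]\<close>)
    then have "smooth_on (\<psi> ` ?D) (\<lambda>y. left_inv_field G u (inv_into V \<psi> y) f)"
    proof (rule smooth_on_cong[OF oD, rotated])
      fix y assume "y \<in> \<psi> ` ?D"
      then obtain q where q: "y = \<psi> q" "q \<in> V" "q \<in> U" by blast
      have iq: "inv_into V \<psi> y = q" using inj q by simp
      have sm: "smooth_at A \<one>\<^bsub>G\<^esub> (\<lambda>x. f (q \<otimes>\<^bsub>G\<^esub> x))"
        using smooth_atI[OF U(1) q(3) U(2)] by (simp add: smooth_at_left_translate)
      have "((\<lambda>z. (y, z)) has_derivative (\<lambda>h. (0, h))) (at (\<phi> \<one>\<^bsub>G\<^esub>))"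
        by (auto intro!: derivative_eq_intros)
      from has_derivative_compose[OF this smooth_on_imp_has_derivative[OF F(2)]] in\<Omega>[of q] q
      have "((\<lambda>z. f (q \<otimes>\<^bsub>G\<^esub> inv_into W \<phi> z)) has_derivative
          (\<lambda>h. frechet_derivative ?F (at (y, \<phi> \<one>\<^bsub>G\<^esub>)) (0, h))) (at (\<phi> \<one>\<^bsub>G\<^esub>))"
        by (simp add: inj)
      from frechet_derivativeI[OF this]
      show "frechet_derivative ?F (at (y, \<phi> \<one>\<^bsub>G\<^esub>)) (0, v) = left_inv_field G u (inv_into V \<psi> y) f"
        using sm by (simp add: left_inv_field_def left_push_def v dir_deriv_def iq o_def)
    qed
    then show "\<exists>V x D. smooth_chart A (V, x) \<and> open D \<and> q0 \<in> D \<and> D \<subseteq> V \<and>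
      smooth_on (x ` D) (\<lambda>y. left_inv_field G u (inv_into V x y) f)"
      using sV is_chartD(1)[OF cV] U V q0 by (intro exI[of _ V] exI[of _ \<psi>] exI[of _ ?D]) auto
  qed
qed

lemma lie_bracket_lie_algebra:
  "u \<in> lie_algebra G A \<Longrightarrow> v \<in> lie_algebra G A \<Longrightarrow> lie_bracket G A u v \<in> lie_algebra G A"
  unfolding lie_bracket_def
  by (intro vf_bracket_tangent left_inv_field_vector_field)

lemma vf_bracket_left_inv_field:
  "vf_bracket A (left_inv_field G u) (left_inv_field G v) p = left_inv_field G (lie_bracket G A u v) p"
proof
  fix f
  have "smooth_at A \<one>\<^bsub>G\<^esub> (\<lambda>x. f (p \<otimes>\<^bsub>G\<^esub> x)) \<longleftrightarrow> smooth_at A p f"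
    by (simp add: smooth_at_left_translate)
  then show "vf_bracket A (left_inv_field G u) (left_inv_field G v) p f =
      left_inv_field G (lie_bracket G A u v) p f"
    by (simp add: vf_bracket_def lie_bracket_def left_inv_field_def left_push_def m_assoc)
qed

end


subsection \<open>The left symmetric product of a symplectic Lie group\<close>

locale symplectic_lie = lie G A
  for G :: "'g::{t2_space, second_countable_topology} monoid" and A :: "('g, real ^ 'n) chart set" +
  fixes \<omega> :: "'g two_form" and nabla :: "'g vfield \<Rightarrow> 'g vfield \<Rightarrow> 'g vfield"
  assumes symplectic: "symplectic_form A \<omega>" and invariant: "left_invariant_form G A \<omega>"
    and associated: "associated_connection G A \<omega> nabla"
begin

abbreviation T :: "'g tvec set" where "T \<equiv> lie_algebra G A"

abbreviation X :: "'g tvec \<Rightarrow> 'g vfield" where "X \<equiv> left_inv_field G"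

text \<open>The left symmetric product; by \<open>nabla_X\<close> its value at the identity
  determines the connection on all left invariant fields.\<close>

definition lprod :: "'g tvec \<Rightarrow> 'g tvec \<Rightarrow> 'g tvec" where
  "lprod u v = nabla (X u) (X v) \<one>\<^bsub>G\<^esub>"

lemma X_field: "u \<in> T \<Longrightarrow> X u \<in> vector_fields A"
  by (rule left_inv_field_vector_field)

lemma X_tangent: "u \<in> T \<Longrightarrow> X u p \<in> tangent_space A p"
  by (rule vector_field_tangent[OF X_field])

lemma X_one: "X u \<one>\<^bsub>G\<^esub> = u"
  by (simp add: left_inv_field_def left_push_one)

lemma linear_X: "linear (\<lambda>u. X u p)"
  unfolding left_inv_field_def by (rule linear_left_push)

lemma X_add_apply: "X (u + v) p f = X u p f + X v p f"
  by (simp add: linear_add[OF linear_X])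

lemma X_scale_apply: "X (c *\<^sub>R u) p f = c * X u p f"
  by (simp only: linear_scale[OF linear_X]) (simp add: scaleR_fun_def)

lemma tangent_diff: "u \<in> tangent_space A p \<Longrightarrow> v \<in> tangent_space A p \<Longrightarrow> u - v \<in> tangent_space A p"
  and tangent_zero: "0 \<in> tangent_space A p"
  using subspace_diff[OF subspace_tangent_space] subspace_0[OF subspace_tangent_space] by blast+

lemma X_surj:
  assumes "z \<in> tangent_space A p"
  obtains w where "w \<in> T" "z = X w p"
proof
  show "left_push G (inv\<^bsub>G\<^esub> p) z \<in> T" using left_push_tangent[OF assms, of "inv\<^bsub>G\<^esub> p"] by simp
  show "z = X (left_push G (inv\<^bsub>G\<^esub> p) z) p"
    by (simp add: left_inv_field_def left_push_left_push left_push_one)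
qed

lemma X_inj:
  assumes "X u p = X v p"
  shows "u = v"
proof -
  have "left_push G (inv\<^bsub>G\<^esub> p) (X u p) = left_push G (inv\<^bsub>G\<^esub> p) (X v p)" using assms by simp
  then show ?thesis by (simp add: left_inv_field_def left_push_left_push left_push_one)
qed

lemma form_linear:
  assumes "u \<in> tangent_space A p" "v \<in> tangent_space A p" "w \<in> tangent_space A p"
  shows "\<omega> p (a *\<^sub>R u + b *\<^sub>R v) w = a * \<omega> p u w + b * \<omega> p v w" "\<omega> p u v = - \<omega> p v u"
proof -
  have "is_two_form A \<omega>" using symplectic by (simp add: symplectic_form_def)
  note * = conjunct1[OF this[unfolded is_two_form_def], rule_format, OF assms]
  show "\<omega> p (a *\<^sub>R u + b *\<^sub>R v) w = a * \<omega> p u w + b * \<omega> p v w" by (rule conjunct1[OF *])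
  show "\<omega> p u v = - \<omega> p v u" by (rule conjunct2[OF *])
qed

lemma form_zero: "u \<in> tangent_space A p \<Longrightarrow> \<omega> p u 0 = 0"
  using form_linear(1)[of u p u u 0 0] form_linear(2)[of u p 0 u] tangent_zero by auto

lemma form_eqI:
  assumes "u \<in> tangent_space A p" "v \<in> tangent_space A p"
    and "\<And>w. w \<in> tangent_space A p \<Longrightarrow> \<omega> p u w = \<omega> p v w"
  shows "u = v"
proof -
  have "\<omega> p (u - v) w = 0" if "w \<in> tangent_space A p" for w
    using form_linear(1)[OF assms(1,2) that, of 1 "-1"] assms(3)[OF that] by simp
  then have "u - v = 0"
    by (rule conjunct2[OF conjunct2[OF symplectic[unfolded symplectic_form_def]], rule_format,
          OF tangent_diff[OF assms(1,2)]])
  then show ?thesis by simp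
qed

lemma form_X: "u \<in> T \<Longrightarrow> v \<in> T \<Longrightarrow> \<omega> p (X u p) (X v p) = \<omega> \<one>\<^bsub>G\<^esub> u v"
  using invariant[unfolded left_invariant_form_def, rule_format, of u "\<one>\<^bsub>G\<^esub>" v p]
  by (simp add: left_inv_field_def)

lemma connection:
  assumes "Y \<in> vector_fields A" "Z \<in> vector_fields A"
  shows "nabla Y Z \<in> vector_fields A"
    and "Y' \<in> vector_fields A \<Longrightarrow> nabla (Y + Y') Z = nabla Y Z + nabla Y' Z"
    and "Z' \<in> vector_fields A \<Longrightarrow> nabla Y (Z + Z') = nabla Y Z + nabla Y Z'"
    and "nabla (\<lambda>p. c *\<^sub>R Y p) Z = (\<lambda>p. c *\<^sub>R nabla Y Z p)"
    and "nabla Y (\<lambda>p. c *\<^sub>R Z p) = (\<lambda>p. Y p (\<lambda>q. c) *\<^sub>R Z p + c *\<^sub>R nabla Y Z p)"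
proof -
  have "connection A nabla" using associated by (simp add: associated_connection_def)
  note * = this[unfolded connection_def, rule_format, OF _ _ _ smooth_fun_const[of UNIV c]]
  show "nabla Y Z \<in> vector_fields A" by (rule *[OF assms assms(1), THEN conjunct1])
  show "nabla (Y + Y') Z = nabla Y Z + nabla Y' Z" if "Y' \<in> vector_fields A"
    by (rule *[OF assms(1) that assms(2), THEN conjunct2, THEN conjunct1])
  show "nabla (\<lambda>p. c *\<^sub>R Y p) Z = (\<lambda>p. c *\<^sub>R nabla Y Z p)"
    by (rule *[OF assms assms(1), THEN conjunct2, THEN conjunct2, THEN conjunct1])
  show "nabla Y (Z + Z') = nabla Y Z + nabla Y Z'" if "Z' \<in> vector_fields A"
    by (rule *[OF assms that, THEN conjunct2, THEN conjunct2, THEN conjunct2, THEN conjunct1])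
  show "nabla Y (\<lambda>p. c *\<^sub>R Z p) = (\<lambda>p. Y p (\<lambda>q. c) *\<^sub>R Z p + c *\<^sub>R nabla Y Z p)"
    by (rule *[OF assms assms(1), THEN conjunct2, THEN conjunct2, THEN conjunct2, THEN conjunct2])
qed

lemma lprod_T: "u \<in> T \<Longrightarrow> v \<in> T \<Longrightarrow> lprod u v \<in> T"
  unfolding lprod_def by (rule vector_field_tangent[OF connection(1)[OF X_field X_field]])

lemma form_nabla:
  assumes "u \<in> T" "v \<in> T" "w \<in> T"
  shows "\<omega> p (nabla (X u) (X v) p) (X w p) = - \<omega> \<one>\<^bsub>G\<^esub> v (lie_bracket G A u w)"
  using associated assms form_X[OF assms(2) lie_bracket_lie_algebra[OF assms(1,3)], of p]
  unfolding associated_connection_def by (simp add: vf_bracket_left_inv_field)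

lemma form_lprod:
  "u \<in> T \<Longrightarrow> v \<in> T \<Longrightarrow> w \<in> T \<Longrightarrow> \<omega> \<one>\<^bsub>G\<^esub> (lprod u v) w = - \<omega> \<one>\<^bsub>G\<^esub> v (lie_bracket G A u w)"
  using form_nabla[of u v w "\<one>\<^bsub>G\<^esub>"] by (simp add: lprod_def X_one)

text \<open>Both sides pair equally with every left invariant field, by invariance of the form and
  the defining formula. These fields fill each tangent space, so nondegeneracy applies.\<close>

lemma nabla_X:
  assumes "u \<in> T" "v \<in> T"
  shows "nabla (X u) (X v) p = X (lprod u v) p"
proof (rule form_eqI)
  show "nabla (X u) (X v) p \<in> tangent_space A p"
    by (rule vector_field_tangent[OF connection(1)[OF X_field X_field]]) (rule assms)+
  show "X (lprod u v) p \<in> tangent_space A p" by (intro X_tangent lprod_T assms)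
  fix z assume "z \<in> tangent_space A p"
  then obtain w where w: "w \<in> T" "z = X w p" by (rule X_surj)
  show "\<omega> p (nabla (X u) (X v) p) z = \<omega> p (X (lprod u v) p) z"
    using w assms by (simp add: form_nabla form_X lprod_T form_lprod)
qed

lemma lprod_add1: "u \<in> T \<Longrightarrow> u' \<in> T \<Longrightarrow> v \<in> T \<Longrightarrow> lprod (u + u') v = lprod u v + lprod u' v"
  and lprod_add2: "u \<in> T \<Longrightarrow> v \<in> T \<Longrightarrow> v' \<in> T \<Longrightarrow> lprod u (v + v') = lprod u v + lprod u v'"
  and lprod_scale1: "u \<in> T \<Longrightarrow> v \<in> T \<Longrightarrow> lprod (c *\<^sub>R u) v = c *\<^sub>R lprod u v"
  and lprod_scale2: "u \<in> T \<Longrightarrow> v \<in> T \<Longrightarrow> lprod u (c *\<^sub>R v) = c *\<^sub>R lprod u v"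
proof -
  have add: "X (a + b) = X a + X b" for a b by (simp add: fun_eq_iff linear_add[OF linear_X])
  have scale: "X (c *\<^sub>R a) = (\<lambda>p. c *\<^sub>R X a p)" for c a by (simp add: fun_eq_iff linear_scale[OF linear_X])
  show "u \<in> T \<Longrightarrow> u' \<in> T \<Longrightarrow> v \<in> T \<Longrightarrow> lprod (u + u') v = lprod u v + lprod u' v"
    by (simp only: lprod_def add connection(2) X_field plus_fun_apply)
  show "u \<in> T \<Longrightarrow> v \<in> T \<Longrightarrow> v' \<in> T \<Longrightarrow> lprod u (v + v') = lprod u v + lprod u v'"
    by (simp only: lprod_def add connection(3) X_field plus_fun_apply)
  show "u \<in> T \<Longrightarrow> v \<in> T \<Longrightarrow> lprod (c *\<^sub>R u) v = c *\<^sub>R lprod u v"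
    by (simp only: lprod_def scale connection(4) X_field)
  show "u \<in> T \<Longrightarrow> v \<in> T \<Longrightarrow> lprod u (c *\<^sub>R v) = c *\<^sub>R lprod u v"
    by (simp add: lprod_def scale connection(5) X_field tangent_const[OF X_tangent])
qed

text \<open>Left multiplications are the negative adjoints of the inner derivations, so that products of
  sufficiently many of them vanish on a nilpotent Lie algebra.\<close>

lemma foldr_lprod_T: "set us \<subseteq> T \<Longrightarrow> v \<in> T \<Longrightarrow> foldr lprod us v \<in> T"
  by (induction us) (auto intro: lprod_T)

text \<open>Each left multiplication moves to the second argument of the form as a bracket, one step
  down the lower central series; \<open>j\<close> counts the steps already made there.\<close>

lemma form_foldr_lprod:
  assumes "lower_central G A (j + length us) = {0}" "set us \<subseteq> T" "v \<in> T" "w \<in> T" "w \<in> lower_central G A j"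
  shows "\<omega> \<one>\<^bsub>G\<^esub> (foldr lprod us v) w = 0"
  using assms
proof (induction us arbitrary: j w)
  case Nil
  have "w \<in> {0}" using Nil.prems(1,5) by (simp only: list.size add_0_right)
  then show ?case using form_zero[OF Nil.prems(3)] by (simp only: foldr.simps id_apply singleton_iff)
next
  case (Cons u us)
  have "lie_bracket G A u w \<in> lower_central G A (Suc j)"
    using Cons.prems by (auto intro!: span_base)
  moreover have "lie_bracket G A u w \<in> T" using Cons.prems by (intro lie_bracket_lie_algebra) auto
  ultimately have "\<omega> \<one>\<^bsub>G\<^esub> (foldr lprod us v) (lie_bracket G A u w) = 0"
    using Cons.prems by (intro Cons.IH[of "Suc j"]) auto
  then show ?case using Cons.prems by (simp add: form_lprod foldr_lprod_T)
qed

lemma foldr_lprod_zero: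
  assumes "lower_central G A (length us) = {0}" "set us \<subseteq> T" "v \<in> T"
  shows "foldr lprod us v = 0"
proof (rule form_eqI[OF foldr_lprod_T[OF assms(2,3)] tangent_zero])
  fix w assume w: "w \<in> T"
  have "\<omega> \<one>\<^bsub>G\<^esub> 0 w = 0" using form_linear(2)[OF tangent_zero w w] form_zero[OF w] by simp
  moreover have "\<omega> \<one>\<^bsub>G\<^esub> (foldr lprod us v) w = 0"
    by (rule form_foldr_lprod[of 0]) (use assms w in auto)
  ultimately show "\<omega> \<one>\<^bsub>G\<^esub> (foldr lprod us v) w = \<omega> \<one>\<^bsub>G\<^esub> 0 w" by simp
qed

end


subsection \<open>Left invariant fields in an affine chart\<close>

text \<open>An affine chart need not contain the identity, so an arbitrary point \<open>p0\<close>
  of it takes over as base point.\<close>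

locale symplectic_affine_chart = symplectic_lie G A \<omega> nabla
  for G :: "'g::{t2_space, second_countable_topology} monoid" and A :: "('g, real ^ 'n) chart set"
    and \<omega> nabla +
  fixes U :: "'g set" and x :: "'g \<Rightarrow> real ^ 'n" and p0 :: 'g
  assumes affine: "affine_chart A nabla (U, x)" and p0: "p0 \<in> U"
begin

lemma chart: "smooth_chart A (U, x)"
  using affine by (simp add: affine_chart_def)

lemma inj_x: "inj_on x U" and open_U: "open U"
  using is_chartD[OF smooth_chartD[OF chart]] by auto

text \<open>Parallelism of the coordinate differentials, evaluated on two left invariant fields. It
  is the source of the structure equation of the frame and of the two algebraic identities that
  follow.\<close>

lemma X_X_coordinate:
  assumes "u \<in> T" "v \<in> T" "q \<in> U"
  shows "X u q (\<lambda>q. X v q (\<lambda>q. x q $ i)) = X (lprod u v) q (\<lambda>q. x q $ i)"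
proof -
  have "cov_deriv_form nabla (X u) (differential (\<lambda>q. x q $ i)) (X v) q = 0"
    using affine assms X_field unfolding affine_chart_def by blast
  then show ?thesis using assms by (simp add: cov_deriv_form_def differential_def nabla_X)
qed

lemma X_eqI:
  assumes "u \<in> T" "v \<in> T" "\<And>i. X u p0 (\<lambda>q. x q $ i) = X v p0 (\<lambda>q. x q $ i)"
  shows "u = v"
  using tangent_eqI[OF chart p0 X_tangent[OF assms(1)] X_tangent[OF assms(2)] assms(3)] X_inj by blast

text \<open>Torsion freeness, read off from the flat coordinates: on them the bracket is a
  commutator of double derivatives, each of which is given by \<open>lprod\<close>.\<close>

lemma lie_bracket_lprod:
  assumes "u \<in> T" "v \<in> T"
  shows "lie_bracket G A u v = lprod u v - lprod v u"
proof (rule X_eqI)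
  show "lie_bracket G A u v \<in> T" "lprod u v - lprod v u \<in> T"
    using assms by (simp_all add: lie_bracket_lie_algebra tangent_diff lprod_T)
  fix i
  have "X (lie_bracket G A u v) p0 (\<lambda>q. x q $ i) = X (lprod u v) p0 (\<lambda>q. x q $ i) - X (lprod v u) p0 (\<lambda>q. x q $ i)"
    using smooth_at_coordinate[OF chart p0] assms p0
    by (simp flip: vf_bracket_left_inv_field) (simp add: vf_bracket_def X_X_coordinate)
  then show "X (lie_bracket G A u v) p0 (\<lambda>q. x q $ i) = X (lprod u v - lprod v u) p0 (\<lambda>q. x q $ i)"
    by (simp add: linear_diff[OF linear_X])
qed

text \<open>Flatness, obtained by letting the bracket of \<open>u\<close> and \<open>w\<close> act
  on \<open>?f\<close> as a commutator. Two uses of \<open>X_X_coordinate\<close> turn a double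
  derivative of \<open>?f\<close> into an iterated product; the first happens under a tangent
  vector, hence \<open>tangent_local\<close>.\<close>

lemma lprod_flat:
  assumes u: "u \<in> T" and v: "v \<in> T" and w: "w \<in> T"
  shows "lprod u (lprod w v) - lprod w (lprod u v) = lprod (lprod u w - lprod w u) v"
proof (rule X_eqI)
  show "lprod u (lprod w v) - lprod w (lprod u v) \<in> T" "lprod (lprod u w - lprod w u) v \<in> T"
    using assms by (simp_all add: tangent_diff lprod_T)
  fix i
  let ?f = "\<lambda>q. X v q (\<lambda>q. x q $ i)"
  have sm: "smooth_at A p0 ?f"
    by (rule smooth_atI[OF open_U p0 vector_field_smooth[OF X_field[OF v] open_U smooth_fun_coordinate[OF chart]]])
  have twice: "X a p0 (\<lambda>q. X b q ?f) = X (lprod a (lprod b v)) p0 (\<lambda>q. x q $ i)"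
    if "a \<in> T" "b \<in> T" for a b
  proof -
    have "X a p0 (\<lambda>q. X b q ?f) = X a p0 (\<lambda>q. X (lprod b v) q (\<lambda>q. x q $ i))"
      by (rule tangent_local[OF X_tangent[OF that(1)] open_U p0]) (rule X_X_coordinate[OF that(2) v])
    then show ?thesis using X_X_coordinate[OF that(1) lprod_T[OF that(2) v] p0] by simp
  qed
  have "X (lie_bracket G A u w) p0 ?f = X u p0 (\<lambda>q. X w q ?f) - X w p0 (\<lambda>q. X u q ?f)"
    using sm by (simp flip: vf_bracket_left_inv_field) (simp add: vf_bracket_def)
  moreover have "X (lie_bracket G A u w) p0 ?f = X (lprod (lie_bracket G A u w) v) p0 (\<lambda>q. x q $ i)"
    by (rule X_X_coordinate[OF lie_bracket_lie_algebra[OF u w] v p0])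
  ultimately show "X (lprod u (lprod w v) - lprod w (lprod u v)) p0 (\<lambda>q. x q $ i) =
      X (lprod (lprod u w - lprod w u) v) p0 (\<lambda>q. x q $ i)"
    by (simp add: twice u w lie_bracket_lprod linear_diff[OF linear_X])
qed

text \<open>Chosen so that the left invariant field of \<open>\<tau> v\<close> has components
  \<open>v\<close> at \<open>p0\<close>; this normalises the frame \<open>E\<close> to the identity
  at \<open>x p0\<close>.\<close>

definition \<tau> :: "real ^ 'n \<Rightarrow> 'g tvec" where
  "\<tau> v = left_push G (inv\<^bsub>G\<^esub> p0) (dir_deriv A (U, x) p0 v)"

definition \<kappa> :: "'g tvec \<Rightarrow> real ^ 'n" where
  "\<kappa> t = (\<chi> i. X t p0 (\<lambda>q. x q $ i))"

lemma X_\<tau>: "X (\<tau> v) p0 = dir_deriv A (U, x) p0 v"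
  by (simp add: \<tau>_def left_inv_field_def left_push_left_push left_push_one)

lemma \<tau>_T: "\<tau> v \<in> T"
proof -
  have "dir_deriv A (U, x) p0 v \<in> tangent_space A p0" using tangent_space_chart[OF chart p0] by blast
  from left_push_tangent[OF this, of "inv\<^bsub>G\<^esub> p0"] show ?thesis by (simp add: \<tau>_def)
qed

lemma \<kappa>_\<tau>: "\<kappa> (\<tau> v) = v"
  by (simp add: \<kappa>_def X_\<tau> dir_deriv_coordinate[OF chart p0])

lemma \<tau>_\<kappa>: "t \<in> T \<Longrightarrow> \<tau> (\<kappa> t) = t"
  using tangent_eq_dir_deriv[OF chart p0 X_tangent[of t p0]] X_\<tau>[of "\<kappa> t"] X_inj
  by (simp add: \<kappa>_def)

lemma linear_\<tau>: "linear \<tau>"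
  unfolding \<tau>_def
  using linear_compose[OF linear_dir_deriv[OF chart p0] linear_left_push] by (simp add: o_def)

lemma linear_\<kappa>: "linear \<kappa>"
  by (rule linearI) (simp_all add: \<kappa>_def vec_eq_iff X_add_apply X_scale_apply)

definition m :: "real ^ 'n \<Rightarrow> real ^ 'n \<Rightarrow> real ^ 'n" where
  "m u v = \<kappa> (lprod (\<tau> u) (\<tau> v))"

definition E :: "real ^ 'n \<Rightarrow> real ^ 'n \<Rightarrow> real ^ 'n" where
  "E y v = (\<chi> i. X (\<tau> v) (inv_into U x y) (\<lambda>q. x q $ i))"

lemma \<tau>_m: "\<tau> (m u v) = lprod (\<tau> u) (\<tau> v)"
  by (simp add: m_def \<tau>_\<kappa> lprod_T \<tau>_T)

lemma \<tau>_foldr_m: "\<tau> (foldr m us v) = foldr lprod (map \<tau> us) (\<tau> v)"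
  by (induction us) (simp_all add: \<tau>_m)

lemma E_x: "q \<in> U \<Longrightarrow> E (x q) v $ i = X (\<tau> v) q (\<lambda>q. x q $ i)"
  using inj_x by (simp add: E_def)

lemma affine_frame:
  assumes K: "lower_central G A K = {0}"
  shows "affine_frame m E (x ` U) (x p0) K"
proof (rule affine_frame.intro)
  show "bilinear m"
    unfolding bilinear_def
    by (auto intro!: linearI simp: m_def linear_add[OF linear_\<tau>] linear_scale[OF linear_\<tau>] \<tau>_T lprod_T
        lprod_add1 lprod_add2 lprod_scale1 lprod_scale2 linear_add[OF linear_\<kappa>] linear_scale[OF linear_\<kappa>])
  show S: "open (x ` U)" using is_chartD(2)[OF smooth_chartD[OF chart]] .
  show "connected (x ` U)"
    using affine is_chartD(4)[OF smooth_chartD[OF chart]]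
    by (intro connected_continuous_image) (auto simp: affine_chart_def)
  show "x p0 \<in> x ` U" using p0 by simp
  show "E (x p0) v = v" for v
    by (simp add: vec_eq_iff E_x[OF p0] X_\<tau> dir_deriv_coordinate[OF chart p0])
  show sE: "smooth_on (x ` U) (\<lambda>y. E y v)" for v
    unfolding E_def by (rule smooth_vector_field_components[OF chart X_field[OF \<tau>_T]])
  show "m u (m w v) - m w (m u v) = m (m u w - m w u) v" for u v w
    using arg_cong[OF lprod_flat[OF \<tau>_T \<tau>_T \<tau>_T, of u w v], of \<kappa>]
    by (simp add: m_def linear_diff[OF linear_\<kappa>] linear_diff[OF linear_\<tau>] \<tau>_\<kappa> lprod_T \<tau>_T)
  \<comment> \<open>The index at which the lower central series vanishes is also a length at which
    products of left multiplications vanish.\<close>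
  show "foldr m us v = 0" if "length us = K" for us v
  proof -
    have "\<tau> (foldr m us v) = 0"
      unfolding \<tau>_foldr_m by (rule foldr_lprod_zero) (use K that \<tau>_T in auto)
    then have "\<kappa> (\<tau> (foldr m us v)) = \<kappa> 0" by simp
    then show ?thesis by (simp add: \<kappa>_\<tau> linear_0[OF linear_\<kappa>])
  qed
  fix y assume y: "y \<in> x ` U"
  then obtain q where q: "q \<in> U" "y = x q" by blast
  show linE: "linear (E y)"
    by (rule linearI) (simp_all add: vec_eq_iff q(2) E_x[OF q(1)] linear_add[OF linear_\<tau>] linear_scale[OF linear_\<tau>]
        X_add_apply X_scale_apply)
  show "inj (E y)"
  proof (rule injI)
    fix v w assume "E y v = E y w"
    then have "E (x q) v $ i = E (x q) w $ i" for i by (simp add: q(2))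
    then have "X (\<tau> v) q = X (\<tau> w) q"
      unfolding E_x[OF q(1)] by (rule tangent_eqI[OF chart q(1) X_tangent[OF \<tau>_T] X_tangent[OF \<tau>_T]])
    then show "v = w" using X_inj \<kappa>_\<tau> by metis
  qed
  show "frechet_derivative (\<lambda>y. E y v) (at y) (E y u) = E y (m u v)" for u v
    unfolding vec_eq_iff
  proof
    fix i
    let ?f = "\<lambda>q. X (\<tau> v) q (\<lambda>q. x q $ i)"
    have sm: "smooth_at A q ?f"
      by (rule smooth_atI[OF open_U q(1) vector_field_smooth[OF X_field[OF \<tau>_T] open_U smooth_fun_coordinate[OF chart]]])
    have "((\<lambda>y. E y v $ i) has_derivative (\<lambda>h. frechet_derivative (\<lambda>y. E y v) (at y) h $ i)) (at y)"
      by (rule bounded_linear.has_derivative[OF bounded_linear_vec_nth smooth_on_imp_has_derivative[OF sE y]])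
    moreover have "(\<lambda>y. E y v $ i) = ?f \<circ> inv_into U x" by (auto simp: E_def)
    ultimately have "frechet_derivative (?f \<circ> inv_into U x) (at (x q)) (E y u) = frechet_derivative (\<lambda>y. E y v) (at y) (E y u) $ i"
      using frechet_derivativeI q(2) by metis
    moreover have "(\<chi> i. X (\<tau> u) q (\<lambda>q. x q $ i)) = E y u" by (simp add: vec_eq_iff q(2) E_x[OF q(1)])
    ultimately have "frechet_derivative (\<lambda>y. E y v) (at y) (E y u) $ i = X (\<tau> u) q ?f"
      using tangent_vector_apply[OF chart q(1) X_tangent[OF \<tau>_T] sm, of u] by simp
    then show "frechet_derivative (\<lambda>y. E y v) (at y) (E y u) $ i = E y (m u v) $ i"
      using q by (simp add: X_X_coordinate \<tau>_T E_x \<tau>_m)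
  qed
qed

text \<open>The functions \<open>x (p0 \<otimes> q) $ a\<close> of \<open>q\<close> are coordinates
  around the identity, with differentials there dual to the basis
  \<open>\<tau> (axis a 1)\<close>.\<close>

lemma lie_algebra_expand:
  assumes t: "t \<in> T"
  shows "t f = (\<Sum>a\<in>UNIV. t (\<lambda>q. x (p0 \<otimes>\<^bsub>G\<^esub> q) $ a) * \<tau> (axis a 1) f)"
proof -
  have lin: "linear (\<lambda>v. \<tau> v f)"
    by (rule linearI) (simp_all add: linear_add[OF linear_\<tau>] linear_scale[OF linear_\<tau>] scaleR_fun_def)
  have "t f = \<tau> (\<kappa> t) f" by (simp add: \<tau>_\<kappa> t)
  also have "\<dots> = (\<Sum>a\<in>UNIV. \<kappa> t $ a * \<tau> (axis a 1) f)" using linear_sum_axis[OF lin, of "\<kappa> t"] by simp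
  finally show ?thesis by (simp add: \<kappa>_def left_inv_field_def left_push_def)
qed

text \<open>The functions in \<open>hs\<close> fill the slots already expanded and do not depend on
  \<open>q\<close>. Tangency in the next slot replaces the coordinate translated by \<open>q\<close>
  by those translated by \<open>p0\<close>; the coefficients are entries of the frame, hence
  polynomial in \<open>x q\<close>. At the end \<open>P hs\<close> is a constant.\<close>

lemma multivector_polynomial:
  assumes K: "lower_central G A K = {0}"
    and P: "\<And>fs i. length fs = k \<Longrightarrow> i < k \<Longrightarrow> (\<lambda>f. P (fs[i := f])) \<in> T"
    and len: "length hs + length js = k"
  shows "\<exists>Q. real_polynomial_function Q \<and>
     (\<forall>q\<in>U. P (hs @ map (\<lambda>j z. x (q \<otimes>\<^bsub>G\<^esub> z) $ j) js) = Q (x q))"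
  using len
proof (induction js arbitrary: hs)
  case Nil
  show ?case by (auto intro: real_polynomial_const)
next
  case (Cons j js)
  interpret affine_frame m E "x ` U" "x p0" K by (rule affine_frame[OF K])
  have "\<exists>Q. real_polynomial_function Q \<and> (\<forall>q\<in>U. P ((hs @ [h]) @ map (\<lambda>j z. x (q \<otimes>\<^bsub>G\<^esub> z) $ j) js) = Q (x q))" for h
    by (rule Cons.IH) (use Cons.prems in simp)
  then obtain Q where Q: "\<And>h. real_polynomial_function (Q h)"
    "\<And>h q. q \<in> U \<Longrightarrow> P ((hs @ [h]) @ map (\<lambda>j z. x (q \<otimes>\<^bsub>G\<^esub> z) $ j) js) = Q h (x q)" by metis
  have "\<forall>a. \<exists>Q. real_polynomial_function Q \<and> (\<forall>y\<in>x ` U. E y (axis a 1) $ j = Q y)"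
    using E_polynomial by blast
  from choice[OF this] obtain R where R: "\<And>a. real_polynomial_function (R a)"
    "\<And>a y. y \<in> x ` U \<Longrightarrow> E y (axis a 1) $ j = R a y" by blast
  let ?h = "\<lambda>a z. x (p0 \<otimes>\<^bsub>G\<^esub> z) $ a"
  have "P (hs @ map (\<lambda>j z. x (q \<otimes>\<^bsub>G\<^esub> z) $ j) (j # js)) = (\<Sum>a\<in>UNIV. Q (?h a) (x q) * R a (x q))"
    if q: "q \<in> U" for q
  proof -
    let ?l = "map (\<lambda>j z. x (q \<otimes>\<^bsub>G\<^esub> z) $ j) js" and ?f = "\<lambda>z. x (q \<otimes>\<^bsub>G\<^esub> z) $ j"
    have "(\<lambda>f. P ((hs @ ?f # ?l)[length hs := f])) \<in> T"
      by (rule P) (use Cons.prems in auto)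
    then have "(\<lambda>f. P (hs @ f # ?l)) \<in> T" by simp
    from lie_algebra_expand[OF this, of ?f]
    have "P (hs @ ?f # ?l) = (\<Sum>a\<in>UNIV. P (hs @ ?h a # ?l) * \<tau> (axis a 1) ?f)" .
    moreover have "\<tau> (axis a 1) ?f = R a (x q)" for a
      using R(2)[of "x q" a] q by (simp add: E_x left_inv_field_def left_push_def)
    ultimately show ?thesis using Q(2)[OF q] by simp
  qed
  moreover have "real_polynomial_function (\<lambda>y. \<Sum>a\<in>UNIV. Q (?h a) y * R a y)"
    by (intro real_polynomial_function_sum finite real_polynomial_mult Q R)
  ultimately show ?case by (intro exI[of _ "\<lambda>y. \<Sum>a\<in>UNIV. Q (?h a) y * R a y"]) auto
qed

end

theorem theorem1p2:
  fixes G :: "'g::{t2_space, second_countable_topology} monoid"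
    and A :: "('g, real ^ 'n) chart set"
    and \<omega> :: "'g two_form"
    and nabla :: "'g vfield \<Rightarrow> 'g vfield \<Rightarrow> 'g vfield"
  assumes "symplectic_lie_group G A \<omega>"
    and "connected (UNIV :: 'g set)"
    and "nilpotent_lie_group G A"
    and "associated_connection G A \<omega> nabla"
  shows "(\<forall>k P. multivector_field A k P \<and> left_invariant_multivector G k P \<longrightarrow>
            polynomial_multivector_field A nabla k P) \<and>
         (\<forall>\<pi>. poisson_structure A \<pi> \<and> left_invariant_multivector G 2 \<pi> \<longrightarrow>
            polynomial_multivector_field A nabla 2 \<pi>)"
proof -
  interpret symplectic_lie G A \<omega> nabla
    using assms by unfold_locales (auto simp: symplectic_lie_group_def)
  obtain K where K: "lower_central G A K = {0}"
    using assms(3) by (auto simp: nilpotent_lie_group_def)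
  have main: "polynomial_multivector_field A nabla k P"
    if P: "multivector_field A k P" and inv: "left_invariant_multivector G k P" for k P
    unfolding polynomial_multivector_field_def
  proof (intro allI impI)
    fix U x and js :: "'n list"
    assume affine: "affine_chart A nabla (U, x)" and len: "length js = k"
    show "\<exists>Q. real_polynomial_function Q \<and> (\<forall>p\<in>U. P p (map (\<lambda>i q. x q $ i) js) = Q (x p))"
    proof (cases "U = {}")
      case True
      then show ?thesis by (auto intro: real_polynomial_const)
    next
      case False
      then obtain p0 where "p0 \<in> U" by blast
      then interpret symplectic_affine_chart G A \<omega> nabla U x p0
        using affine by unfold_locales
      have "multivector_at A k \<one>\<^bsub>G\<^esub> (P \<one>\<^bsub>G\<^esub>)" using P by (simp add: multivector_field_def)
      then have "\<exists>Q. real_polynomial_function Q \<and>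
          (\<forall>q\<in>U. P \<one>\<^bsub>G\<^esub> ([] @ map (\<lambda>j z. x (q \<otimes>\<^bsub>G\<^esub> z) $ j) js) = Q (x q))"
        by (intro multivector_polynomial[OF K, of k]) (auto simp: multivector_at_def len)
      \<comment> \<open>Left invariance moves the dependence on \<open>q\<close> from the
        multivector into the coordinate functions, leaving one fixed multivector at the
        identity.\<close>
      moreover have "P q (map (\<lambda>i q. x q $ i) js) = P \<one>\<^bsub>G\<^esub> (map (\<lambda>j z. x (q \<otimes>\<^bsub>G\<^esub> z) $ j) js)" for q
        using inv[unfolded left_invariant_multivector_def, rule_format, of "map (\<lambda>i q. x q $ i) js" q "\<one>\<^bsub>G\<^esub>"] len
        by (simp add: o_def)
      ultimately show ?thesis by simp
    qed
  qed
  then show ?thesis by (auto simp: poisson_structure_def)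
qed

end
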